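(* Let $\gamma>0$ and $\mu\in\mathcal{OS}\cap\mathcal{ID}$, with associated $\nu_1$. Suppose that there exists $n_1\in\mathbb N$ such that $\nu_1^{n_1*}\in\mathcal{S}_{\sharp}$. Then either $T(\mu,\gamma)=(0,\infty)$ or $T(\mu,\gamma)=\emptyset$. The equality $T(\mu,\gamma)=(0,\infty)$ holds if and only if $\nu_1\in\mathcal{S}(\gamma)$.
   Context: "Distribution" means probability distribution on $\mathbb R$; $\bar\xi(x)=\xi((x,\infty))$ is the tail of a measure $\xi$; $\rho^{n*}$ is the $n$-th convolution power; $\widehat\rho(\gamma)=\int_{-\infty}^\infty e^{\gamma x}\rho(dx)$. An integral $\int_a^b g\,d\rho$ is over $(a,b]$. $f\sim g$ means $\lim_{x\to\infty}f(x)/g(x)=1$; $f\asymp g$ means $0<\liminf_{x\to\infty}f(x)/g(x)\le\limsup_{x\to\infty}f(x)/g(x)<\infty$. $\rho\in\mathcal{L}(\gamma)$ if $\bar\rho(x)>0$ for all $x>0$ and $\bar\rho(x+a)\sim e^{-\gamma a}\bar\rho(x)$ for every $a\in\mathbb R$. $\rho\in\mathcal{S}(\gamma)$ if $\rho\in\mathcal{L}(\gamma)$, $\widehat\rho(\gamma)<\infty$ and $\overline{\rho^{2*}}(x)\sim 2\widehat\rho(\gamma)\bar\rho(x)$. $\rho\in\mathcal{OS}$ if $\bar\rho(x)>0$ for all $x>0$ and $\overline{\rho^{2*}}(x)\asymp\bar\rho(x)$. $\rho\in\mathcal{S}_\sharp$ if $\rho\in\mathcal{OS}$ and $$\limsup_{A\to\infty}\limsup_{x\to\infty}\frac{\bar\rho(x-A)\bar\rho(A)+\int_A^{x-A}\bar\rho(x-u)\rho(du)}{\bar\rho(x)}=0.$$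 $\mathcal{ID}$ is the class of infinitely divisible distributions on $\mathbb R$. For $\mu\in\mathcal{ID}$, $\nu$ denotes its Lévy measure and $\mu^{t*}$ ($t>0$) its $t$-th convolution power (the distribution with characteristic function the $t$-th power of that of $\mu$, i.e. the law at time $t$ of the associated Lévy process). When $\bar\nu(c)>0$ for all $c>0$ (which is the case for $\mu\in\mathcal{OS}\cap\mathcal{ID}$), $\nu_1(dx):=1_{(1,\infty)}(x)\nu(dx)/\bar\nu(1)$. $T(\mu,\gamma):=\{t>0:\mu^{t*}\in\mathcal{L}(\gamma)\}$. *)

theory Defs
  imports "HOL-Probability.Probability"
begin

definition tail :: "real measure \<Rightarrow> real \<Rightarrow> real" where
  "tail \<xi> x = measure \<xi> {x<..}"

primrec conv_pow :: "real measure \<Rightarrow> nat \<Rightarrow> real measure" where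
  "conv_pow \<rho> 0 = return borel 0"
| "conv_pow \<rho> (Suc n) = (\<rho> \<star> conv_pow \<rho> n)"

definition exp_moment :: "real measure \<Rightarrow> real \<Rightarrow> ennreal" where
  "exp_moment \<rho> \<gamma> = (\<integral>\<^sup>+ x. ennreal (exp (\<gamma> * x)) \<partial>\<rho>)"

definition asymp_comparable :: "(real \<Rightarrow> real) \<Rightarrow> (real \<Rightarrow> real) \<Rightarrow> bool" where
  "asymp_comparable f g \<longleftrightarrow>
     0 < Liminf at_top (\<lambda>x. ereal (f x / g x)) \<and>
     Limsup at_top (\<lambda>x. ereal (f x / g x)) < \<infinity>"

definition class_L :: "real \<Rightarrow> real measure set" where
  "class_L \<gamma> = {\<rho>. real_distribution \<rho> \<and> (\<forall>x>0. tail \<rho> x > 0) \<and>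
     (\<forall>a. (\<lambda>x. tail \<rho> (x + a)) \<sim>[at_top] (\<lambda>x. exp (- \<gamma> * a) * tail \<rho> x))}"

definition class_S :: "real \<Rightarrow> real measure set" where
  "class_S \<gamma> = {\<rho>. \<rho> \<in> class_L \<gamma> \<and> exp_moment \<rho> \<gamma> < \<infinity> \<and>
     (\<lambda>x. tail (conv_pow \<rho> 2) x) \<sim>[at_top]
       (\<lambda>x. 2 * enn2real (exp_moment \<rho> \<gamma>) * tail \<rho> x)}"

definition class_OS :: "real measure set" where
  "class_OS = {\<rho>. real_distribution \<rho> \<and> (\<forall>x>0. tail \<rho> x > 0) \<and>
     asymp_comparable (tail (conv_pow \<rho> 2)) (tail \<rho>)}"

definition class_S_sharp :: "real measure set" where
  "class_S_sharp = {\<rho>. \<rho> \<in> class_OS \<and>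
     Limsup at_top (\<lambda>A::real. Limsup at_top (\<lambda>x::real. ereal
       ((tail \<rho> (x - A) * tail \<rho> A + (LINT u:{A<..x - A}|\<rho>. tail \<rho> (x - u))) / tail \<rho> x))) = 0}"

definition class_ID :: "real measure set" where
  "class_ID = {\<mu>. real_distribution \<mu> \<and>
     (\<forall>n\<ge>1. \<exists>\<rho>. real_distribution \<rho> \<and> conv_pow \<rho> n = \<mu>)}"

text \<open>
  \<open>levy_measure \<mu> \<nu>\<close>: \<open>\<nu>\<close> is the measure in a Levy-Khintchine representation of \<open>\<mu>\<close>, with Gaussian
  variance \<open>a\<close> and drift \<open>b\<close>. By the Levy-Khintchine theorem every infinitely divisible \<open>\<mu>\<close> has
  exactly one such \<open>\<nu>\<close>.
\<close>
definition levy_measure :: "real measure \<Rightarrow> real measure \<Rightarrow> bool" where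
  "levy_measure \<mu> \<nu> \<longleftrightarrow>
     sets \<nu> = sets borel \<and> emeasure \<nu> {0} = 0 \<and>
     (\<integral>\<^sup>+ x. ennreal (min 1 (x\<^sup>2)) \<partial>\<nu>) < \<infinity> \<and>
     (\<exists>a\<ge>0. \<exists>b::real. \<forall>z::real. char \<mu> z =
        exp (- complex_of_real (a * z\<^sup>2 / 2) + \<i> * complex_of_real (b * z) +
          (\<integral>x. (iexp (z * x) - 1 - \<i> * complex_of_real (z * x * indicator {-1..1} x)) \<partial>\<nu>)))"

definition levy_jump :: "real measure \<Rightarrow> real measure" where
  "levy_jump \<nu> = uniform_measure \<nu> {1<..}"

text \<open>
  The \<open>t\<close>-th power of the zero-free function \<open>char \<mu>\<close> is taken along its continuous logarithm
  \<open>\<psi>\<close> vanishing at \<open>0\<close>, not along the principal branch.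
\<close>
definition is_real_conv_pow :: "real measure \<Rightarrow> real \<Rightarrow> real measure \<Rightarrow> bool" where
  "is_real_conv_pow \<mu> t \<rho> \<longleftrightarrow> real_distribution \<rho> \<and>
     (\<exists>\<psi>::real \<Rightarrow> complex. continuous_on UNIV \<psi> \<and> \<psi> 0 = 0 \<and>
        (\<forall>z. char \<mu> z = exp (\<psi> z)) \<and> (\<forall>z. char \<rho> z = exp (complex_of_real t * \<psi> z)))"

lemma is_real_conv_pow_unique:
  assumes "is_real_conv_pow \<mu> t \<rho>" "is_real_conv_pow \<mu> t \<rho>'"
  shows "\<rho> = \<rho>'"
proof -
  obtain p where p: "continuous_on UNIV p" "p 0 = 0" "\<And>z. char \<mu> z = exp (p z)"
    "\<And>z. char \<rho> z = exp (complex_of_real t * p z)" and d: "real_distribution \<rho>"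
    using assms(1) unfolding is_real_conv_pow_def by blast
  obtain q where q: "continuous_on UNIV q" "q 0 = 0" "\<And>z. char \<mu> z = exp (q z)"
    "\<And>z. char \<rho>' z = exp (complex_of_real t * q z)" and d': "real_distribution \<rho>'"
    using assms(2) unfolding is_real_conv_pow_def by blast
  define h where "h z = (p z - q z) / (2 * of_real pi * \<i>)" for z :: real
  have h: "h z \<in> \<int>" for z
  proof -
    have "exp (p z) = exp (q z)" using p(3) q(3) by metis
    then obtain n :: int where "p z = q z + (of_int (2 * n) * pi) * \<i>"
      unfolding exp_eq by blast
    then have "h z = of_int n" by (simp add: h_def field_simps)
    then show ?thesis by simp
  qed
  have "h constant_on UNIV"
  proof (rule continuous_discrete_range_constant)
    show "connected (UNIV::real set)" by simp
    show "continuous_on UNIV h"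
      unfolding h_def by (intro continuous_intros p q) auto
    show "\<exists>e>0. \<forall>y. y \<in> UNIV \<and> h y \<noteq> h x \<longrightarrow> e \<le> norm (h y - h x)" for x
    proof (intro exI[of _ 1] conjI allI impI)
      fix y assume "y \<in> UNIV \<and> h y \<noteq> h x"
      then have "h y - h x \<in> \<int>" "h y - h x \<noteq> 0" using h by auto
      then obtain k :: int where k: "h y - h x = of_int k" "k \<noteq> 0"
        by (metis Ints_cases of_int_0)
      then show "1 \<le> norm (h y - h x)" by simp
    qed simp
  qed
  then have "h z = h 0" for z unfolding constant_on_def by auto
  then have "p z = q z" for z using p(2) q(2) by (simp add: h_def)
  then have "char \<rho> = char \<rho>'" using p(4) q(4) by auto
  then show ?thesis using Levy_uniqueness d d' by blast
qed

definition real_conv_pow :: "real measure \<Rightarrow> real \<Rightarrow> real measure" where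
  "real_conv_pow \<mu> t = (THE \<rho>. is_real_conv_pow \<mu> t \<rho>)"

definition T_set :: "real measure \<Rightarrow> real \<Rightarrow> real set" where
  "T_set \<mu> \<gamma> = {t. t > 0 \<and> real_conv_pow \<mu> t \<in> class_L \<gamma>}"

end

theory Submission
  imports Defs "HOL-Complex_Analysis.Complex_Analysis"
begin

text \<open>
  Write \<open>\<mu>\<^sup>t = \<pi> \<star> \<eta>\<close>, where \<open>\<pi>\<close> is the compound Poisson law of the jumps larger than \<open>1\<close>, with jump
  law \<open>\<rho>\<close>, and \<open>\<eta>\<close> has exponential moments of all positive orders. Let \<open>\<sigma>\<close> be the convolution power
  of \<open>\<rho>\<close> with the single big jump property. Along a sequence \<open>x\<^sub>k\<close> for which
  \<open>tail \<rho> (x\<^sub>k + a) / tail \<sigma> (x\<^sub>k)\<close> converges to some \<open>h a\<close> for all \<open>a\<close>, the passage to the limit acts on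
  convolutions as a derivation, so the limit belonging to \<open>\<pi>\<close> is proportional to \<open>h \<star> \<pi>\<close>, and that of
  \<open>\<mu>\<^sup>t\<close> to \<open>h \<star> \<pi> \<star> \<eta>\<close>. If \<open>\<mu>\<^sup>t\<close> is in \<open>class_L \<gamma>\<close>, this function is a multiple of \<open>exp (- \<gamma> a)\<close>.
  Both factors can then be removed: \<open>\<eta>\<close> by a Wiener theorem, which applies because the transform of an
  infinitely divisible law has no zeros, and \<open>\<pi>\<close> by the inverse exponential series. Hence \<open>h\<close> is itself a
  multiple of \<open>exp (- \<gamma> a)\<close> for every such sequence, which means \<open>\<rho> \<in> class_S \<gamma>\<close>. Conversely, for
  \<open>\<rho> \<in> class_S \<gamma>\<close> the same limit computation with \<open>\<sigma> = \<rho>\<close> applies to every \<open>t\<close>.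
\<close>

section \<open>Convolutions, tails and exponential moments\<close>

text \<open>\<open>class_OS\<close> only bounds ratios: \<open>tail \<rho>\<close> against
  \<open>tail \<sigma>\<close> need not converge and \<open>\<sigma>\<close> need not be
  long-tailed. Limits are therefore available only along subsequences. The two factors are removed
  by different means because their moments differ. Carleman's argument needs a transform that is
  analytic in a strip around the line \<open>Re w = \<gamma>\<close>. The law \<eta> provides one,
  having all positive exponential moments, whereas \<rho>, and with it \<pi>, has in general no
  exponential moment beyond the order \<gamma>. The inverse exponential series uses the moment of
  order \<gamma> alone. That moment is not assumed: it comes from Fatou's lemma, once the limit
  belonging to the power of \<mu> is known to be exponential. Nonnegativity of the jumps makes the
  tails of the powers of \<rho> increase with the exponent, which turns the bound on \<sigma>
  \<star> \<sigma> into a geometric bound on all powers; this lets the limit pass through the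
  Poisson sum. The limit of \<pi> cannot vanish, because \<sigma> is itself one of the powers mixed
  in \<pi>.\<close>

lemma real_distributionD:
  assumes "real_distribution M"
  shows "finite_measure M" "prob_space M" "sets M = sets borel" "space M = UNIV" "sigma_finite_measure M"
proof -
  interpret real_distribution M by fact
  show "finite_measure M" "prob_space M" "sets M = sets borel" "space M = UNIV" "sigma_finite_measure M"
    by unfold_locales auto
qed

lemma real_distributionI:
  "prob_space M \<Longrightarrow> sets M = sets borel \<Longrightarrow> real_distribution M"
  using sets_eq_imp_space_eq[of M borel]
  by (simp add: real_distribution_def real_distribution_axioms_def)

lemma real_distribution_return: "real_distribution (return borel (x::real))"
  by (intro real_distributionI prob_space_return) auto

lemma real_distribution_convolution:
  assumes "real_distribution \<alpha>" "real_distribution \<beta>"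
  shows "real_distribution (\<alpha> \<star> \<beta>)"
proof (rule real_distributionI)
  interpret a: real_distribution \<alpha> by fact
  interpret b: real_distribution \<beta> by fact
  interpret pair_prob_space \<alpha> \<beta> ..
  show "prob_space (\<alpha> \<star> \<beta>)"
    unfolding convolution_def by (rule prob_space_distr) measurable
qed simp

lemma integral_convolution:
  fixes f :: "real \<Rightarrow> 'b::{banach, second_countable_topology}"
  assumes "real_distribution \<alpha>" "real_distribution \<beta>" "integrable (\<alpha> \<star> \<beta>) f"
  shows "(\<integral>x. f x \<partial>(\<alpha> \<star> \<beta>)) = (\<integral>x. (\<integral>y. f (x + y) \<partial>\<beta>) \<partial>\<alpha>)"
proof -
  interpret a: real_distribution \<alpha> by fact
  interpret b: real_distribution \<beta> by fact
  interpret pair_prob_space \<alpha> \<beta> ..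
  have f[measurable]: "f \<in> borel_measurable borel"
    using borel_measurable_integrable[OF assms(3)] by simp
  have int: "integrable (\<alpha> \<Otimes>\<^sub>M \<beta>) (\<lambda>(x, y). f (x + y))"
    using assms(3) unfolding convolution_def
    by (subst (asm) integrable_distr_eq) (simp_all add: case_prod_unfold)
  have "(\<integral>x. f x \<partial>(\<alpha> \<star> \<beta>)) = (\<integral>z. (\<lambda>(x, y). f (x + y)) z \<partial>(\<alpha> \<Otimes>\<^sub>M \<beta>))"
    unfolding convolution_def by (subst integral_distr) (simp_all add: case_prod_unfold)
  also have "\<dots> = (\<integral>x. (\<integral>y. f (x + y) \<partial>\<beta>) \<partial>\<alpha>)"
    using integral_fst'[OF int] by simp
  finally show ?thesis .
qed

lemma tail_nonneg [simp]: "0 \<le> tail \<alpha> x"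
  by (simp add: tail_def)

lemma tail_le_1: "real_distribution \<alpha> \<Longrightarrow> tail \<alpha> x \<le> 1"
  by (simp add: tail_def prob_space.prob_le_1 real_distributionD)

lemma tail_antimono: "real_distribution \<alpha> \<Longrightarrow> x \<le> y \<Longrightarrow> tail \<alpha> y \<le> tail \<alpha> x"
  unfolding tail_def
  by (intro finite_measure.finite_measure_mono) (auto simp: real_distributionD)

lemma borel_measurable_antimono:
  fixes f :: "real \<Rightarrow> real"
  assumes "antimono f" shows "f \<in> borel_measurable borel"
proof -
  have "mono (\<lambda>x. - f x)" using assms by (auto simp: mono_def antimono_def)
  from borel_measurable_uminus[OF borel_measurable_mono[OF this]] show ?thesis by simp
qed

lemma measurable_tail [measurable]:
  assumes "real_distribution \<alpha>" shows "tail \<alpha> \<in> borel_measurable borel"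
  by (rule borel_measurable_antimono) (auto simp: antimono_def tail_antimono[OF assms])

lemma integrable_bounded:
  fixes f :: "real \<Rightarrow> 'b::{banach, second_countable_topology}"
  assumes "real_distribution \<alpha>" "f \<in> borel_measurable borel" "\<And>x. norm (f x) \<le> B"
  shows "integrable \<alpha> f"
proof -
  interpret a: real_distribution \<alpha> by fact
  show ?thesis using assms(2,3) by (intro a.integrable_const_bound[of _ B]) auto
qed

lemma tail_convolution:
  assumes "real_distribution \<alpha>" "real_distribution \<beta>"
  shows "tail (\<alpha> \<star> \<beta>) x = (\<integral>y. tail \<alpha> (x - y) \<partial>\<beta>)"
proof -
  have comm: "(\<alpha> \<star> \<beta>) = (\<beta> \<star> \<alpha>)"
    by (intro convolution_commutative) (auto simp: real_distributionD assms)
  note rd = real_distribution_convolution[OF assms(2,1)]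
  have "tail (\<alpha> \<star> \<beta>) x = (\<integral>y. indicator {x<..} y \<partial>(\<beta> \<star> \<alpha>))"
    unfolding comm tail_def by simp
  also have "\<dots> = (\<integral>y. (\<integral>u. indicator {x<..} (y + u) \<partial>\<alpha>) \<partial>\<beta>)"
    by (intro integral_convolution assms integrable_bounded[OF rd, of _ 1]) auto
  also have "\<dots> = (\<integral>y. (\<integral>u. indicator {x - y<..} u \<partial>\<alpha>) \<partial>\<beta>)"
    by (intro Bochner_Integration.integral_cong refl) (auto simp: indicator_def)
  also have "\<dots> = (\<integral>y. tail \<alpha> (x - y) \<partial>\<beta>)"
    unfolding tail_def by (simp add: real_distributionD assms)
  finally show ?thesis .
qed

lemma char_convolution:
  assumes "real_distribution \<alpha>" "real_distribution \<beta>"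
  shows "char (\<alpha> \<star> \<beta>) z = char \<alpha> z * char \<beta> z"
proof -
  interpret b: real_distribution \<beta> by fact
  have "char (\<alpha> \<star> \<beta>) z = (\<integral>x. (\<integral>y. iexp (z * (x + y)) \<partial>\<beta>) \<partial>\<alpha>)"
    unfolding char_def using real_distribution_convolution[OF assms]
    by (intro integral_convolution assms integrable_bounded[of _ _ 1]) auto
  also have "\<dots> = (\<integral>x. iexp (z * x) * char \<beta> z \<partial>\<alpha>)"
    unfolding char_def
    by (intro Bochner_Integration.integral_cong refl)
       (simp add: ring_distribs exp_add)
  finally show ?thesis by (simp add: char_def)
qed

lemma exp_moment_convolution:
  assumes "real_distribution \<alpha>" "real_distribution \<beta>"
  shows "exp_moment (\<alpha> \<star> \<beta>) \<gamma> = exp_moment \<alpha> \<gamma> * exp_moment \<beta> \<gamma>"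
proof -
  have [measurable_cong]: "sets \<alpha> = sets borel" "sets \<beta> = sets borel"
    by (auto simp: real_distributionD assms)
  show ?thesis
    unfolding exp_moment_def
    by (subst nn_integral_convolution)
       (auto simp: real_distributionD assms ring_distribs exp_add ennreal_mult
         nn_integral_cmult nn_integral_multc)
qed

lemma AE_convolution:
  assumes "real_distribution \<alpha>" "real_distribution \<beta>"
    and P: "AE x in \<alpha>. a \<le> x" and Q: "AE x in \<beta>. b \<le> x"
  shows "AE x in \<alpha> \<star> \<beta>. a + b \<le> x"
proof -
  have [measurable_cong]: "sets \<alpha> = sets borel" "sets \<beta> = sets borel"
    by (auto simp: real_distributionD assms)
  interpret a: real_distribution \<alpha> by fact
  interpret b: real_distribution \<beta> by fact
  interpret pair_prob_space \<alpha> \<beta> ..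
  have "AE z in \<alpha> \<Otimes>\<^sub>M \<beta>. a + b \<le> fst z + snd z"
  proof (rule AE_pair_measure)
    show "AE x in \<alpha>. AE y in \<beta>. a + b \<le> fst (x, y) + snd (x, y)"
      using P by eventually_elim (use Q in eventually_elim, auto)
  qed measurable
  then show ?thesis
    unfolding convolution_def by (subst AE_distr_iff) (auto simp: case_prod_beta)
qed

lemma real_distribution_conv_pow:
  "real_distribution \<rho> \<Longrightarrow> real_distribution (conv_pow \<rho> n)"
  by (induction n) (auto intro: real_distribution_return real_distribution_convolution)

lemma return_convolution:
  assumes "real_distribution \<rho>"
  shows "(return borel 0 \<star> \<rho>) = \<rho>"
proof -
  have "char (return borel 0 \<star> \<rho>) = char \<rho>"
    by (rule ext, subst char_convolution)
       (auto simp: real_distribution_return assms char_def integral_return)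
  then show ?thesis
    by (intro Levy_uniqueness real_distribution_convolution real_distribution_return assms)
qed

lemma convolution_comm:
  "real_distribution \<alpha> \<Longrightarrow> real_distribution \<beta> \<Longrightarrow> (\<alpha> \<star> \<beta>) = (\<beta> \<star> \<alpha>)"
  by (intro convolution_commutative) (auto simp: real_distributionD)

lemma convolution_assoc:
  "real_distribution \<alpha> \<Longrightarrow> real_distribution \<beta> \<Longrightarrow> real_distribution \<delta> \<Longrightarrow>
    ((\<alpha> \<star> \<beta>) \<star> \<delta>) = (\<alpha> \<star> (\<beta> \<star> \<delta>))"
  by (intro convolution_associative[symmetric]) (auto simp: real_distributionD)

lemma conv_pow_1: "real_distribution \<rho> \<Longrightarrow> conv_pow \<rho> (Suc 0) = \<rho>"
  by (simp add: convolution_comm[OF _ real_distribution_return] return_convolution)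

lemma conv_pow_2: "real_distribution \<rho> \<Longrightarrow> conv_pow \<rho> 2 = (\<rho> \<star> \<rho>)"
  using conv_pow_1[of \<rho>] by (simp add: numeral_2_eq_2)

lemma conv_pow_add:
  "real_distribution \<rho> \<Longrightarrow> conv_pow \<rho> (m + n) = (conv_pow \<rho> m \<star> conv_pow \<rho> n)"
  by (induction m)
     (auto simp: return_convolution convolution_assoc real_distribution_conv_pow)

lemma char_conv_pow: "real_distribution \<rho> \<Longrightarrow> char (conv_pow \<rho> n) z = char \<rho> z ^ n"
  by (induction n)
     (auto simp: char_convolution real_distribution_conv_pow char_def[of "return _ _"] integral_return)

lemma exp_moment_conv_pow:
  "real_distribution \<rho> \<Longrightarrow> exp_moment (conv_pow \<rho> n) \<gamma> = exp_moment \<rho> \<gamma> ^ n"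
  by (induction n)
     (auto simp: exp_moment_convolution real_distribution_conv_pow exp_moment_def[of "return _ _"]
       nn_integral_return)

lemma AE_conv_pow_nonneg:
  assumes "real_distribution \<rho>" "AE x in \<rho>. 0 \<le> x"
  shows "AE x in conv_pow \<rho> n. 0 \<le> x"
proof (induction n)
  case (Suc n)
  from AE_convolution[OF assms(1) real_distribution_conv_pow[OF assms(1)] assms(2) Suc]
  show ?case by (simp only: conv_pow.simps add_0)
next
  case 0
  have "AE x in return borel (0::real). 0 \<le> x" by (subst AE_return) auto
  then show ?case by (simp only: conv_pow.simps)
qed

text \<open>A nonnegative extra summand can only push the sum upwards. This allows any power to be
  compared with a later one whose exponent is a multiple of a given number.\<close>

lemma tail_conv_pow_mono:
  assumes "real_distribution \<rho>" "AE x in \<rho>. 0 \<le> x" "m \<le> n"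
  shows "tail (conv_pow \<rho> m) x \<le> tail (conv_pow \<rho> n) x"
  using \<open>m \<le> n\<close>
proof (induction n rule: dec_induct)
  case (step n)
  interpret real_distribution \<rho> by fact
  note rd = real_distribution_conv_pow[OF assms(1), of n]
  have "tail (conv_pow \<rho> n) x = (\<integral>y. tail (conv_pow \<rho> n) x \<partial>\<rho>)"
    using prob_space by simp
  also have "\<dots> \<le> (\<integral>y. tail (conv_pow \<rho> n) (x - y) \<partial>\<rho>)"
  proof (rule integral_mono_AE)
    show "AE y in \<rho>. tail (conv_pow \<rho> n) x \<le> tail (conv_pow \<rho> n) (x - y)"
      using assms(2) by eventually_elim (auto intro: tail_antimono rd)
    have [measurable]: "tail (conv_pow \<rho> n) \<in> borel_measurable borel" by (rule measurable_tail[OF rd])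
    show "integrable \<rho> (\<lambda>y. tail (conv_pow \<rho> n) (x - y))"
      by (rule integrable_bounded[OF assms(1), of _ 1]) (auto intro: tail_le_1 rd)
  qed simp
  also have "\<dots> = tail (conv_pow \<rho> n \<star> \<rho>) x"
    by (rule tail_convolution[OF rd assms(1), symmetric])
  also have "\<dots> = tail (conv_pow \<rho> (Suc n)) x"
    by (simp add: convolution_comm[OF rd assms(1)])
  finally show ?case using step.IH by simp
qed simp

section \<open>A Wiener theorem by Carleman's method\<close>

text \<open>Difference quotients are dominated by exponentials with slightly larger and smaller real
  parts, which openness of \<open>S\<close> provides. Weight \<open>q\<close> and exponent
  \<open>p\<close> are kept apart so that one statement serves transforms of measures, of bounded
  functions on a half-line and of functions on a product space.\<close>

lemma exp_integral_has_field_derivative: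
  fixes M :: "'a measure" and p q :: "'a \<Rightarrow> real"
  assumes [measurable]: "p \<in> borel_measurable M" "q \<in> borel_measurable M"
    and "open S" and int: "\<And>s. s \<in> S \<Longrightarrow> integrable M (\<lambda>x. \<bar>q x\<bar> * exp (s * p x))"
    and w0: "Re w0 \<in> S"
  shows "((\<lambda>w. \<integral>x. of_real (q x) * exp (w * of_real (p x)) \<partial>M) has_field_derivative
    (\<integral>x. of_real (q x) * of_real (p x) * exp (w0 * of_real (p x)) \<partial>M)) (at w0)"
    (is "(?f has_field_derivative ?D) _")
proof -
  obtain d where d: "d > 0" "cball (Re w0) d \<subseteq> S"
    using \<open>open S\<close> w0 open_contains_cball by blast
  define r where "r = d / 2"
  have r: "r > 0" "Re w0 + 2 * r \<in> S" "Re w0 - 2 * r \<in> S"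
    using d by (auto simp: r_def subset_eq dist_real_def)
  have intf: "integrable M (\<lambda>x. of_real (q x) * exp (w * of_real (p x)) :: complex)" if "Re w \<in> S" for w
    by (rule Bochner_Integration.integrable_bound[OF int[OF that]])
       (auto simp: norm_mult)
  \<comment> \<open>The quotient of \<open>exp (h * p x) - 1\<close> by \<open>h\<close> costs
    \<open>\<bar>p x\<bar> * exp (r * \<bar>p x\<bar>)\<close>, and \<open>\<bar>p x\<bar>\<close>
    is at most \<open>exp (r * \<bar>p x\<bar>) / r\<close>. This explains the shifts by
    \<open>2 * r\<close> and the factor \<open>1 / r\<close>; the sign of \<open>p x\<close> decides
    which exponential dominates.\<close>
  define W where "W x = (1 / r) * (\<bar>q x\<bar> * exp ((Re w0 + 2 * r) * p x) + \<bar>q x\<bar> * exp ((Re w0 - 2 * r) * p x))" for x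
  have W: "integrable M W"
    unfolding W_def by (intro integrable_mult_right Bochner_Integration.integrable_add int r)
  have bound: "norm ((of_real (q x) * exp ((w0 + h) * of_real (p x)) - of_real (q x) * exp (w0 * of_real (p x))) / h) \<le> W x"
    if h: "h \<noteq> 0" "norm h \<le> r" for h :: complex and x
  proof -
    let ?z = "h * of_real (p x)"
    have nz: "norm ?z \<le> r * \<bar>p x\<bar>"
      using h by (auto simp: norm_mult intro!: mult_right_mono)
    have "norm (exp ?z - 1) \<le> exp \<bar>Re ?z\<bar> * norm ?z"
      using Taylor_exp[of ?z 0] by simp
    also have "\<dots> \<le> exp (r * \<bar>p x\<bar>) * norm ?z"
      using nz abs_Re_le_cmod[of ?z] by (intro mult_right_mono) auto
    finally have 1: "norm (exp ?z - 1) \<le> exp (r * \<bar>p x\<bar>) * (norm h * \<bar>p x\<bar>)"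
      by (simp add: norm_mult)
    have "r * \<bar>p x\<bar> \<le> exp (r * \<bar>p x\<bar>)"
      using exp_ge_add_one_self[of "r * \<bar>p x\<bar>"] by linarith
    then have 2: "\<bar>p x\<bar> \<le> exp (r * \<bar>p x\<bar>) / r"
      using r by (simp add: field_simps)
    have "norm ((of_real (q x) * exp ((w0 + h) * of_real (p x)) - of_real (q x) * exp (w0 * of_real (p x))) / h)
        = \<bar>q x\<bar> * exp (Re w0 * p x) * (norm (exp ?z - 1) / norm h)"
    proof -
      have "of_real (q x) * exp ((w0 + h) * of_real (p x)) - of_real (q x) * exp (w0 * of_real (p x))
        = of_real (q x) * exp (w0 * of_real (p x)) * (exp ?z - 1)"
        by (simp add: ring_distribs exp_add)
      then show ?thesis by (simp add: norm_mult norm_divide)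
    qed
    also have "\<dots> \<le> \<bar>q x\<bar> * exp (Re w0 * p x) * (exp (r * \<bar>p x\<bar>) * \<bar>p x\<bar>)"
      using 1 h by (intro mult_left_mono) (auto simp: field_simps)
    also have "\<dots> \<le> \<bar>q x\<bar> * exp (Re w0 * p x) * (exp (r * \<bar>p x\<bar>) * (exp (r * \<bar>p x\<bar>) / r))"
      using 2 by (intro mult_left_mono) auto
    also have "\<dots> = (1 / r) * (\<bar>q x\<bar> * exp (Re w0 * p x + 2 * (r * \<bar>p x\<bar>)))"
      by (simp add: exp_add exp_double power2_eq_square)
    also have "\<dots> \<le> W x"
    proof -
      have "exp (Re w0 * p x + 2 * (r * \<bar>p x\<bar>)) \<le> exp ((Re w0 + 2 * r) * p x) + exp ((Re w0 - 2 * r) * p x)"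
        by (cases "p x \<ge> 0") (auto simp: algebra_simps add_increasing add_increasing2)
      then have "\<bar>q x\<bar> * exp (Re w0 * p x + 2 * (r * \<bar>p x\<bar>)) \<le>
          \<bar>q x\<bar> * (exp ((Re w0 + 2 * r) * p x) + exp ((Re w0 - 2 * r) * p x))"
        by (intro mult_left_mono) auto
      then show ?thesis using r unfolding W_def by (simp add: field_simps)
    qed
    finally show ?thesis .
  qed
  show ?thesis
    unfolding DERIV_def tendsto_at_iff_sequentially
  proof (intro allI impI)
    fix X :: "nat \<Rightarrow> complex"
    assume X0: "\<forall>i. X i \<in> UNIV - {0}" and X: "X \<longlonglongrightarrow> 0"
    from tendstoD[OF X r(1)] obtain N where N: "\<And>n. n \<ge> N \<Longrightarrow> norm (X n) < r"
      unfolding eventually_sequentially by auto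
    have ReS: "Re (w0 + X (n + N)) \<in> S" for n
      using N[of "n + N"] d abs_Re_le_cmod[of "X (n + N)"] by (auto simp: r_def subset_eq dist_real_def)
    let ?g = "\<lambda>n x. (of_real (q x) * exp ((w0 + X (n + N)) * of_real (p x)) - of_real (q x) * exp (w0 * of_real (p x))) / X (n + N)"
    have eq: "(?f (w0 + X (n + N)) - ?f w0) / X (n + N) = (\<integral>x. ?g n x \<partial>M)" for n
      by (subst Bochner_Integration.integral_diff[symmetric]) (auto intro!: intf ReS w0)
    have "(\<lambda>n. \<integral>x. ?g n x \<partial>M) \<longlonglongrightarrow> ?D"
    proof (rule integral_dominated_convergence[OF _ _ W])
      show "AE x in M. norm (?g n x) \<le> W x" for n
        using N[of "n + N"] X0 by (intro AE_I2 bound) auto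
      show "AE x in M. (\<lambda>n. ?g n x) \<longlonglongrightarrow> of_real (q x) * of_real (p x) * exp (w0 * of_real (p x))"
      proof (rule AE_I2)
        fix x
        have "((\<lambda>w. of_real (q x) * exp (w * of_real (p x))) has_field_derivative
            of_real (q x) * of_real (p x) * exp (w0 * of_real (p x))) (at w0)"
          by (auto intro!: derivative_eq_intros)
        then have "((\<lambda>h. (of_real (q x) * exp ((w0 + h) * of_real (p x)) - of_real (q x) * exp (w0 * of_real (p x))) / h)
           \<longlongrightarrow> of_real (q x) * of_real (p x) * exp (w0 * of_real (p x))) (at 0)"
          unfolding DERIV_def .
        from this[unfolded tendsto_at_iff_sequentially, rule_format, OF _ LIMSEQ_ignore_initial_segment[OF X, of N]]
        show "(\<lambda>n. ?g n x) \<longlonglongrightarrow> of_real (q x) * of_real (p x) * exp (w0 * of_real (p x))"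
          using X0 by (simp add: o_def)
      qed
    qed measurable
    then have "(\<lambda>n. (?f (w0 + X (n + N)) - ?f w0) / X (n + N)) \<longlonglongrightarrow> ?D"
      unfolding eq .
    then show "((\<lambda>h. (?f (w0 + h) - ?f w0) / h) \<circ> X) \<longlonglongrightarrow> ?D"
      unfolding o_def by (rule LIMSEQ_offset)
  qed
qed

lemma exp_integral_field_differentiable:
  fixes M :: "'a measure" and p q :: "'a \<Rightarrow> real"
  assumes "p \<in> borel_measurable M" "q \<in> borel_measurable M"
    and "open S" "\<And>s. s \<in> S \<Longrightarrow> integrable M (\<lambda>x. \<bar>q x\<bar> * exp (s * p x))" "Re w0 \<in> S"
  shows "(\<lambda>w. \<integral>x. of_real (q x) * exp (w * of_real (p x)) \<partial>M) field_differentiable (at w0)"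
  using exp_integral_has_field_derivative[OF assms] field_differentiable_def by blast

text \<open>The factor \<open>R\<^sup>2 + w\<^sup>2\<close> vanishes at \<open>\<plusminus>\<i> R\<close> and equals \<open>2 w Re w\<close> up to a unimodular
  factor on the circle of radius \<open>R\<close>, so it absorbs the singular bound near the imaginary axis.\<close>

lemma entire_bounded_by_inverse_Re_eq_0:
  fixes f :: "complex \<Rightarrow> complex"
  assumes hol: "f holomorphic_on UNIV"
    and bound: "\<And>w. Re w \<noteq> 0 \<Longrightarrow> norm (f w) \<le> B / \<bar>Re w\<bar>"
  shows "f w = 0"
proof -
  have B: "B \<ge> 0" using bound[of 1] order_trans[OF norm_ge_zero, of "f 1" B] by simp
  \<comment> \<open>For \<open>\<bar>w\<bar> \<le> R / 2\<close> the factor has modulus at least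
    \<open>3 / 4 * R\<^sup>2\<close> at \<open>w\<close>, while the maximum principle bounds the
    product by \<open>2 * R * B\<close>. The quotient is \<open>8 / 3 * B / R\<close>, rounded up to
    \<open>3 * B / R\<close>.\<close>
  have key: "norm (f w) \<le> 3 * B / R" if R: "R \<ge> 2 * norm w" "R > 0" for R
  proof -
    define F where "F z = ((of_real R)\<^sup>2 + z\<^sup>2) * f z" for z
    have "norm (F w) \<le> 2 * R * B"
    proof (rule maximum_modulus_frontier[of F "ball 0 R"])
      show "F holomorphic_on interior (ball 0 R)"
        unfolding F_def by (intro holomorphic_intros holomorphic_on_subset[OF hol]) auto
      show "continuous_on (closure (ball 0 R)) F"
        unfolding F_def
        by (intro continuous_intros holomorphic_on_imp_continuous_on holomorphic_on_subset[OF hol]) auto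
      show "bounded (ball (0::complex) R)" by simp
      show "w \<in> ball 0 R" using R norm_ge_zero[of w] by (auto simp del: norm_ge_zero)
      show "norm (F z) \<le> 2 * R * B" if "z \<in> frontier (ball 0 R)" for z
      proof -
        have nz: "norm z = R" using that R by simp
        have "(of_real R)\<^sup>2 + z\<^sup>2 = z * (2 * of_real (Re z))"
        proof -
          have "(of_real R)\<^sup>2 = z * cnj z" using complex_norm_square[of z] nz by simp
          then have "(of_real R)\<^sup>2 + z\<^sup>2 = z * (z + cnj z)"
            by (simp add: power2_eq_square algebra_simps)
          then show ?thesis by (simp add: complex_add_cnj)
        qed
        then have "norm (F z) = R * (2 * \<bar>Re z\<bar>) * norm (f z)"
          by (simp add: F_def norm_mult nz)
        also have "\<dots> \<le> 2 * R * B"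
        proof (cases "Re z = 0")
          case False
          then have "\<bar>Re z\<bar> * norm (f z) \<le> B" using bound[of z] by (simp add: field_simps)
          then have "(2 * R) * (\<bar>Re z\<bar> * norm (f z)) \<le> (2 * R) * B"
            using R by (intro mult_left_mono) auto
          then show ?thesis by (simp add: mult_ac)
        qed (use R B in auto)
        finally show ?thesis .
      qed
    qed
    moreover have "norm (F w) \<ge> (3 / 4 * R\<^sup>2) * norm (f w)"
    proof -
      have "(norm w)\<^sup>2 \<le> (R / 2)\<^sup>2" using R by (intro power_mono) auto
      moreover have "norm ((of_real R)\<^sup>2 + w\<^sup>2) \<ge> norm ((of_real R :: complex)\<^sup>2) - norm (w\<^sup>2)"
        by (metis norm_diff_ineq)
      ultimately have "norm ((of_real R)\<^sup>2 + w\<^sup>2) \<ge> 3 / 4 * R\<^sup>2"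
        by (simp add: norm_power power_divide)
      then show ?thesis unfolding F_def norm_mult by (intro mult_right_mono) auto
    qed
    ultimately have "(3 / 4 * R\<^sup>2) * norm (f w) \<le> 2 * R * B" by simp
    then have "R * (3 * (R * norm (f w))) \<le> R * (8 * B)"
      by (simp add: power2_eq_square algebra_simps)
    then have "3 * (R * norm (f w)) \<le> 8 * B" using R by simp
    then have "R * norm (f w) \<le> 3 * B" using B by linarith
    then show ?thesis using R by (simp add: field_simps)
  qed
  have "norm (f w) \<le> 0"
  proof (rule tendsto_lowerbound)
    show "((\<lambda>R. 3 * B / R) \<longlongrightarrow> 0) at_top" by real_asymp
    show "\<forall>\<^sub>F R in at_top. norm (f w) \<le> 3 * B / R"
      using eventually_ge_at_top[of "2 * norm w"] eventually_gt_at_top[of 0]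
      by eventually_elim (rule key)
  qed simp
  then show ?thesis by simp
qed


section \<open>Transforms on the two half-lines\<close>

lemma integral_exp_half_line:
  assumes "(l::real) > 0"
  shows "integrable lborel (\<lambda>x. indicator {0..} x * exp (- (l * x)))"
    and "(\<integral>x. indicator {0..} x * exp (- (l * x)) \<partial>lborel) = 1 / l"
    and "integrable lborel (\<lambda>x. indicator {..<0} x * exp (l * x))"
    and "(\<integral>x. indicator {..<0} x * exp (l * x) \<partial>lborel) = 1 / l"
proof -
  interpret E: prob_space "density lborel (exponential_density l)"
    by (rule prob_space_exponential_density[OF assms])
  have eq: "exponential_density l x = l * (indicator {0..} x * exp (- (l * x)))" for x
    by (auto simp: exponential_density_def indicator_def mult_ac)
  have 1: "(\<integral>\<^sup>+x. ennreal (exponential_density l x) \<partial>lborel) = 1"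
    using E.emeasure_space_1 by (simp add: emeasure_density)
  have "integrable lborel (exponential_density l)" "(\<integral>x. exponential_density l x \<partial>lborel) = 1"
    using 1 assms by (auto intro!: integrableI_nonneg integral_eq_nn_integral[THEN trans] simp: exponential_density_nonneg)
  then show i: "integrable lborel (\<lambda>x. indicator {0..} x * exp (- (l * x)))"
    and v: "(\<integral>x. indicator {0..} x * exp (- (l * x)) \<partial>lborel) = 1 / l"
    using assms unfolding eq by (auto simp: field_simps)
  \<comment> \<open>Reflecting \<open>{0..}\<close> gives the closed negative half-line; it differs
    from \<open>{..<0}\<close> by the null set \<open>{0}\<close>.\<close>
  have AEr: "AE x in lborel. indicator {..<0} x * exp (l * x) = indicator {0..} (-x) * exp (- (l * (- x)))"
    using AE_lborel_singleton[of "0::real"] by eventually_elim (auto simp: indicator_def)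
  have i': "integrable lborel (\<lambda>x. indicator {0..} (0 + (-1) * x) * exp (- (l * (0 + (-1) * x))))"
    by (rule lborel_integrable_real_affine[OF i]) simp
  show "integrable lborel (\<lambda>x. indicator {..<0} x * exp (l * x))"
    using i' by (subst integrable_cong_AE[OF _ _ AEr]) auto
  show "(\<integral>x. indicator {..<0} x * exp (l * x) \<partial>lborel) = 1 / l"
    using v lborel_integral_real_affine[of "-1" "\<lambda>x. indicator {0..} x * exp (- (l * x))" 0]
    by (subst integral_cong_AE[OF _ _ AEr]) auto
qed

text \<open>Both \<open>\<integral> indicator A (a - u)\<dots>\<close> and \<open>\<integral> indicator A a \<dots>\<close> are Fubini-integrable; the second
  integrates to \<open>0\<close> by hypothesis and the first factorises.\<close>

lemma convolution_zero_transform: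
  fixes \<theta> :: "real measure" and g :: "real \<Rightarrow> real" and w :: complex
  assumes fin: "finite_measure \<theta>" and [measurable_cong]: "sets \<theta> = sets borel"
    and intw: "integrable \<theta> (\<lambda>u. exp (Re w * u))"
    and [measurable]: "g \<in> borel_measurable borel" and g: "\<And>a. \<bar>g a\<bar> \<le> B"
    and zero: "\<And>a. (\<integral>u. g (a - u) \<partial>\<theta>) = 0"
    and [measurable]: "A \<in> sets borel"
    and A: "integrable lborel (\<lambda>a. indicator A a * exp (Re w * a) :: real)"
  shows "(\<integral>z. of_real (g (snd z - fst z) * (indicator A (snd z - fst z) - indicator A (snd z)))
       * exp (w * of_real (snd z)) \<partial>(\<theta> \<Otimes>\<^sub>M lborel))
    = (\<integral>u. exp (w * of_real u) \<partial>\<theta>) * (\<integral>b. of_real (indicator A b * g b) * exp (w * of_real b) \<partial>lborel)"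
proof -
  interpret t: finite_measure \<theta> by fact
  interpret pair_sigma_finite \<theta> lborel ..
  have B: "B \<ge> 0" using g[of 0] by linarith
  let ?s = "Re w"
  define f1 :: "real \<Rightarrow> real \<Rightarrow> complex" where
    "f1 = (\<lambda>u a. of_real (g (a - u) * indicator A (a - u)) * exp (w * of_real a))"
  define f2 :: "real \<Rightarrow> real \<Rightarrow> complex" where
    "f2 = (\<lambda>u a. of_real (g (a - u) * indicator A a) * exp (w * of_real a))"
  have [measurable]: "case_prod f1 \<in> borel_measurable (\<theta> \<Otimes>\<^sub>M lborel)"
    "case_prod f2 \<in> borel_measurable (\<theta> \<Otimes>\<^sub>M lborel)"
    unfolding f1_def f2_def by measurable
  define C where "C = (\<integral>a. indicator A a * exp (?s * a) \<partial>lborel)"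
  have shift: "integrable lborel (\<lambda>a. indicator A (a - u) * exp (?s * a) :: real)"
    "(\<integral>a. indicator A (a - u) * exp (?s * a) \<partial>lborel) = exp (?s * u) * C" for u
  proof -
    have eq: "indicator A (a - u) * exp (?s * a) = exp (?s * u) * (indicator A (-u + 1 * a) * exp (?s * (-u + 1 * a)))" for a
      by (simp add: algebra_simps flip: exp_add)
    show "integrable lborel (\<lambda>a. indicator A (a - u) * exp (?s * a) :: real)"
      unfolding eq using lborel_integrable_real_affine[OF A, of 1 "-u"] by (intro integrable_mult_right) auto
    show "(\<integral>a. indicator A (a - u) * exp (?s * a) \<partial>lborel) = exp (?s * u) * C"
      unfolding eq C_def using lborel_integral_real_affine[of 1 "\<lambda>a. indicator A a * exp (?s * a)" "-u"]
      by simp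
  qed
  have n1: "norm (f1 u a) \<le> B * (indicator A (a - u) * exp (?s * a))" for u a
    using g[of "a - u"] by (auto simp: f1_def norm_mult indicator_def)
  have n2: "norm (f2 u a) \<le> B * (indicator A a * exp (?s * a))" for u a
    using g[of "a - u"] by (auto simp: f2_def norm_mult indicator_def)
  have i1u: "integrable lborel (f1 u)" for u
    by (rule Bochner_Integration.integrable_bound[OF integrable_mult_right[OF shift(1), of B u]])
       (use B n1[unfolded f1_def] in \<open>auto simp: f1_def\<close>)
  have i2u: "integrable lborel (f2 u)" for u
    by (rule Bochner_Integration.integrable_bound[OF integrable_mult_right[OF A, of B]])
       (use B n2[unfolded f2_def] in \<open>auto simp: f2_def\<close>)
  have i1: "integrable (\<theta> \<Otimes>\<^sub>M lborel) (case_prod f1)"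
  proof (rule Fubini_integrable)
    show "integrable \<theta> (\<lambda>u. \<integral>a. norm (case_prod f1 (u, a)) \<partial>lborel)"
    proof (rule Bochner_Integration.integrable_bound[OF integrable_mult_right[OF intw, of "B * C"]])
      have "(\<integral>a. norm (f1 u a) \<partial>lborel) \<le> (\<integral>a. B * (indicator A (a - u) * exp (?s * a)) \<partial>lborel)" for u
        by (intro integral_mono integrable_mult_right shift integrable_norm i1u n1)
      then have "(\<integral>a. norm (f1 u a) \<partial>lborel) \<le> B * C * exp (?s * u)" for u
        using integral_mult_right_zero[of lborel B "\<lambda>a. indicator A (a - u) * exp (?s * a)"] shift(2)[of u]
        by (metis mult.assoc mult.commute)
      moreover have "0 \<le> (\<integral>a. norm (f1 u a) \<partial>lborel)" for u by simp
      ultimately show "AE u in \<theta>. norm (\<integral>a. norm (case_prod f1 (u, a)) \<partial>lborel) \<le> norm (B * C * exp (?s * u))"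
        by (intro AE_I2) (auto intro: order_trans[OF _ abs_ge_self])
    qed measurable
  qed (use i1u in auto)
  have i2: "integrable (\<theta> \<Otimes>\<^sub>M lborel) (case_prod f2)"
  proof (rule Fubini_integrable)
    show "integrable \<theta> (\<lambda>u. \<integral>a. norm (case_prod f2 (u, a)) \<partial>lborel)"
    proof (rule t.integrable_const_bound[of _ "B * C"])
      have "(\<integral>a. norm (f2 u a) \<partial>lborel) \<le> (\<integral>a. B * (indicator A a * exp (?s * a)) \<partial>lborel)" for u
        by (intro integral_mono integrable_mult_right A integrable_norm i2u n2)
      then have "(\<integral>a. norm (f2 u a) \<partial>lborel) \<le> B * C" for u
        by (simp add: C_def)
      then show "AE u in \<theta>. norm (\<integral>a. norm (case_prod f2 (u, a)) \<partial>lborel) \<le> B * C" by simp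
    qed measurable
  qed (use i2u in auto)
  have v1: "(\<integral>z. case_prod f1 z \<partial>(\<theta> \<Otimes>\<^sub>M lborel)) =
    (\<integral>u. exp (w * of_real u) \<partial>\<theta>) * (\<integral>b. of_real (indicator A b * g b) * exp (w * of_real b) \<partial>lborel)"
  proof -
    have "(\<integral>z. case_prod f1 z \<partial>(\<theta> \<Otimes>\<^sub>M lborel)) = (\<integral>u. (\<integral>a. f1 u a \<partial>lborel) \<partial>\<theta>)"
      by (rule integral_fst'[OF i1, symmetric, unfolded case_prod_conv])
    also have "\<dots> = (\<integral>u. exp (w * of_real u) * (\<integral>b. of_real (indicator A b * g b) * exp (w * of_real b) \<partial>lborel) \<partial>\<theta>)"
    proof (intro Bochner_Integration.integral_cong refl)
      fix u
      have "(\<integral>a. f1 u a \<partial>lborel) = (\<integral>a. f1 u (u + 1 * a) \<partial>lborel)"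
        using lborel_integral_real_affine[of 1 "f1 u" u] by simp
      also have "\<dots> = (\<integral>a. exp (w * of_real u) * (of_real (indicator A a * g a) * exp (w * of_real a)) \<partial>lborel)"
        by (intro Bochner_Integration.integral_cong refl)
           (simp add: f1_def ring_distribs exp_add mult_ac)
      also have "\<dots> = exp (w * of_real u) * (\<integral>b. of_real (indicator A b * g b) * exp (w * of_real b) \<partial>lborel)"
        by (rule integral_mult_right_zero)
      finally show "(\<integral>a. f1 u a \<partial>lborel) =
        exp (w * of_real u) * (\<integral>b. of_real (indicator A b * g b) * exp (w * of_real b) \<partial>lborel)" .
    qed
    also have "\<dots> = (\<integral>u. exp (w * of_real u) \<partial>\<theta>) * (\<integral>b. of_real (indicator A b * g b) * exp (w * of_real b) \<partial>lborel)"
      by (rule integral_mult_left_zero)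
    finally show ?thesis .
  qed
  have v2: "(\<integral>z. case_prod f2 z \<partial>(\<theta> \<Otimes>\<^sub>M lborel)) = 0"
  proof -
    have "(\<integral>z. case_prod f2 z \<partial>(\<theta> \<Otimes>\<^sub>M lborel)) = (\<integral>u. (\<integral>a. f2 u a \<partial>lborel) \<partial>\<theta>)"
      by (rule integral_fst'[OF i2, symmetric, unfolded case_prod_conv])
    also have "\<dots> = (\<integral>a. (\<integral>u. f2 u a \<partial>\<theta>) \<partial>lborel)"
      by (rule Fubini_integral[OF i2, symmetric])
    also have "\<dots> = (\<integral>a. 0 \<partial>(lborel :: real measure))"
    proof (intro Bochner_Integration.integral_cong refl)
      fix a
      have "(\<integral>u. f2 u a \<partial>\<theta>) = (\<integral>u. of_real (g (a - u)) * (of_real (indicator A a) * exp (w * of_real a)) \<partial>\<theta>)"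
        by (intro Bochner_Integration.integral_cong refl) (simp add: f2_def mult_ac)
      also have "\<dots> = of_real (\<integral>u. g (a - u) \<partial>\<theta>) * (of_real (indicator A a) * exp (w * of_real a))"
        by (subst integral_mult_left_zero) simp
      finally show "(\<integral>u. f2 u a \<partial>\<theta>) = 0" by (simp add: zero)
    qed
    finally show ?thesis by simp
  qed
  have "(\<integral>z. of_real (g (snd z - fst z) * (indicator A (snd z - fst z) - indicator A (snd z)))
       * exp (w * of_real (snd z)) \<partial>(\<theta> \<Otimes>\<^sub>M lborel)) = (\<integral>z. case_prod f1 z - case_prod f2 z \<partial>(\<theta> \<Otimes>\<^sub>M lborel))"
    by (intro Bochner_Integration.integral_cong refl)
       (auto simp: f1_def f2_def case_prod_beta algebra_simps)
  also have "\<dots> = (\<integral>z. case_prod f1 z \<partial>(\<theta> \<Otimes>\<^sub>M lborel)) - (\<integral>z. case_prod f2 z \<partial>(\<theta> \<Otimes>\<^sub>M lborel))"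
    by (intro Bochner_Integration.integral_diff i1 i2)
  finally show ?thesis using v1 v2 by simp
qed

text \<open>The gap between \<open>\<bar>s\<bar>\<close> and \<open>d\<close> pays for the linear
  factor, which arises as the length of an interval in the strip estimate.\<close>

lemma abs_mult_exp_abs_le:
  fixes s d a :: real
  assumes "\<bar>s\<bar> < d"
  shows "\<bar>a\<bar> * exp (\<bar>s\<bar> * \<bar>a\<bar>) \<le> exp (d * \<bar>a\<bar>) / (d - \<bar>s\<bar>)"
proof -
  have "(d - \<bar>s\<bar>) * \<bar>a\<bar> \<le> exp ((d - \<bar>s\<bar>) * \<bar>a\<bar>)"
    using exp_ge_add_one_self[of "(d - \<bar>s\<bar>) * \<bar>a\<bar>"] by linarith
  then have "((d - \<bar>s\<bar>) * \<bar>a\<bar>) * exp (\<bar>s\<bar> * \<bar>a\<bar>) \<le> exp ((d - \<bar>s\<bar>) * \<bar>a\<bar>) * exp (\<bar>s\<bar> * \<bar>a\<bar>)"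
    by (intro mult_right_mono) auto
  also have "\<dots> = exp (d * \<bar>a\<bar>)" by (simp add: algebra_simps flip: exp_add)
  finally show ?thesis using assms by (simp add: field_simps)
qed

text \<open>A shift by \<open>u\<close> does not change membership in \<open>A\<close> when
  \<open>\<bar>u\<bar> < \<bar>a\<bar>\<close>, so the difference of indicators lives on
  \<open>\<bar>a\<bar> \<le> \<bar>u\<bar>\<close>. There the weight in \<open>a\<close> is
  controlled by an exponential in \<open>\<bar>u\<bar>\<close>. This makes the difference integrable
  for \<open>s\<close> of either sign, whereas each half alone converges only in a
  half-plane.\<close>

lemma strip_integrable:
  fixes \<theta> :: "real measure" and g :: "real \<Rightarrow> real"
  assumes fin: "finite_measure \<theta>" and [measurable_cong]: "sets \<theta> = sets borel"
    and exp_int: "integrable \<theta> (\<lambda>u. exp (\<delta> * \<bar>u\<bar>))"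
    and [measurable]: "g \<in> borel_measurable borel" and g: "\<And>a. \<bar>g a\<bar> \<le> B"
    and [measurable]: "A \<in> sets borel"
    and A: "\<And>u a. \<bar>u\<bar> < \<bar>a\<bar> \<Longrightarrow> (a - u \<in> A) = (a \<in> A)"
    and s: "\<bar>s\<bar> < \<delta>"
  shows "integrable (\<theta> \<Otimes>\<^sub>M lborel)
    (\<lambda>z. \<bar>g (snd z - fst z) * (indicator A (snd z - fst z) - indicator A (snd z))\<bar> * exp (s * snd z))"
proof -
  interpret t: finite_measure \<theta> by fact
  interpret pair_sigma_finite \<theta> lborel ..
  have B: "B \<ge> 0" using g[of 0] by linarith
  let ?f = "\<lambda>z. \<bar>g (snd z - fst z) * (indicator A (snd z - fst z) - indicator A (snd z))\<bar> * exp (s * snd z)"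
  have le: "?f (u, a) \<le> B * exp (\<bar>s\<bar> * \<bar>u\<bar>) * indicator {-\<bar>u\<bar>..\<bar>u\<bar>} a" for u a
  proof (cases "\<bar>u\<bar> < \<bar>a\<bar>")
    case True
    then show ?thesis using A[OF True] B by (simp add: indicator_def)
  next
    case False
    have "s * a \<le> \<bar>s\<bar> * \<bar>u\<bar>"
    proof -
      have "s * a \<le> \<bar>s\<bar> * \<bar>a\<bar>" using abs_ge_self[of "s * a"] by (simp only: abs_mult)
      also have "\<dots> \<le> \<bar>s\<bar> * \<bar>u\<bar>" using False by (intro mult_left_mono) auto
      finally show ?thesis .
    qed
    moreover have "\<bar>g (a - u) * (indicator A (a - u) - indicator A a)\<bar> \<le> B"
      using g[of "a - u"] B by (auto simp: indicator_def)
    ultimately have "?f (u, a) \<le> B * exp (\<bar>s\<bar> * \<bar>u\<bar>)"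
      unfolding fst_conv snd_conv by (intro mult_mono) (auto simp: B)
    moreover have "a \<in> {-\<bar>u\<bar>..\<bar>u\<bar>}" using False by auto
    ultimately show ?thesis by simp
  qed
  have iu: "integrable lborel (\<lambda>a. B * exp (\<bar>s\<bar> * \<bar>u\<bar>) * indicator {-\<bar>u\<bar>..\<bar>u\<bar>} a)" for u
    by simp
  have ifu: "integrable lborel (\<lambda>a. ?f (u, a))" for u
    by (rule Bochner_Integration.integrable_bound[OF iu[of u]]) (use le B in auto)
  show ?thesis
  proof (rule Fubini_integrable)
    show "integrable \<theta> (\<lambda>u. \<integral>a. norm (?f (u, a)) \<partial>lborel)"
    proof (rule Bochner_Integration.integrable_bound[OF integrable_mult_right[OF exp_int, of "2 * B / (\<delta> - \<bar>s\<bar>)"]])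
      have "norm (\<integral>a. norm (?f (u, a)) \<partial>lborel) \<le> norm (2 * B / (\<delta> - \<bar>s\<bar>) * exp (\<delta> * \<bar>u\<bar>))" for u
      proof -
        have "(\<integral>a. norm (?f (u, a)) \<partial>lborel) \<le> (\<integral>a. B * exp (\<bar>s\<bar> * \<bar>u\<bar>) * indicator {-\<bar>u\<bar>..\<bar>u\<bar>} a \<partial>lborel)"
          using le[of u] by (intro integral_mono iu integrable_norm ifu) auto
        also have "\<dots> = 2 * B * (\<bar>u\<bar> * exp (\<bar>s\<bar> * \<bar>u\<bar>))"
          by simp
        also have "\<dots> \<le> 2 * B * (exp (\<delta> * \<bar>u\<bar>) / (\<delta> - \<bar>s\<bar>))"
          using abs_mult_exp_abs_le[OF s] B by (intro mult_left_mono) auto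
        finally have "(\<integral>a. norm (?f (u, a)) \<partial>lborel) \<le> 2 * B / (\<delta> - \<bar>s\<bar>) * exp (\<delta> * \<bar>u\<bar>)"
          by simp
        then show ?thesis using B s by (simp add: abs_mult)
      qed
      then show "AE u in \<theta>. norm (\<integral>a. norm (?f (u, a)) \<partial>lborel) \<le> norm (2 * B / (\<delta> - \<bar>s\<bar>) * exp (\<delta> * \<bar>u\<bar>))"
        by simp
    qed measurable
  qed (use ifu in auto)
qed

text \<open>Adding a constant to \<open>g\<close> and weighting by \<open>exp (- a)\<close> on the
  half-line yields a probability density. The vanishing transform says that it has the
  characteristic function of the standard exponential law, so uniqueness of characteristic functions
  makes the two densities agree.\<close>

lemma AE_zero_if_laplace_zero:
  fixes g :: "real \<Rightarrow> real"
  assumes [measurable]: "g \<in> borel_measurable borel" and g: "\<And>a. \<bar>g a\<bar> \<le> B"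
    and zero: "\<And>y::real. (\<integral>a. of_real (indicator {0..} a * g a) * exp (Complex (- 1) y * of_real a) \<partial>lborel) = 0"
  shows "AE a in lborel. 0 \<le> a \<longrightarrow> g a = 0"
proof -
  define C where "C = \<bar>B\<bar> + 1"
  have C: "C > 0" "\<bar>g a\<bar> \<le> C" for a using g[of a] by (auto simp: C_def)
  let ?e = "\<lambda>a::real. indicator {0..} a * exp (- a) :: real"
  define f where "f a = ?e a * ((g a + C) / C)" for a
  have f0: "f a \<ge> 0" for a using C(2)[of a] C(1) by (simp add: f_def)
  have [measurable]: "f \<in> borel_measurable borel" unfolding f_def by measurable
  have e: "integrable lborel ?e" "integral\<^sup>L lborel ?e = 1" using integral_exp_half_line(1,2)[of 1] by auto
  have expC: "exp (Complex (- 1) y * of_real a) = of_real (exp (- a)) * iexp (y * a)" for y a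
    by (simp add: Complex_eq algebra_simps flip: exp_of_real exp_add)
  have ig: "integrable lborel (\<lambda>a. of_real (?e a * g a) * iexp (y * a))" for y
    by (rule Bochner_Integration.integrable_bound[OF integrable_mult_right[OF e(1), of C]])
       (use C in \<open>auto simp: norm_mult indicator_def\<close>)
  have ie: "integrable lborel (\<lambda>a. of_real (?e a) * iexp (y * a))" for y
    by (rule Bochner_Integration.integrable_bound[OF e(1)]) (auto simp: norm_mult)
  have z: "(\<integral>a. of_real (?e a * g a) * iexp (y * a) \<partial>lborel) = 0" for y
    using zero[of y] unfolding expC of_real_mult by (simp only: mult_ac)
  have feq: "of_real (f a) * iexp (y * a) = of_real (?e a) * iexp (y * a) + of_real (?e a * g a) * iexp (y * a) / of_real C" for a y
    using C(1) by (simp add: f_def field_simps)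
  have fint: "(\<integral>a. of_real (f a) * iexp (y * a) \<partial>lborel) = (\<integral>a. of_real (?e a) * iexp (y * a) \<partial>lborel)" for y
    unfolding feq using ig[of y] ie[of y] z[of y]
    by (subst Bochner_Integration.integral_add) (auto intro!: integrable_divide_zero)
  have "f a \<le> ?e a * 2" for a
    unfolding f_def using C(1) C(2)[of a] by (intro mult_left_mono) (auto simp: divide_le_eq abs_le_iff)
  then have "norm (f a) \<le> norm (2 * ?e a)" for a
    using f0[of a] by (simp add: mult.commute abs_mult)
  then have fi: "integrable lborel f"
    by (intro Bochner_Integration.integrable_bound[OF integrable_mult_right[OF e(1), of 2]]) auto
  \<comment> \<open>The total mass is read off from the transform at frequency
    \<open>0\<close>.\<close>
  have f1: "integral\<^sup>L lborel f = 1"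
  proof -
    have "complex_of_real (integral\<^sup>L lborel f) = (\<integral>a. of_real (?e a) \<partial>lborel)"
      using fint[of 0] by simp
    also have "\<dots> = of_real (integral\<^sup>L lborel ?e)" using e(1) by (intro integral_of_real)
    finally show ?thesis using e(2) by simp
  qed
  have rd: "real_distribution (density lborel (\<lambda>a. ennreal (h a)))"
    if [measurable]: "h \<in> borel_measurable borel" and "\<And>a. h a \<ge> 0" "integrable lborel h" "integral\<^sup>L lborel h = 1" for h :: "real \<Rightarrow> real"
    using that by (intro real_distributionI prob_spaceI) (auto simp: emeasure_density nn_integral_eq_integral)
  have "density lborel (\<lambda>a. ennreal (f a)) = density lborel (\<lambda>a. ennreal (?e a))"
  proof (rule Levy_uniqueness)
    show "real_distribution (density lborel (\<lambda>a. ennreal (f a)))"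
      by (rule rd) (use f0 fi f1 in auto)
    show "real_distribution (density lborel (\<lambda>a. ennreal (?e a)))"
      by (rule rd[OF _ _ e]) auto
    show "char (density lborel (\<lambda>a. ennreal (f a))) = char (density lborel (\<lambda>a. ennreal (?e a)))"
      using fint by (auto simp: char_def integral_density f0 scaleR_conv_of_real)
  qed
  then have "AE a in lborel. ennreal (f a) = ennreal (?e a)"
    by (intro sigma_finite_measure.density_unique[OF sigma_finite_lborel]) auto
  then show ?thesis
  proof eventually_elim
    case (elim a)
    then have "f a = ?e a" using f0[of a] by (subst (asm) ennreal_inj) auto
    then show ?case using C(1) by (auto simp: f_def field_simps)
  qed
qed

text \<open>Carleman's argument: the Laplace transforms of the two halves of \<open>g\<close> continue each other
  across the imaginary axis, since both equal the quotient of a function analytic in the strip by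
  the zero-free transform of \<open>\<theta>\<close>.\<close>

lemma wiener_carleman_half:
  fixes \<theta> :: "real measure" and g :: "real \<Rightarrow> real"
  assumes fin: "finite_measure \<theta>" and sets_eq[measurable_cong]: "sets \<theta> = sets borel"
    and "\<delta> > 0" and exp_int: "integrable \<theta> (\<lambda>u. exp (\<delta> * \<bar>u\<bar>))"
    and nz: "\<And>y::real. (\<integral>u. exp (\<i> * of_real y * of_real u) \<partial>\<theta>) \<noteq> 0"
    and gm[measurable]: "g \<in> borel_measurable borel" and g: "\<And>a. \<bar>g a\<bar> \<le> B"
    and zero: "\<And>a. (\<integral>u. g (a - u) \<partial>\<theta>) = 0"
  shows "AE a in lborel. 0 \<le> a \<longrightarrow> g a = 0"
proof -
  interpret t: finite_measure \<theta> by fact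
  have B: "B \<ge> 0" using g[of 0] by linarith
  define T where "T = (\<lambda>w::complex. \<integral>u. exp (w * of_real u) \<partial>\<theta>)"
  define G where "G A w = (\<integral>b. of_real (indicator A b * g b) * exp (w * of_real b) \<partial>lborel)" for A and w :: complex
  \<comment> \<open>The difference of the two Fubini integrands, one with the half-line moving along
    with the shift and one with it fixed. Its transform \<open>Q\<close> is the function analytic in
    the whole strip.\<close>
  define q where "q A z = g (snd z - fst z) * (indicator A (snd z - fst z) - indicator A (snd z))" for A and z :: "real \<times> real"
  define Q where "Q A w = (\<integral>z. of_real (q A z) * exp (w * of_real (snd z)) \<partial>(\<theta> \<Otimes>\<^sub>M lborel))" for A and w :: complex
  have exp_int': "integrable \<theta> (\<lambda>u. exp (s * u))" if "\<bar>s\<bar> < \<delta>" for s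
  proof (rule Bochner_Integration.integrable_bound[OF exp_int])
    have "s * u \<le> \<delta> * \<bar>u\<bar>" for u
    proof -
      have "s * u \<le> \<bar>s\<bar> * \<bar>u\<bar>" using abs_ge_self[of "s * u"] by (simp only: abs_mult)
      also have "\<dots> \<le> \<delta> * \<bar>u\<bar>" using that by (intro mult_right_mono) auto
      finally show ?thesis .
    qed
    then show "AE u in \<theta>. norm (exp (s * u)) \<le> norm (exp (\<delta> * \<bar>u\<bar>))" by simp
  qed measurable
  have T_diff: "T field_differentiable (at w)" if "\<bar>Re w\<bar> < \<delta>" for w
    using exp_integral_field_differentiable[of "\<lambda>x. x" \<theta> "\<lambda>_. 1" "{-\<delta><..<\<delta>}" w] exp_int' that
    by (auto simp: T_def abs_less_iff)
  have [measurable]: "q A \<in> borel_measurable (\<theta> \<Otimes>\<^sub>M lborel)" if [measurable]: "A \<in> sets borel" for A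
    unfolding q_def by measurable
  have Q_diff: "Q {0..} field_differentiable (at w)" if "\<bar>Re w\<bar> < \<delta>" for w
    unfolding Q_def
  proof (rule exp_integral_field_differentiable)
    show "integrable (\<theta> \<Otimes>\<^sub>M lborel) (\<lambda>x. \<bar>q {0..} x\<bar> * exp (s * snd x))" if "s \<in> {-\<delta><..<\<delta>}" for s
      unfolding q_def by (rule strip_integrable[OF fin sets_eq exp_int gm g]) (use that in auto)
    show "Re w \<in> {-\<delta><..<\<delta>}" using that by auto
  qed auto
  have G1_int: "integrable lborel (\<lambda>a. indicator {0..} a * exp (s * a) :: real)"
    and G1_val: "(\<integral>a. indicator {0..} a * exp (s * a) \<partial>lborel) = 1 / \<bar>s\<bar>" if "s < 0" for s
    using integral_exp_half_line(1,2)[of "-s"] that by auto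
  have G2_int: "integrable lborel (\<lambda>a. indicator {..<0} a * exp (s * a) :: real)"
    and G2_val: "(\<integral>a. indicator {..<0} a * exp (s * a) \<partial>lborel) = 1 / \<bar>s\<bar>" if "s > 0" for s
    using integral_exp_half_line(3,4)[of "s"] that by auto
  have G_bound: "integrable lborel (\<lambda>a. \<bar>indicator A a * g a\<bar> * exp (s * a))"
    if [measurable]: "A \<in> sets borel" and i: "integrable lborel (\<lambda>a. indicator A a * exp (s * a) :: real)" for s A
    by (rule Bochner_Integration.integrable_bound[OF integrable_mult_right[OF i, of B]])
       (use g B in \<open>auto simp: abs_mult indicator_def\<close>)
  have G_norm: "norm (G A w) \<le> B * (\<integral>a. indicator A a * exp (Re w * a) \<partial>lborel)"
    if [measurable]: "A \<in> sets borel" and i: "integrable lborel (\<lambda>a. indicator A a * exp (Re w * a) :: real)" for w A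
    unfolding G_def
  proof (rule order_trans[OF integral_norm_bound])
    show "(\<integral>b. norm (of_real (indicator A b * g b) * exp (w * of_real b)) \<partial>lborel) \<le> B * (\<integral>a. indicator A a * exp (Re w * a) \<partial>lborel)"
      unfolding integral_mult_right_zero[symmetric]
    proof (rule integral_mono)
      show "integrable lborel (\<lambda>b. norm (of_real (indicator A b * g b) * exp (w * of_real b)))"
        using G_bound[OF that] by (simp add: norm_mult abs_mult)
      show "integrable lborel (\<lambda>a. B * (indicator A a * exp (Re w * a)))"
        using i by (rule integrable_mult_right)
      show "norm (complex_of_real (indicator A b * g b) * exp (w * of_real b)) \<le> B * (indicator A b * exp (Re w * b))" for b
        using g[of b] by (auto simp: norm_mult indicator_def)
    qed
  qed
  have G1_diff: "G {0..} field_differentiable (at w)" if "Re w < 0" for w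
    unfolding G_def
    by (rule exp_integral_field_differentiable[of _ _ _ "{..<0}"]) (use that in \<open>auto intro!: G_bound G1_int\<close>)
  have G2_diff: "G {..<0} field_differentiable (at w)" if "Re w > 0" for w
    unfolding G_def
    by (rule exp_integral_field_differentiable[of _ _ _ "{0<..}"]) (use that in \<open>auto intro!: G_bound G2_int\<close>)
  have QG: "Q A w = T w * G A w"
    if "A \<in> sets borel" "integrable lborel (\<lambda>a. indicator A a * exp (Re w * a) :: real)" "\<bar>Re w\<bar> < \<delta>" for A w
    unfolding Q_def T_def G_def q_def
    by (rule convolution_zero_transform[OF fin sets_eq exp_int' gm g zero]) (use that in auto)
  \<comment> \<open>Complementary indicators add up to \<open>1\<close>, which cancels in the
    difference. The resulting sign is what matches the transform of the right half with minus that
    of the left half.\<close>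
  have Q_compl: "Q {..<0} w = - Q {0..} w" for w
  proof -
    have "q {..<0} z = - q {0..} z" for z
      by (auto simp: q_def indicator_def)
    then show ?thesis by (simp add: Q_def)
  qed
  have T0: "T w \<noteq> 0" if "Re w = 0" for w
    using nz[of "Im w"] that complex_eq[of w] by (simp add: T_def)
  \<comment> \<open>The glued function. In the strip \<open>T\<close> may vanish off the imaginary
    axis, so the quotient representation is used only on a small disk around each point of the axis,
    where continuity keeps \<open>T\<close> nonzero.\<close>
  define E where "E w = (if Re w < 0 then G {0..} w else if Re w > 0 then - G {..<0} w else Q {0..} w / T w)" for w
  have E_strip: "E w = Q {0..} w / T w" if "\<bar>Re w\<bar> < \<delta>" "T w \<noteq> 0" for w
  proof -
    consider "Re w < 0" | "Re w > 0" | "Re w = 0" by linarith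
    then show ?thesis
    proof cases
      case 1
      then show ?thesis using that QG[of "{0..}" w, OF _ G1_int] by (simp add: E_def)
    next
      case 2
      then have "Q {0..} w = - (T w * G {..<0} w)"
        using that QG[of "{..<0}" w, OF _ G2_int] Q_compl[of w] by (simp add: minus_equation_iff[of "Q _ _"])
      then show ?thesis using 2 that by (simp add: E_def)
    qed (simp add: E_def)
  qed
  have "E holomorphic_on UNIV"
  proof (rule holomorphic_onI)
    fix w
    have "E field_differentiable (at w)"
    proof -
      consider "Re w < 0" | "Re w > 0" | "Re w = 0" by linarith
      then show ?thesis
      proof cases
        case 1
        have "open {w. Re w < 0}" by (rule open_halfspace_Re_lt)
        with 1 obtain d where "d > 0" "ball w d \<subseteq> {w. Re w < 0}" by (metis mem_Collect_eq openE)
        then show ?thesis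
          by (intro field_differentiable_transform_within[OF _ _ _ G1_diff[OF 1], of d]) (auto simp: E_def dist_commute subset_eq)
      next
        case 2
        have "open {w. Re w > 0}" by (rule open_halfspace_Re_gt)
        with 2 obtain d where d: "d > 0" "ball w d \<subseteq> {w. Re w > 0}" by (metis mem_Collect_eq openE)
        show ?thesis
        proof (rule field_differentiable_transform_within[OF _ _ _ field_differentiable_minus[OF G2_diff[OF 2]]])
          fix z assume "dist z w < d"
          then have "Re z > 0" using d by (auto simp: subset_eq dist_commute)
          then show "- G {..<0} z = E z" by (simp add: E_def)
        qed (use d in auto)
      next
        case 3
        then have w: "\<bar>Re w\<bar> < \<delta>" "T w \<noteq> 0" using T0 \<open>\<delta> > 0\<close> by auto
        have "isCont T w" using T_diff[OF w(1)] by (rule field_differentiable_imp_continuous_at)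
        then obtain e where e: "e > 0" "\<And>z. dist w z < e \<Longrightarrow> T z \<noteq> 0"
          using continuous_at_avoid[of w T 0] w(2) by auto
        show ?thesis
        proof (rule field_differentiable_transform_within[OF _ _ _ field_differentiable_divide[OF Q_diff[OF w(1)] T_diff[OF w(1)] w(2)], of "min e \<delta>"])
          fix z assume "dist z w < min e \<delta>"
          moreover have "\<bar>Re z\<bar> \<le> dist z w" using 3 abs_Re_le_cmod[of "z - w"] by (simp add: dist_norm)
          ultimately show "Q {0..} z / T z = E z"
            using e(2)[of z] by (subst E_strip) (auto simp: dist_commute)
        qed (use e \<open>\<delta> > 0\<close> in auto)
      qed
    qed
    then show "E field_differentiable (at w within UNIV)" by simp
  qed
  \<comment> \<open>The bound \<open>B\<close> on \<open>g\<close> times the integral of the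
    exponential over its half-line.\<close>
  moreover have "norm (E w) \<le> B / \<bar>Re w\<bar>" if "Re w \<noteq> 0" for w
    using that G_norm[of "{0..}" w, OF _ G1_int] G_norm[of "{..<0}" w, OF _ G2_int] G1_val[of "Re w"] G2_val[of "Re w"]
    by (auto simp: E_def)
  ultimately have E0: "E w = 0" for w
    by (rule entire_bounded_by_inverse_Re_eq_0)
  show ?thesis
  proof (rule AE_zero_if_laplace_zero[OF gm g])
    \<comment> \<open>The vertical line through \<open>-1\<close> lies in the half-plane where
      \<open>E\<close> is the transform of the right half of \<open>g\<close>.\<close>
    show "(\<integral>a. of_real (indicator {0..} a * g a) * exp (Complex (- 1) y * of_real a) \<partial>lborel) = 0" for y
      using E0[of "Complex (-1) y"] by (simp add: E_def G_def)
  qed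
qed

text \<open>The convolution equation is translation invariant, so the half-line result applies to
  every translate of \<open>g\<close> by a natural number, and these half-lines exhaust the
  line.\<close>

lemma wiener_carleman:
  fixes \<theta> :: "real measure" and g :: "real \<Rightarrow> real"
  assumes "finite_measure \<theta>" "sets \<theta> = sets borel"
    and "\<delta> > 0" "integrable \<theta> (\<lambda>u. exp (\<delta> * \<bar>u\<bar>))"
    and "\<And>y::real. (\<integral>u. exp (\<i> * of_real y * of_real u) \<partial>\<theta>) \<noteq> 0"
    and [measurable]: "g \<in> borel_measurable borel" and "\<And>a. \<bar>g a\<bar> \<le> B"
    and zero: "\<And>a. (\<integral>u. g (a - u) \<partial>\<theta>) = 0"
  shows "AE a in lborel. g a = 0"
proof -
  have "AE a in lborel. 0 \<le> a + real n \<longrightarrow> g a = 0" for n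
  proof -
    have "AE a in lborel. 0 \<le> a \<longrightarrow> g (a - real n) = 0"
      using assms zero[of "_ - real n"]
      by (intro wiener_carleman_half[of \<theta> \<delta> "\<lambda>a. g (a - real n)"]) (auto simp: algebra_simps)
    from AE_borel_affine[OF _ _ this, of 1 "real n"] show ?thesis by (simp add: add_ac)
  qed
  then have "AE a in lborel. \<forall>n. 0 \<le> a + real n \<longrightarrow> g a = 0" unfolding AE_all_countable by blast
  then show ?thesis
  proof eventually_elim
    case (elim a)
    obtain n where "- a \<le> real n" using real_arch_simple by blast
    with elim show ?case by (metis add.commute diff_0 diff_le_eq)
  qed
qed

section \<open>Selection along sequences\<close>

lemma convergent_diagonal_subseq:
  fixes f :: "nat \<Rightarrow> 'a \<Rightarrow> real"
  assumes "countable D" and bdd: "\<And>a. a \<in> D \<Longrightarrow> bounded (range (\<lambda>k. f k a))"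
  obtains r where "strict_mono (r :: nat \<Rightarrow> nat)" "\<And>a. a \<in> D \<Longrightarrow> convergent (\<lambda>k. f (r k) a)"
proof (cases "D = {}")
  case True
  then show ?thesis using that[of id] by (simp add: strict_mono_id)
next
  case False
  define P where "P n s \<longleftrightarrow> convergent (\<lambda>k. f (s k) (from_nat_into D n))" for n and s :: "nat \<Rightarrow> nat"
  interpret subseqs P
  proof
    fix n and s :: "nat \<Rightarrow> nat" assume "strict_mono s"
    have "bounded (range (\<lambda>k. f (s k) (from_nat_into D n)))"
      using bdd[OF from_nat_into[OF False]] by (rule bounded_subset) auto
    from bounded_imp_convergent_subsequence[OF this] obtain l r
      where "strict_mono r" "((\<lambda>k. f (s k) (from_nat_into D n)) \<circ> r) \<longlonglongrightarrow> l" by blast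
    then show "\<exists>r'. strict_mono r' \<and> P n (s \<circ> r')"
      by (intro exI[of _ r]) (auto simp: P_def convergent_def o_def)
  qed
  have "convergent (\<lambda>k. f (diagseq k) a)" if aD: "a \<in> D" for a
  proof -
    obtain n where n: "a = from_nat_into D n"
      using from_nat_into_surj[OF assms(1) aD] by metis
    \<comment> \<open>The diagonal sequence is a subsequence of the \<open>n\<close>-th selected one
      only after its first \<open>Suc n\<close> terms are dropped; this is harmless for
      convergence.\<close>
    have "P n (diagseq \<circ> (+) (Suc n))"
    proof (rule diagseq_holds)
      fix r s :: "nat \<Rightarrow> nat" and n assume "strict_mono r" "P n s"
      then show "P n (s \<circ> r)"
        using convergent_subseq_convergent[of "\<lambda>k. f (s k) (from_nat_into D n)" r]
        by (simp add: P_def o_def)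
    qed
    then show ?thesis
      using convergent_ignore_initial_segment[of "\<lambda>k. f (diagseq k) a" "Suc n"]
      by (simp add: P_def n o_def add.commute)
  qed
  with subseq_diagseq show ?thesis using that by blast
qed

text \<open>Unlike in Helly's selection theorem of the library, convergence holds at every point: a second
  diagonal subsequence takes care of the countably many discontinuities of the limit.\<close>

lemma antimono_convergent_subseq:
  fixes f :: "nat \<Rightarrow> real \<Rightarrow> real"
  assumes mono: "\<And>k. antimono (f k)" and bdd: "\<And>a. bounded (range (\<lambda>k. f k a))"
  obtains r h where "strict_mono (r :: nat \<Rightarrow> nat)" "\<And>a. (\<lambda>k. f (r k) a) \<longlonglongrightarrow> h a"
proof -
  obtain r1 :: "nat \<Rightarrow> nat" where r1: "strict_mono r1" "\<And>a. a \<in> \<rat> \<Longrightarrow> convergent (\<lambda>k. f (r1 k) a)"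
    by (rule convergent_diagonal_subseq[OF countable_rat, of f]) (use bdd in auto)
  define l where "l a = lim (\<lambda>k. f (r1 k) a)" for a
  have l: "(\<lambda>k. f (r1 k) a) \<longlonglongrightarrow> l a" if "a \<in> \<rat>" for a
    using r1(2)[OF that] unfolding l_def convergent_LIMSEQ_iff .
  have l_mono: "l b \<le> l a" if "a \<in> \<rat>" "b \<in> \<rat>" "a \<le> b" for a b
    by (rule LIMSEQ_le[OF l[OF that(2)] l[OF that(1)]]) (use mono that in \<open>auto simp: antimono_def\<close>)
  \<comment> \<open>The right limit of the antitone function \<open>l\<close> of rational arguments.
    At a continuity point of \<open>H\<close> the values at nearby rationals on both sides squeeze
    the sequence.\<close>
  define H where "H a = (SUP q\<in>{q\<in>\<rat>. a < q}. l q)" for a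
  have ne: "{q\<in>\<rat>. a < q} \<noteq> {}" for a :: real
    using Rats_dense_in_real[of a "a + 1"] by auto
  have bd: "bdd_above (l ` {q\<in>\<rat>. a < q})" for a
  proof -
    obtain q0 where "q0 \<in> \<rat>" "q0 < a" using Rats_dense_in_real[of "a - 1" a] by auto
    then show ?thesis by (intro bdd_aboveI2[of _ _ "l q0"] l_mono) auto
  qed
  have H_mono: "H b \<le> H a" if "a \<le> b" for a b
    unfolding H_def by (rule cSUP_subset_mono) (use that ne bd in auto)
  have conv: "(\<lambda>k. f (r1 k) a) \<longlonglongrightarrow> H a" if cont: "isCont H a" for a
  proof (rule order_tendstoI)
    fix y assume "y < H a"
    then obtain q where q: "q \<in> \<rat>" "a < q" "y < l q"
      unfolding H_def using less_cSUP_iff[OF ne bd] by blast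
    from order_tendstoD(1)[OF l[OF q(1)] q(3)]
    show "\<forall>\<^sub>F k in sequentially. y < f (r1 k) a"
      by eventually_elim (rule less_le_trans[OF _ antimonoD[OF mono]], use q(2) in auto)
  next
    fix y assume y: "H a < y"
    have "(H \<longlongrightarrow> H a) (at_left a)"
      using cont unfolding isCont_def by (rule filterlim_at_split[THEN iffD1, THEN conjunct1])
    from order_tendstoD(2)[OF this y] obtain b where b: "b < a" "\<And>z. b < z \<Longrightarrow> z < a \<Longrightarrow> H z < y"
      unfolding eventually_at_left_field by blast
    define z where "z = (a + b) / 2"
    have z: "b < z" "z < a" "H z < y" using b by (auto simp: z_def)
    obtain q where q: "q \<in> \<rat>" "z < q" "q < a" using Rats_dense_in_real[OF z(2)] by auto
    have "l q \<le> H z" unfolding H_def by (rule cSUP_upper[OF _ bd]) (use q in auto)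
    then have "l q < y" using z by simp
    from order_tendstoD(2)[OF l[OF q(1)] this]
    show "\<forall>\<^sub>F k in sequentially. f (r1 k) a < y"
      by eventually_elim (rule le_less_trans[OF antimonoD[OF mono]], use q(3) in auto)
  qed
  have "mono (\<lambda>a. - H a)" using H_mono by (auto simp: mono_def)
  from mono_ctble_discont[OF this] have "countable {a. \<not> isCont H a}"
    by (rule countable_subset[rotated]) (use continuous_minus[of "at _" "\<lambda>a. - H a"] in auto)
  moreover have "bounded (range (\<lambda>k. f (r1 k) a))" for a
    using bdd[of a] by (rule bounded_subset) auto
  ultimately obtain r2 :: "nat \<Rightarrow> nat"
    where r2: "strict_mono r2" "\<And>a. \<not> isCont H a \<Longrightarrow> convergent (\<lambda>k. f (r1 (r2 k)) a)"
    using convergent_diagonal_subseq[of "{a. \<not> isCont H a}" "\<lambda>k. f (r1 k)"] by auto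
  have "convergent (\<lambda>k. f (r1 (r2 k)) a)" for a
    using conv[of a] r2 LIMSEQ_subseq_LIMSEQ[of "\<lambda>k. f (r1 k) a" "H a" r2]
    by (cases "isCont H a") (auto simp: convergent_def o_def)
  then have "(\<lambda>k. f ((r1 \<circ> r2) k) a) \<longlonglongrightarrow> lim (\<lambda>k. f ((r1 \<circ> r2) k) a)" for a
    by (simp add: convergent_LIMSEQ_iff o_def)
  then show ?thesis by (rule that[OF strict_mono_o[OF r1(1) r2(1)]])
qed

text \<open>The sub-subsequence principle, in the form matching the selection results: along a given
  sequence only a further subsequence can be controlled, but its limit value is always the
  same.\<close>

lemma tendsto_at_top_subseqI:
  fixes f :: "real \<Rightarrow> real"
  assumes "\<And>X. filterlim X at_top sequentially \<Longrightarrow>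
    \<exists>r. strict_mono (r :: nat \<Rightarrow> nat) \<and> (\<lambda>k. f (X (r k))) \<longlonglongrightarrow> l"
  shows "(f \<longlongrightarrow> l) at_top"
proof (rule ccontr)
  assume "\<not> (f \<longlongrightarrow> l) at_top"
  then obtain e where e: "e > 0" "\<not> (\<forall>\<^sub>F x in at_top. dist (f x) l < e)"
    by (auto simp: tendsto_iff)
  then have "\<forall>n::nat. \<exists>x\<ge>real n. dist (f x) l \<ge> e"
    by (auto simp: eventually_at_top_linorder not_less)
  then obtain X where X: "\<And>n. X n \<ge> real n" "\<And>n. dist (f (X n)) l \<ge> e" by metis
  have "filterlim X at_top sequentially"
    by (rule filterlim_at_top_mono[OF filterlim_real_sequentially]) (use X in auto)
  from assms[OF this] obtain r :: "nat \<Rightarrow> nat" where "(\<lambda>k. f (X (r k))) \<longlonglongrightarrow> l" by blast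
  from tendstoD[OF this e(1)] have "\<forall>\<^sub>F k in sequentially. False"
    by eventually_elim (use X(2) in \<open>simp add: not_less[symmetric]\<close>)
  then show False by simp
qed

section \<open>Compound Poisson laws\<close>

lemma poisson_integral:
  fixes f :: "nat \<Rightarrow> 'b::{banach, second_countable_topology}"
  assumes "s > 0" "summable (\<lambda>n. s ^ n / fact n * norm (f n))"
  shows "integrable (measure_pmf (poisson_pmf s)) f"
    and "(\<lambda>n. (s ^ n / fact n * exp (- s)) *\<^sub>R f n) sums (\<integral>n. f n \<partial>measure_pmf (poisson_pmf s))"
proof -
  let ?p = "\<lambda>n. s ^ n / fact n * exp (- s)"
  have i: "integrable (count_space UNIV) (\<lambda>n. ?p n *\<^sub>R f n)"
    using summable_mult2[OF assms(2), of "exp (- s)"] assms(1)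
    by (simp add: integrable_count_space_nat_iff mult_ac)
  have p: "measure_pmf (poisson_pmf s) = density (count_space UNIV) (\<lambda>n. ennreal (?p n))"
    using assms(1) by (subst measure_pmf_eq_density) simp
  show "integrable (measure_pmf (poisson_pmf s)) f"
    unfolding p using i assms(1) by (subst integrable_density) auto
  have "(\<integral>n. f n \<partial>measure_pmf (poisson_pmf s)) = (\<integral>n. ?p n *\<^sub>R f n \<partial>count_space UNIV)"
    unfolding p using assms(1) by (subst integral_density) auto
  with sums_integral_count_space_nat[OF i]
  show "(\<lambda>n. ?p n *\<^sub>R f n) sums (\<integral>n. f n \<partial>measure_pmf (poisson_pmf s))" by simp
qed

lemma summable_exp_pow: "summable (\<lambda>n. s ^ n / fact n * (c ^ n) :: real)"
  using summable_exp[of "s * c"] by (simp add: power_mult_distrib divide_inverse mult_ac)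

lemma poisson_integral_power:
  fixes c :: complex
  assumes "s > 0"
  shows "integrable (measure_pmf (poisson_pmf s)) (\<lambda>n. c ^ n)"
    and "(\<integral>n. c ^ n \<partial>measure_pmf (poisson_pmf s)) = exp (of_real s * (c - 1))"
proof -
  have sm: "summable (\<lambda>n. s ^ n / fact n * norm (c ^ n))"
    unfolding norm_power by (rule summable_exp_pow)
  show "integrable (measure_pmf (poisson_pmf s)) (\<lambda>n. c ^ n)" by (rule poisson_integral(1)[OF assms sm])
  have "(\<lambda>n. (of_real s * c) ^ n /\<^sub>R fact n) sums exp (of_real s * c)" by (rule exp_converges)
  from sums_scaleR_right[OF this, of "exp (- s)"]
  have "(\<lambda>n. (s ^ n / fact n * exp (- s)) *\<^sub>R c ^ n) sums (exp (- s) *\<^sub>R exp (of_real s * c))"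
    by (rule back_subst[of "\<lambda>f. f sums _"])
       (auto simp: scaleR_conv_of_real power_mult_distrib field_simps)
  with poisson_integral(2)[OF assms sm]
  have "(\<integral>n. c ^ n \<partial>measure_pmf (poisson_pmf s)) = exp (- s) *\<^sub>R exp (of_real s * c)"
    by (rule sums_unique2)
  also have "\<dots> = exp (of_real s * (c - 1))"
    by (simp add: scaleR_conv_of_real algebra_simps flip: exp_of_real exp_add)
  finally show "(\<integral>n. c ^ n \<partial>measure_pmf (poisson_pmf s)) = exp (of_real s * (c - 1))" .
qed

lemma poisson_integral_power_real:
  fixes c :: real
  assumes "s > 0"
  shows "integrable (measure_pmf (poisson_pmf s)) (\<lambda>n. c ^ n)"
    and "(\<integral>n. c ^ n \<partial>measure_pmf (poisson_pmf s)) = exp (s * (c - 1))"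
proof -
  show i: "integrable (measure_pmf (poisson_pmf s)) (\<lambda>n. c ^ n)"
    using poisson_integral(1)[OF assms, of "\<lambda>n. c ^ n"] summable_exp_pow[of s "\<bar>c\<bar>"]
    by (simp add: power_abs)
  have "complex_of_real (\<integral>n. c ^ n \<partial>measure_pmf (poisson_pmf s)) = of_real (exp (s * (c - 1)))"
    using poisson_integral_power(2)[OF assms, of "of_real c"] i
    by (simp flip: of_real_power exp_of_real)
  then show "(\<integral>n. c ^ n \<partial>measure_pmf (poisson_pmf s)) = exp (s * (c - 1))"
    by (simp only: of_real_eq_iff)
qed

text \<open>The compound Poisson law: a sum of a Poisson distributed number of independent terms
  with law \<open>\<rho>\<close>. Writing it as a mixture reduces tails, transforms and moments to
  Poisson averages over the powers of \<open>\<rho>\<close>.\<close>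

definition cpois :: "real \<Rightarrow> real measure \<Rightarrow> real measure" where
  "cpois s \<rho> = measure_pmf (poisson_pmf s) \<bind> conv_pow \<rho>"

context
  fixes s :: real and \<rho> :: "real measure"
  assumes s: "s > 0" and rd: "real_distribution \<rho>"
begin

lemma conv_pow_kernel: "conv_pow \<rho> \<in> measurable (measure_pmf p) (subprob_algebra borel)"
  using real_distribution_conv_pow[OF rd]
  by (auto simp: measurable_def space_subprob_algebra real_distributionD prob_space_imp_subprob_space)

lemma real_distribution_cpois: "real_distribution (cpois s \<rho>)"
proof (rule real_distributionI)
  show "prob_space (cpois s \<rho>)"
    unfolding cpois_def
    by (rule prob_space.prob_space_bind[OF prob_space_measure_pmf _ conv_pow_kernel])
       (simp add: real_distributionD real_distribution_conv_pow rd)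
  show "sets (cpois s \<rho>) = sets borel"
    unfolding cpois_def by (rule sets_bind) (auto simp: real_distributionD real_distribution_conv_pow rd)
qed

lemma integral_cpois:
  fixes f :: "real \<Rightarrow> real"
  assumes "f \<in> borel_measurable borel" "\<And>x. \<bar>f x\<bar> \<le> B"
  shows "(\<integral>x. f x \<partial>cpois s \<rho>) = (\<integral>n. (\<integral>x. f x \<partial>conv_pow \<rho> n) \<partial>measure_pmf (poisson_pmf s))"
  unfolding cpois_def
proof (rule integral_bind[where K=borel and B=B and B'=1])
  show "AE n in measure_pmf (poisson_pmf s). emeasure (conv_pow \<rho> n) (space (conv_pow \<rho> n)) \<le> ennreal 1"
    by (simp add: prob_space.emeasure_space_1 real_distributionD(2) real_distribution_conv_pow rd)
qed (use assms conv_pow_kernel in \<open>auto simp: prob_space_measure_pmf prob_space.finite_measure\<close>)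

lemma tail_cpois: "tail (cpois s \<rho>) x = (\<integral>n. tail (conv_pow \<rho> n) x \<partial>measure_pmf (poisson_pmf s))"
  unfolding tail_def cpois_def
  by (rule subprob_space.measure_bind[OF prob_space_imp_subprob_space[OF prob_space_measure_pmf] conv_pow_kernel])
     simp

lemma char_cpois: "char (cpois s \<rho>) z = exp (of_real s * (char \<rho> z - 1))"
proof -
  have int: "integrable M (\<lambda>x. iexp (z * x))" if "real_distribution M" for M
    by (rule integrable_bounded[OF that, of _ 1]) auto
  have ip: "integrable (measure_pmf (poisson_pmf s)) (\<lambda>n. char (conv_pow \<rho> n) z)"
    unfolding char_conv_pow[OF rd] by (rule poisson_integral_power(1)[OF s])
  \<comment> \<open>Real and imaginary parts are treated separately because
    \<open>integral_cpois\<close> is stated for real integrands.\<close>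
  have Re: "Re (char M z) = (\<integral>x. cos (z * x) \<partial>M)" and Im: "Im (char M z) = (\<integral>x. sin (z * x) \<partial>M)"
    if "real_distribution M" for M
    unfolding char_def integral_Re[OF int[OF that], symmetric] integral_Im[OF int[OF that], symmetric]
    by (simp_all add: Re_exp Im_exp)
  note rds = real_distribution_cpois real_distribution_conv_pow[OF rd]
  have "char (cpois s \<rho>) z = (\<integral>n. char (conv_pow \<rho> n) z \<partial>measure_pmf (poisson_pmf s))"
  proof (rule complex_eqI)
    show "Re (char (cpois s \<rho>) z) = Re (\<integral>n. char (conv_pow \<rho> n) z \<partial>measure_pmf (poisson_pmf s))"
      unfolding integral_Re[OF ip, symmetric] Re[OF rds(1)] Re[OF rds(2)]
      by (rule integral_cpois[where B=1]) auto
    show "Im (char (cpois s \<rho>) z) = Im (\<integral>n. char (conv_pow \<rho> n) z \<partial>measure_pmf (poisson_pmf s))"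
      unfolding integral_Im[OF ip, symmetric] Im[OF rds(1)] Im[OF rds(2)]
      by (rule integral_cpois[where B=1]) auto
  qed
  then show ?thesis by (simp add: char_conv_pow rd poisson_integral_power s)
qed

lemma exp_moment_cpois:
  assumes "exp_moment \<rho> K = ennreal M" "M \<ge> 0"
  shows "exp_moment (cpois s \<rho>) K = ennreal (exp (s * (M - 1)))"
proof -
  have "exp_moment (cpois s \<rho>) K = (\<integral>\<^sup>+n. exp_moment (conv_pow \<rho> n) K \<partial>measure_pmf (poisson_pmf s))"
    unfolding cpois_def exp_moment_def by (rule nn_integral_bind[OF _ conv_pow_kernel]) simp
  also have "\<dots> = (\<integral>\<^sup>+n. ennreal (M ^ n) \<partial>measure_pmf (poisson_pmf s))"
    using assms by (simp add: exp_moment_conv_pow rd ennreal_power)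
  also have "\<dots> = ennreal (\<integral>n. M ^ n \<partial>measure_pmf (poisson_pmf s))"
    using assms poisson_integral_power_real(1)[OF s] by (intro nn_integral_eq_integral) auto
  finally show ?thesis by (simp add: poisson_integral_power_real s)
qed

end

lemma measure_pos:
  "emeasure M A < \<infinity> \<Longrightarrow> emeasure M A \<noteq> 0 \<Longrightarrow> measure M A > 0"
  by (simp add: measure_def enn2real_positive_iff less_top zero_less_iff_neq_zero)

lemma uniform_measure_eq_density_real:
  assumes "A \<in> sets M" "emeasure M A < \<infinity>" "emeasure M A \<noteq> 0"
  shows "uniform_measure M A = density M (\<lambda>x. ennreal (indicator A x / measure M A))"
proof -
  have 1: "emeasure M A = ennreal (measure M A)" using assms by (simp add: emeasure_eq_ennreal_measure)
  then have "measure M A > 0" using assms by (intro measure_pos)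
  then have "indicator A x / emeasure M A = ennreal (indicator A x / measure M A)" for x
    unfolding 1 by (simp add: divide_ennreal[symmetric] ennreal_indicator)
  then show ?thesis by (simp add: uniform_measure_def)
qed

lemma integral_uniform_measure:
  fixes f :: "_ \<Rightarrow> 'b::{banach, second_countable_topology}"
  assumes "A \<in> sets M" "emeasure M A < \<infinity>" "emeasure M A \<noteq> 0" "f \<in> borel_measurable M"
  shows "measure M A *\<^sub>R (\<integral>x. f x \<partial>uniform_measure M A) = (\<integral>x. indicator A x *\<^sub>R f x \<partial>M)"
proof -
  have "measure M A > 0" using assms by (intro measure_pos)
  moreover have "(\<integral>x. f x \<partial>uniform_measure M A) = (\<integral>x. (indicator A x / measure M A) *\<^sub>R f x \<partial>M)"
    unfolding uniform_measure_eq_density_real[OF assms(1-3)] using assms by (intro integral_density) auto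
  moreover have "(indicator A x / measure M A) *\<^sub>R f x = (1 / measure M A) *\<^sub>R (indicator A x *\<^sub>R f x)" for x
    by simp
  then have "(\<integral>x. (indicator A x / measure M A) *\<^sub>R f x \<partial>M) = (1 / measure M A) *\<^sub>R (\<integral>x. indicator A x *\<^sub>R f x \<partial>M)"
    by (simp only: integral_scaleR_right)
  ultimately show ?thesis by simp
qed

lemma real_distribution_uniform_measure:
  assumes "sets \<nu> = sets borel" "A \<in> sets borel" "emeasure \<nu> A < \<infinity>" "emeasure \<nu> A \<noteq> 0"
  shows "real_distribution (uniform_measure \<nu> A)"
  using assms by (intro real_distributionI prob_space_uniform_measure) auto

text \<open>The factor \<open>measure \<nu> A\<close> in the intensity cancels the normalisation of
  the jump law, leaving an exponent that is an integral against \<open>\<nu>\<close> itself.\<close>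

lemma char_cpois_uniform:
  assumes "sets \<nu> = sets borel" "A \<in> sets borel" "emeasure \<nu> A < \<infinity>" "emeasure \<nu> A \<noteq> 0" "t > 0"
  shows "char (cpois (t * measure \<nu> A) (uniform_measure \<nu> A)) z
    = exp (of_real t * (\<integral>x. indicator A x *\<^sub>R (iexp (z * x) - 1) \<partial>\<nu>))"
proof -
  note rd = real_distribution_uniform_measure[OF assms(1-4)]
  interpret real_distribution "uniform_measure \<nu> A" by (rule rd)
  have pos: "measure \<nu> A > 0"
    using assms by (intro measure_pos)
  have "measure \<nu> A *\<^sub>R (char (uniform_measure \<nu> A) z - 1) = measure \<nu> A *\<^sub>R (\<integral>x. iexp (z * x) - 1 \<partial>uniform_measure \<nu> A)"
    unfolding char_def using prob_space
    by (subst Bochner_Integration.integral_diff) (auto intro!: integrable_iexp simp: real_distributionD rd)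
  also have "\<dots> = (\<integral>x. indicator A x *\<^sub>R (iexp (z * x) - 1) \<partial>\<nu>)"
    using assms by (intro integral_uniform_measure) (auto simp: measurable_cong_sets[OF assms(1) refl])
  finally show ?thesis
    using assms pos by (simp add: char_cpois rd scaleR_conv_of_real mult.assoc)
qed

lemma exp_moment_cpois_uniform:
  assumes "sets \<nu> = sets borel" "A \<in> sets borel" "emeasure \<nu> A < \<infinity>" "emeasure \<nu> A \<noteq> 0" "t > 0"
    and int: "integrable \<nu> (\<lambda>x. indicator A x * exp (K * x))"
  shows "exp_moment (cpois (t * measure \<nu> A) (uniform_measure \<nu> A)) K
    = ennreal (exp (t * (\<integral>x. indicator A x * (exp (K * x) - 1) \<partial>\<nu>)))"
proof -
  note rd = real_distribution_uniform_measure[OF assms(1-4)]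
  interpret real_distribution "uniform_measure \<nu> A" by (rule rd)
  have pos: "measure \<nu> A > 0"
    using assms by (intro measure_pos)
  have eqd: "uniform_measure \<nu> A = density \<nu> (\<lambda>x. ennreal (indicator A x / measure \<nu> A))"
    using assms by (intro uniform_measure_eq_density_real) auto
  have m: "f \<in> borel_measurable \<nu> \<longleftrightarrow> f \<in> borel_measurable borel" for f :: "real \<Rightarrow> real"
    by (rule arg_cong2[where f="(\<in>)"]) (simp_all add: measurable_cong_sets[OF assms(1) refl])
  have A: "A \<in> sets \<nu>" using assms by simp
  have i: "integrable (uniform_measure \<nu> A) (\<lambda>x. exp (K * x))"
    unfolding eqd using int pos A by (subst integrable_density) (auto simp: m assms(2) intro!: borel_measurable_divide borel_measurable_indicator)
  define M where "M = (\<integral>x. exp (K * x) \<partial>uniform_measure \<nu> A)"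
  have "exp_moment (uniform_measure \<nu> A) K = ennreal M"
    unfolding exp_moment_def M_def by (rule nn_integral_eq_integral[OF i]) simp
  then have "exp_moment (cpois (t * measure \<nu> A) (uniform_measure \<nu> A)) K = ennreal (exp (t * measure \<nu> A * (M - 1)))"
    using assms pos by (intro exp_moment_cpois rd) (auto simp: M_def)
  moreover have "measure \<nu> A * (M - 1) = measure \<nu> A *\<^sub>R (\<integral>x. exp (K * x) - 1 \<partial>uniform_measure \<nu> A)"
    unfolding M_def using prob_space i by (subst Bochner_Integration.integral_diff) auto
  moreover have "measure \<nu> A *\<^sub>R (\<integral>x. exp (K * x) - 1 \<partial>uniform_measure \<nu> A) = (\<integral>x. indicator A x *\<^sub>R (exp (K * x) - 1) \<partial>\<nu>)"
    using assms A by (intro integral_uniform_measure) (auto simp: m)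
  ultimately show ?thesis by (simp add: mult.assoc)
qed

section \<open>Laws with a given Levy-Khintchine exponent\<close>

lemma exp_moment_tail_bound:
  assumes "real_distribution P" "exp_moment P K \<le> ennreal B" "K > 0" "B \<ge> 0"
  shows "tail P R \<le> exp (- (K * R)) * B"
proof -
  interpret real_distribution P by fact
  have "emeasure P {R<..} = (\<integral>\<^sup>+x. indicator {R<..} x \<partial>P)" by simp
  also have "\<dots> \<le> (\<integral>\<^sup>+x. ennreal (exp (- (K * R))) * ennreal (exp (K * x)) \<partial>P)"
    using \<open>K > 0\<close> by (intro nn_integral_mono) (auto simp: indicator_def simp flip: ennreal_mult exp_add intro!: ennreal_leI)
  also have "\<dots> = ennreal (exp (- (K * R))) * exp_moment P K"
    by (subst nn_integral_cmult) (auto simp: exp_moment_def)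
  also have "\<dots> \<le> ennreal (exp (- (K * R))) * ennreal B"
    using assms by (intro mult_left_mono) auto
  finally have "ennreal (tail P R) \<le> ennreal (exp (- (K * R)) * B)"
    using assms by (simp add: tail_def emeasure_eq_measure ennreal_mult)
  then show ?thesis using assms by (subst (asm) ennreal_le_iff) auto
qed

text \<open>Exponential moments of orders \<open>1\<close> and \<open>-1\<close>, bounded uniformly,
  make both tails uniformly small, hence the family is tight and has a weak limit point. Its
  characteristic function is the given limit. The bounds are inherited by the bounded truncations of
  the exponential and then by their supremum.\<close>

lemma char_limit_exists:
  fixes P :: "nat \<Rightarrow> real measure"
  assumes rd: "\<And>k. real_distribution (P k)"
    and mom: "\<And>k K. exp_moment (P k) K \<le> ennreal (B K)" and B: "\<And>K. B K \<ge> 0"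
    and lim: "\<And>z. (\<lambda>k. char (P k) z) \<longlonglongrightarrow> \<phi> z"
  obtains M where "real_distribution M" "\<And>z. char M z = \<phi> z" "\<And>K. exp_moment M K \<le> ennreal (B K)"
proof -
  have tight: "tight P"
    unfolding tight_def
  proof (intro conjI allI impI rd)
    fix e :: real assume e: "e > 0"
    have "((\<lambda>R. exp (- R) * B 1 + exp (- R) * B (- 1)) \<longlongrightarrow> 0) at_top"
      by real_asymp
    from order_tendstoD(2)[OF this e] eventually_gt_at_top[of "0::real"]
    have "\<forall>\<^sub>F R in at_top. exp (- R) * B 1 + exp (- R) * B (- 1) < e \<and> R > 0" by eventually_elim auto
    then obtain R where R: "exp (- R) * B 1 + exp (- R) * B (- 1) < e" "R > 0"
      using eventually_happens by fastforce
    have "measure (P k) {- R<..R} > 1 - e" for k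
    proof -
      interpret real_distribution "P k" by (rule rd)
      have "emeasure (P k) {..- R} = (\<integral>\<^sup>+x. indicator {..- R} x \<partial>P k)" by simp
      also have "\<dots> \<le> (\<integral>\<^sup>+x. ennreal (exp (- R)) * ennreal (exp ((- 1) * x)) \<partial>P k)"
        by (intro nn_integral_mono) (auto simp: indicator_def simp flip: ennreal_mult exp_add intro!: ennreal_leI)
      also have "\<dots> = ennreal (exp (- R)) * exp_moment (P k) (- 1)"
        by (subst nn_integral_cmult) (auto simp: exp_moment_def)
      also have "\<dots> \<le> ennreal (exp (- R)) * ennreal (B (- 1))"
        using mom by (intro mult_left_mono) auto
      finally have "measure (P k) {..- R} \<le> exp (- R) * B (- 1)"
        using B by (simp add: emeasure_eq_measure flip: ennreal_mult)
      moreover have "measure (P k) {R<..} \<le> exp (- R) * B 1"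
        using exp_moment_tail_bound[of "P k" 1 "B 1" R] rd mom B by (simp add: tail_def)
      moreover have "{..-R} \<union> ({-R<..R} \<union> {R<..}) = space (P k)" using R by force
      then have "1 = measure (P k) ({..-R} \<union> ({-R<..R} \<union> {R<..}))"
        using prob_space by metis
      then have "1 = measure (P k) {..-R} + (measure (P k) {-R<..R} + measure (P k) {R<..})"
        using R finite_measure_Union[of "{..-R}" "{-R<..R} \<union> {R<..}"] finite_measure_Union[of "{-R<..R}" "{R<..}"]
        by (simp add: disjoint_iff)
      ultimately show ?thesis using R by linarith
    qed
    then show "\<exists>a b. a < b \<and> (\<forall>n. 1 - e < measure (P n) {a<..b})"
      using R by (intro exI[of _ "-R"] exI[of _ R]) auto
  qed
  obtain r M where r: "strict_mono (r :: nat \<Rightarrow> nat)" and M: "real_distribution M" and w: "weak_conv_m (P \<circ> id \<circ> r) M"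
    using tight_imp_convergent_subsubsequence[OF tight strict_mono_id] by blast
  have rdr: "real_distribution ((P \<circ> id \<circ> r) k)" for k by (simp add: rd)
  show thesis
  proof (rule that[OF M])
    fix z
    have "(\<lambda>k. char ((P \<circ> id \<circ> r) k) z) \<longlonglongrightarrow> char M z"
      by (rule levy_continuity1[OF rdr M w])
    moreover have "(\<lambda>k. char ((P \<circ> id \<circ> r) k) z) \<longlonglongrightarrow> \<phi> z"
      using LIMSEQ_subseq_LIMSEQ[OF lim r] by (simp add: o_def)
    ultimately show "char M z = \<phi> z" by (rule LIMSEQ_unique)
  next
    fix K
    interpret M: real_distribution M by (rule M)
    have m: "(\<integral>\<^sup>+x. ennreal (min (exp (K * x)) (real N)) \<partial>M) \<le> ennreal (B K)" for N
    proof -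
      let ?f = "\<lambda>x. min (exp (K * x)) (real N)"
      have bd: "norm (?f x) \<le> real N" for x by (auto simp: abs_le_iff min_def intro: order_trans[of _ 0])
      have int: "integrable Q ?f" if "real_distribution Q" for Q
        by (rule integrable_bounded[OF that _ bd]) measurable
      have "(\<lambda>k. integral\<^sup>L ((P \<circ> id \<circ> r) k) ?f) \<longlonglongrightarrow> integral\<^sup>L M ?f"
        by (rule weak_conv_imp_integral_bdd_continuous_conv[OF rdr M w _ bd]) (intro continuous_intros)
      moreover have "integral\<^sup>L ((P \<circ> id \<circ> r) k) ?f \<le> B K" for k
      proof -
        have "ennreal (integral\<^sup>L (P (r k)) ?f) = (\<integral>\<^sup>+x. ennreal (?f x) \<partial>P (r k))"
          by (rule nn_integral_eq_integral[symmetric, OF int[OF rd]]) simp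
        also have "\<dots> \<le> exp_moment (P (r k)) K"
          unfolding exp_moment_def by (intro nn_integral_mono ennreal_leI) auto
        also have "\<dots> \<le> ennreal (B K)" by (rule mom)
        finally show ?thesis using B by (simp add: ennreal_le_iff)
      qed
      ultimately have "integral\<^sup>L M ?f \<le> B K" by (intro LIMSEQ_le_const2) auto
      then show ?thesis
        by (subst nn_integral_eq_integral[OF int[OF M]]) (auto intro: ennreal_leI)
    qed
    have "exp_moment M K = (\<integral>\<^sup>+x. (SUP N. ennreal (min (exp (K * x)) (real N))) \<partial>M)"
      unfolding exp_moment_def
    proof (intro nn_integral_cong antisym SUP_least ennreal_leI)
      fix x
      obtain N where "exp (K * x) \<le> real N" using real_arch_simple by blast
      then have "ennreal (exp (K * x)) \<le> ennreal (min (exp (K * x)) (real N))" by (intro ennreal_leI) auto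
      also have "\<dots> \<le> (SUP N. ennreal (min (exp (K * x)) (real N)))" by (rule SUP_upper) simp
      finally show "ennreal (exp (K * x)) \<le> (SUP N. ennreal (min (exp (K * x)) (real N)))" .
    qed auto
    also have "\<dots> = (SUP N. \<integral>\<^sup>+x. ennreal (min (exp (K * x)) (real N)) \<partial>M)"
      by (rule nn_integral_monotone_convergence_SUP) (auto simp: incseq_def le_fun_def intro!: ennreal_leI min.mono)
    also have "\<dots> \<le> ennreal (B K)" by (intro SUP_least m)
    finally show "exp_moment M K \<le> ennreal (B K)" .
  qed
qed

lemma char_return: "char (return borel c) z = iexp (z * c)"
  by (simp add: char_def integral_return)

lemma exp_moment_return: "exp_moment (return borel c) K = ennreal (exp (K * c))"
  by (simp add: exp_moment_def nn_integral_return)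

lemma gaussian_exists:
  assumes "a \<ge> 0"
  obtains P where "real_distribution P" "\<And>z. char P z = exp (- complex_of_real (a * z\<^sup>2 / 2))"
    "\<And>K. exp_moment P K < \<infinity>"
proof -
  let ?N = std_normal_distribution
  interpret N: real_distribution ?N by (rule real_dist_normal_dist)
  \<comment> \<open>Scaling a standard normal variable, rather than taking a density of variance
    \<open>a\<close>, includes the degenerate case \<open>a = 0\<close>.\<close>
  let ?P = "distr ?N borel (\<lambda>x. sqrt a * x)"
  have "real_distribution ?P" by (intro real_distributionI N.prob_space_distr) auto
  moreover have "char ?P z = exp (- complex_of_real (a * z\<^sup>2 / 2))" for z
  proof -
    have "char ?P z = char ?N (z * sqrt a)"
      unfolding char_def by (subst integral_distr) (auto simp: mult_ac)
    moreover have "(complex_of_real (sqrt a))\<^sup>2 = of_real a" using assms by (simp flip: of_real_power)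
    ultimately show ?thesis
      by (simp add: char_std_normal_distribution power_mult_distrib mult.commute flip: exp_of_real)
  qed
  moreover have "exp_moment ?P K < \<infinity>" for K
  proof -
    let ?k = "K * sqrt a"
    have "exp_moment ?P K = (\<integral>\<^sup>+x. ennreal (exp (?k * x)) \<partial>?N)"
      unfolding exp_moment_def by (subst nn_integral_distr) (auto simp: mult_ac)
    also have "\<dots> = (\<integral>\<^sup>+x. ennreal (std_normal_density x) * ennreal (exp (?k * x)) \<partial>lborel)"
      by (subst nn_integral_density) auto
    also have "\<dots> = (\<integral>\<^sup>+x. ennreal (exp (?k\<^sup>2 / 2)) * ennreal (normal_density ?k 1 x) \<partial>lborel)"
    proof (intro nn_integral_cong)
      fix x
      \<comment> \<open>Completing the square.\<close>
      have "std_normal_density x * exp (?k * x) = exp (?k\<^sup>2 / 2) * normal_density ?k 1 x"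
        unfolding normal_density_def by (simp add: field_simps power2_eq_square flip: exp_add)
      then show "ennreal (std_normal_density x) * ennreal (exp (?k * x)) = ennreal (exp (?k\<^sup>2 / 2)) * ennreal (normal_density ?k 1 x)"
        by (simp flip: ennreal_mult)
    qed
    also have "\<dots> = ennreal (exp (?k\<^sup>2 / 2)) * (\<integral>\<^sup>+x. ennreal (normal_density ?k 1 x) \<partial>lborel)"
      by (rule nn_integral_cmult) simp
    also have "(\<integral>\<^sup>+x. ennreal (normal_density ?k 1 x) \<partial>lborel) = 1"
      using prob_space.emeasure_space_1[OF prob_space_normal_density[of 1 ?k]] by (simp add: emeasure_density)
    finally show ?thesis by simp
  qed
  ultimately show ?thesis using that by blast
qed

lemma integral_indicator_null_set:
  fixes f :: "_ \<Rightarrow> 'b::{banach, second_countable_topology}"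
  assumes "A \<in> sets M" "emeasure M A = 0"
  shows "(\<integral>x. indicator A x *\<^sub>R f x \<partial>M) = 0"
proof (rule integral_eq_zero_AE)
  have "AE x in M. x \<notin> A" using assms by (intro AE_not_in) auto
  then show "AE x in M. indicator A x *\<^sub>R f x = 0" by eventually_elim simp
qed

text \<open>On a null set the normalised measure would be degenerate; the point mass at
  \<open>0\<close> then realises the trivial exponent. With this case included, the pieces of the
  Levy measure need no case distinction later.\<close>

lemma cpois_restrict_exists:
  assumes "sets \<nu> = sets borel" "A \<in> sets borel" "emeasure \<nu> A < \<infinity>" "t > 0"
  obtains P where "real_distribution P"
    "\<And>z. char P z = exp (of_real t * (\<integral>x. indicator A x *\<^sub>R (iexp (z * x) - 1) \<partial>\<nu>))"
    "\<And>K. integrable \<nu> (\<lambda>x. indicator A x * exp (K * x)) \<Longrightarrow>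
      exp_moment P K = ennreal (exp (t * (\<integral>x. indicator A x * (exp (K * x) - 1) \<partial>\<nu>)))"
proof (cases "emeasure \<nu> A = 0")
  case True
  have z: "(\<integral>x. indicator A x *\<^sub>R f x \<partial>\<nu>) = 0" for f :: "real \<Rightarrow> complex"
    using True assms by (intro integral_indicator_null_set) auto
  have z': "(\<integral>x. indicator A x * f x \<partial>\<nu>) = 0" for f :: "real \<Rightarrow> real"
    using integral_indicator_null_set[of A \<nu> f] True assms by simp
  show ?thesis
    by (rule that[OF real_distribution_return[of 0]])
       (use z z' in \<open>simp_all add: char_return exp_moment_return\<close>)
next
  case False
  show ?thesis
    by (rule that[OF real_distribution_cpois[OF _ real_distribution_uniform_measure[OF assms(1-3) False]]
          char_cpois_uniform[OF assms(1-3) False assms(4)] exp_moment_cpois_uniform[OF assms(1-3) False assms(4)]])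
       (use measure_pos[OF assms(3) False] assms(4) in auto)
qed

section \<open>The Levy-Khintchine kernel and the law of the small jumps\<close>

definition lk_kernel :: "real \<Rightarrow> real \<Rightarrow> complex" where
  "lk_kernel z x = iexp (z * x) - 1 - \<i> * complex_of_real (z * x * indicator {-1..1} x)"

lemma measurable_lk_kernel [measurable]: "lk_kernel z \<in> borel_measurable borel"
  unfolding lk_kernel_def by measurable

lemma iexp_minus_1_minus_le: "cmod (iexp y - 1 - \<i> * complex_of_real y) \<le> y\<^sup>2 / 2"
  using iexp_approx1[of y 1] by (simp add: power2_eq_square diff_diff_eq fact_numeral)

lemma norm_iexp_minus_1_le: "cmod (iexp y - 1) \<le> 2"
  using norm_triangle_ineq4[of "iexp y" 1] by simp

text \<open>The second-order Taylor bound of the compensated kernel near \<open>0\<close> and the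
  trivial bound \<open>2\<close> away from it combine into a multiple of the function that every
  Levy measure integrates.\<close>

lemma norm_lk_kernel_le: "cmod (lk_kernel z x) \<le> (2 + z\<^sup>2) * min 1 (x\<^sup>2)"
proof (cases "x \<in> {-1..1}")
  case True
  then have "\<bar>x\<bar> \<le> 1" by auto
  then have "x\<^sup>2 \<le> 1" by (simp add: abs_square_le_1)
  moreover have "cmod (lk_kernel z x) \<le> (z * x)\<^sup>2 / 2"
    using True iexp_minus_1_minus_le[of "z * x"] by (simp add: lk_kernel_def)
  moreover have "(z * x)\<^sup>2 / 2 \<le> (2 + z\<^sup>2) * x\<^sup>2"
    using zero_le_power2[of "z * x"] by (simp add: algebra_simps power_mult_distrib)
  ultimately show ?thesis by (simp add: min_def)
next
  case False
  then have "1 \<le> \<bar>x\<bar>" by auto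
  then have "1 \<le> x\<^sup>2" using abs_le_square_iff[of 1 x] by simp
  moreover have "cmod (lk_kernel z x) \<le> 2"
    using False norm_iexp_minus_1_le[of "z * x"] by (simp add: lk_kernel_def)
  ultimately show ?thesis by (simp add: min_def add_increasing2)
qed

lemma exp_minus_1_minus_le:
  fixes y :: real shows "exp y - 1 - y \<le> exp \<bar>y\<bar> * y\<^sup>2"
  using Taylor_exp_field[of y 1] by (simp add: power2_eq_square diff_diff_eq)

lemma integrable_indicator_bounded:
  fixes f :: "'a \<Rightarrow> 'b::{banach, second_countable_topology}"
  assumes "A \<in> sets M" "emeasure M A < \<infinity>" "f \<in> borel_measurable M" "\<And>x. x \<in> A \<Longrightarrow> norm (f x) \<le> b"
  shows "integrable M (\<lambda>x. indicator A x *\<^sub>R f x)"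
proof (rule Bochner_Integration.integrable_bound)
  show "integrable M (\<lambda>x. b * indicator A x)"
    using assms(1,2) by (intro integrable_mult_right) (simp add: integrable_indicator_iff)
  show "AE x in M. norm (indicator A x *\<^sub>R f x) \<le> norm (b * indicator A x)"
    using assms(4) by (auto simp: indicator_def intro: order_trans[OF _ abs_ge_self])
qed (use assms in measurable)

context
  fixes \<nu> :: "real measure"
  assumes sets_nu: "sets \<nu> = sets borel"
    and levy: "(\<integral>\<^sup>+ x. ennreal (min 1 (x\<^sup>2)) \<partial>\<nu>) < \<infinity>"
begin

lemma measurable_nu: "borel_measurable \<nu> = borel_measurable borel"
  by (rule measurable_cong_sets[OF sets_nu refl])

lemma integrable_min_square: "integrable \<nu> (\<lambda>x. min 1 (x\<^sup>2))"
  using levy by (intro integrableI_nonneg) (auto simp: measurable_nu)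

lemma emeasure_nu_finite:
  assumes "A \<in> sets borel" "e > 0" "\<And>x. x \<in> A \<Longrightarrow> e \<le> \<bar>x\<bar>"
  shows "emeasure \<nu> A < \<infinity>"
proof -
  define c where "c = min 1 (e\<^sup>2)"
  have c: "c > 0" using assms by (simp add: c_def)
  have "indicator A x \<le> (1 / c) * min 1 (x\<^sup>2)" for x
  proof (cases "x \<in> A")
    case True
    then have "e\<^sup>2 \<le> x\<^sup>2" using assms(2,3) abs_le_square_iff[of e x] by auto
    then have "c \<le> min 1 (x\<^sup>2)" by (auto simp: c_def)
    then show ?thesis using c True by (simp add: field_simps)
  qed (use c in auto)
  moreover have "integrable \<nu> (\<lambda>x. (1 / c) * min 1 (x\<^sup>2))"
    using integrable_min_square by (rule integrable_mult_right)
  moreover have "(indicator A :: real \<Rightarrow> real) \<in> borel_measurable \<nu>"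
    using assms(1) sets_nu by (intro borel_measurable_indicator) simp
  ultimately have "integrable \<nu> (indicator A :: real \<Rightarrow> real)"
    by (elim Bochner_Integration.integrable_bound)
       (assumption, use c in \<open>intro AE_I2, simp\<close>)
  then show ?thesis using assms(1) sets_nu by (simp add: integrable_indicator_iff)
qed

lemma integrable_lk_kernel:
  assumes "A \<in> sets borel"
  shows "integrable \<nu> (\<lambda>x. indicator A x *\<^sub>R lk_kernel z x)"
proof (rule Bochner_Integration.integrable_bound[OF integrable_mult_right[OF integrable_min_square, of "2 + z\<^sup>2"]])
  have "norm (indicator A x *\<^sub>R lk_kernel z x) \<le> norm ((2 + z\<^sup>2) * min 1 (x\<^sup>2))" for x
    using norm_lk_kernel_le[of z x] by (auto simp: indicator_def abs_mult)
  then show "AE x in \<nu>. norm (indicator A x *\<^sub>R lk_kernel z x) \<le> norm ((2 + z\<^sup>2) * min 1 (x\<^sup>2))" by simp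
qed (use assms in \<open>auto simp: measurable_nu\<close>)

text \<open>The jumps in \<open>[-1, 1]\<close> may have infinite total mass. Jumps of size at most
  \<open>1 / Suc k\<close> are cut off, the rest forms a compound Poisson law recentred by its mean,
  and \<open>k\<close> tends to infinity. Recentring leaves only second-order terms in both
  transforms, and these are controlled uniformly in \<open>k\<close>.\<close>

lemma small_jumps_exists:
  assumes t: "t > 0"
  obtains P where "real_distribution P"
    "\<And>z. char P z = exp (of_real t * (\<integral>x. indicator {-1..1} x *\<^sub>R lk_kernel z x \<partial>\<nu>))"
    "\<And>K. exp_moment P K < \<infinity>"
proof -
  define D where "D k = {x::real. 1 / real (Suc k) < \<bar>x\<bar> \<and> \<bar>x\<bar> \<le> 1}" for k
  have Dm: "D k \<in> sets borel" for k unfolding D_def by measurable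
  have Df: "emeasure \<nu> (D k) < \<infinity>" for k
    by (rule emeasure_nu_finite[OF Dm, of "1 / real (Suc k)"]) (auto simp: D_def)
  have iD: "integrable \<nu> (\<lambda>x. indicator (D k) x *\<^sub>R f x)"
    if "f \<in> borel_measurable borel" "\<And>x. \<bar>x\<bar> \<le> 1 \<Longrightarrow> norm (f x) \<le> b" for k b and f :: "real \<Rightarrow> complex"
    by (rule integrable_indicator_bounded[OF _ Df, of _ _ b]) (use that Dm sets_nu in \<open>auto simp: measurable_nu D_def\<close>)
  have iDr: "integrable \<nu> (\<lambda>x. indicator (D k) x * f x)"
    if "f \<in> borel_measurable borel" "\<And>x. \<bar>x\<bar> \<le> 1 \<Longrightarrow> \<bar>f x\<bar> \<le> b" for k b and f :: "real \<Rightarrow> real"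
    unfolding real_scaleR_def[symmetric]
    by (rule integrable_indicator_bounded[OF _ Df, of _ _ b]) (use that Dm sets_nu in \<open>auto simp: measurable_nu D_def\<close>)
  have iexpD: "integrable \<nu> (\<lambda>x. indicator (D k) x * exp (K * x))" for k K
  proof (rule iDr)
    fix x :: real assume "\<bar>x\<bar> \<le> 1"
    have "K * x \<le> \<bar>K\<bar> * \<bar>x\<bar>" using abs_ge_self[of "K * x"] by (simp only: abs_mult)
    also have "\<dots> \<le> \<bar>K\<bar>" using \<open>\<bar>x\<bar> \<le> 1\<close> by (simp add: mult_left_le)
    finally show "\<bar>exp (K * x)\<bar> \<le> exp \<bar>K\<bar>" by simp
  qed measurable
  \<comment> \<open>The drift that recentres the truncated compound Poisson law. It may diverge as
    \<open>k\<close> grows, so moments are bounded only after it has been absorbed.\<close>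
  define c where "c k = - t * (\<integral>x. indicator (D k) x * x \<partial>\<nu>)" for k
  define B where "B K = exp (t * ((exp \<bar>K\<bar> * K\<^sup>2) * (\<integral>x. min 1 (x\<^sup>2) \<partial>\<nu>)))" for K
  have ix: "integrable \<nu> (\<lambda>x. indicator (D k) x * x)" for k by (rule iDr[of _ 1]) auto
  have ei: "(\<integral>x. indicator (D k) x * (exp (K * x) - 1) \<partial>\<nu>) - K * (\<integral>x. indicator (D k) x * x \<partial>\<nu>)
      \<le> (exp \<bar>K\<bar> * K\<^sup>2) * (\<integral>x. min 1 (x\<^sup>2) \<partial>\<nu>)" for k K
  proof -
    have i1: "integrable \<nu> (\<lambda>x. indicator (D k) x * (exp (K * x) - 1))"
      using Bochner_Integration.integrable_diff[OF iexpD[of k K] iDr[of "\<lambda>_. 1" 1 k]] by (simp add: right_diff_distrib)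
    have "(\<integral>x. indicator (D k) x * (exp (K * x) - 1) \<partial>\<nu>) - K * (\<integral>x. indicator (D k) x * x \<partial>\<nu>)
      = (\<integral>x. indicator (D k) x * (exp (K * x) - 1) - K * (indicator (D k) x * x) \<partial>\<nu>)"
      by (subst Bochner_Integration.integral_diff[OF i1 integrable_mult_right[OF ix]]) simp
    also have "\<dots> \<le> (\<integral>x. (exp \<bar>K\<bar> * K\<^sup>2) * min 1 (x\<^sup>2) \<partial>\<nu>)"
    proof (rule integral_mono)
      fix x
      show "indicator (D k) x * (exp (K * x) - 1) - K * (indicator (D k) x * x) \<le> (exp \<bar>K\<bar> * K\<^sup>2) * min 1 (x\<^sup>2)"
      proof (cases "x \<in> D k")
        case True
        then have x: "\<bar>x\<bar> \<le> 1" by (simp add: D_def)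
        then have "x\<^sup>2 \<le> 1" by (simp add: abs_square_le_1)
        have "exp (K * x) - 1 - K * x \<le> exp \<bar>K * x\<bar> * (K * x)\<^sup>2" by (rule exp_minus_1_minus_le)
        also have "\<dots> \<le> exp \<bar>K\<bar> * (K * x)\<^sup>2"
          using x by (intro mult_right_mono) (auto simp: abs_mult mult_left_le)
        finally show ?thesis using True \<open>x\<^sup>2 \<le> 1\<close> by (simp add: power_mult_distrib)
      qed simp
    qed (intro Bochner_Integration.integrable_diff i1 integrable_mult_right ix integrable_min_square)+
    also have "\<dots> = (exp \<bar>K\<bar> * K\<^sup>2) * (\<integral>x. min 1 (x\<^sup>2) \<partial>\<nu>)" by (rule integral_mult_right_zero)
    finally show ?thesis .
  qed
  have "\<exists>P. real_distribution P \<and>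
    (\<forall>z. char P z = exp (of_real t * (\<integral>x. indicator (D k) x *\<^sub>R lk_kernel z x \<partial>\<nu>))) \<and>
    (\<forall>K. exp_moment P K \<le> ennreal (B K))" for k
  proof -
    obtain P where P: "real_distribution P"
      "\<And>z. char P z = exp (of_real t * (\<integral>x. indicator (D k) x *\<^sub>R (iexp (z * x) - 1) \<partial>\<nu>))"
      "\<And>K. integrable \<nu> (\<lambda>x. indicator (D k) x * exp (K * x)) \<Longrightarrow>
        exp_moment P K = ennreal (exp (t * (\<integral>x. indicator (D k) x * (exp (K * x) - 1) \<partial>\<nu>)))"
      by (rule cpois_restrict_exists[OF sets_nu Dm[of k] Df[of k] t], rule that)
    let ?Q = "P \<star> return borel (c k)"
    note rdr = real_distribution_return[of "c k"]
    have "char ?Q z = exp (of_real t * (\<integral>x. indicator (D k) x *\<^sub>R lk_kernel z x \<partial>\<nu>))" for z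
    proof -
      have i1: "integrable \<nu> (\<lambda>x. indicator (D k) x *\<^sub>R (iexp (z * x) - 1))"
        by (rule iD[of _ 2]) (measurable, rule norm_iexp_minus_1_le)
      have i2: "integrable \<nu> (\<lambda>x. \<i> * of_real z * complex_of_real (indicator (D k) x * x))"
        by (intro integrable_mult_right integrable_of_real ix)
      have "(\<integral>x. indicator (D k) x *\<^sub>R lk_kernel z x \<partial>\<nu>)
        = (\<integral>x. indicator (D k) x *\<^sub>R (iexp (z * x) - 1) - \<i> * of_real z * complex_of_real (indicator (D k) x * x) \<partial>\<nu>)"
        by (intro Bochner_Integration.integral_cong refl)
           (auto simp: lk_kernel_def D_def indicator_def abs_le_iff)
      also have "\<dots> = (\<integral>x. indicator (D k) x *\<^sub>R (iexp (z * x) - 1) \<partial>\<nu>)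
          - \<i> * of_real z * of_real (\<integral>x. indicator (D k) x * x \<partial>\<nu>)"
        by (subst Bochner_Integration.integral_diff[OF i1 i2])
           (simp only: integral_mult_right_zero integral_of_real[OF ix])
      finally have eq: "(\<integral>x. indicator (D k) x *\<^sub>R lk_kernel z x \<partial>\<nu>)
        = (\<integral>x. indicator (D k) x *\<^sub>R (iexp (z * x) - 1) \<partial>\<nu>)
          - \<i> * of_real z * of_real (\<integral>x. indicator (D k) x * x \<partial>\<nu>)" .
      show ?thesis
        unfolding char_convolution[OF P(1) rdr] P(2) char_return exp_add[symmetric] eq
        by (rule arg_cong[where f=exp]) (simp add: c_def right_diff_distrib)
    qed
    moreover have "exp_moment ?Q K \<le> ennreal (B K)" for K
    proof -
      have "exp_moment ?Q K = ennreal (exp (t * ((\<integral>x. indicator (D k) x * (exp (K * x) - 1) \<partial>\<nu>) - K * (\<integral>x. indicator (D k) x * x \<partial>\<nu>))))"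
        unfolding exp_moment_convolution[OF P(1) rdr] P(3)[OF iexpD] exp_moment_return
        by (simp add: c_def algebra_simps flip: exp_add ennreal_mult)
      also have "\<dots> \<le> ennreal (B K)"
        unfolding B_def by (intro ennreal_leI exp_le_cancel_iff[THEN iffD2] mult_left_mono ei less_imp_le[OF t])
      finally show ?thesis .
    qed
    ultimately show ?thesis using real_distribution_convolution[OF P(1) rdr] by blast
  qed
  then obtain P where P: "\<And>k. real_distribution (P k)"
    "\<And>k z. char (P k) z = exp (of_real t * (\<integral>x. indicator (D k) x *\<^sub>R lk_kernel z x \<partial>\<nu>))"
    "\<And>k K. exp_moment (P k) K \<le> ennreal (B K)" by metis
  have lim: "(\<lambda>k. char (P k) z) \<longlonglongrightarrow> exp (of_real t * (\<integral>x. indicator {-1..1} x *\<^sub>R lk_kernel z x \<partial>\<nu>))" for z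
    unfolding P(2)
  proof (intro tendsto_intros integral_dominated_convergence)
    show "integrable \<nu> (\<lambda>x. (2 + z\<^sup>2) * min 1 (x\<^sup>2))"
      by (rule integrable_mult_right[OF integrable_min_square])
    show "AE x in \<nu>. norm (indicator (D k) x *\<^sub>R lk_kernel z x) \<le> (2 + z\<^sup>2) * min 1 (x\<^sup>2)" for k
    proof (rule AE_I2)
      fix x
      have "norm (indicator (D k) x *\<^sub>R lk_kernel z x) \<le> cmod (lk_kernel z x)" by (simp add: indicator_def)
      then show "norm (indicator (D k) x *\<^sub>R lk_kernel z x) \<le> (2 + z\<^sup>2) * min 1 (x\<^sup>2)"
        using norm_lk_kernel_le by (rule order_trans)
    qed
    show "AE x in \<nu>. (\<lambda>k. indicator (D k) x *\<^sub>R lk_kernel z x) \<longlonglongrightarrow> indicator {-1..1} x *\<^sub>R lk_kernel z x"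
    proof (rule AE_I2)
      fix x :: real
      show "(\<lambda>k. indicator (D k) x *\<^sub>R lk_kernel z x) \<longlonglongrightarrow> indicator {-1..1} x *\<^sub>R lk_kernel z x"
      \<comment> \<open>The point \<open>0\<close> lies in no \<open>D k\<close>, but the kernel
        vanishes there.\<close>
      proof (cases "x = 0 \<or> x \<notin> {-1..1}")
        case True
        then have "indicator (D k) x *\<^sub>R lk_kernel z x = indicator {-1..1} x *\<^sub>R lk_kernel z x" for k
          by (auto simp: D_def indicator_def lk_kernel_def abs_le_iff)
        then show ?thesis by (simp only: tendsto_const)
      next
        case False
        have "(\<lambda>k. 1 / real (Suc k)) \<longlonglongrightarrow> 0" by (rule lim_1_over_n[THEN LIMSEQ_Suc, unfolded o_def])
        then have "\<forall>\<^sub>F k in sequentially. 1 / real (Suc k) < \<bar>x\<bar>"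
          by (rule order_tendstoD(2)) (use False in simp)
        then have "\<forall>\<^sub>F k in sequentially. indicator {-1..1} x *\<^sub>R lk_kernel z x = indicator (D k) x *\<^sub>R lk_kernel z x"
          by eventually_elim (use False in \<open>simp add: D_def indicator_def abs_le_iff\<close>)
        then show ?thesis by (rule Lim_transform_eventually[OF tendsto_const])
      qed
    qed
  qed (use Dm in \<open>auto simp: measurable_nu\<close>)
  obtain M where "real_distribution M"
    "\<And>z. char M z = exp (of_real t * (\<integral>x. indicator {-1..1} x *\<^sub>R lk_kernel z x \<partial>\<nu>))"
    "\<And>K. exp_moment M K \<le> ennreal (B K)"
    using char_limit_exists[OF P(1) P(3) _ lim] by (auto simp: B_def)
  then show ?thesis using that by (metis ennreal_less_top infinity_ennreal_def order_le_less_trans)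
qed

end

context
  fixes \<nu> :: "real measure"
  assumes sets_nu: "sets \<nu> = sets borel"
    and levy: "(\<integral>\<^sup>+ x. ennreal (min 1 (x\<^sup>2)) \<partial>\<nu>) < \<infinity>"
begin

lemma integral_lk_kernel_Un:
  assumes "A \<in> sets borel" "B \<in> sets borel" "A \<inter> B = {}"
  shows "(\<integral>x. indicator (A \<union> B) x *\<^sub>R lk_kernel z x \<partial>\<nu>)
    = (\<integral>x. indicator A x *\<^sub>R lk_kernel z x \<partial>\<nu>) + (\<integral>x. indicator B x *\<^sub>R lk_kernel z x \<partial>\<nu>)"
proof -
  have "(\<integral>x. indicator (A \<union> B) x *\<^sub>R lk_kernel z x \<partial>\<nu>)
    = (\<integral>x. indicator A x *\<^sub>R lk_kernel z x + indicator B x *\<^sub>R lk_kernel z x \<partial>\<nu>)"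
    using assms(3) by (intro Bochner_Integration.integral_cong refl) (auto simp: indicator_def)
  also have "\<dots> = (\<integral>x. indicator A x *\<^sub>R lk_kernel z x \<partial>\<nu>) + (\<integral>x. indicator B x *\<^sub>R lk_kernel z x \<partial>\<nu>)"
    by (intro Bochner_Integration.integral_add integrable_lk_kernel[OF sets_nu levy] assms)
  finally show ?thesis .
qed

lemma integral_lk_kernel_large:
  assumes "A \<inter> {-1..1} = {}"
  shows "(\<integral>x. indicator A x *\<^sub>R lk_kernel z x \<partial>\<nu>) = (\<integral>x. indicator A x *\<^sub>R (iexp (z * x) - 1) \<partial>\<nu>)"
proof (intro Bochner_Integration.integral_cong refl)
  fix x
  have "x \<in> A \<Longrightarrow> x \<notin> {-1..1}" using assms by blast
  then show "indicator A x *\<^sub>R lk_kernel z x = indicator A x *\<^sub>R (iexp (z * x) - 1)"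
    by (cases "x \<in> A") (simp_all add: lk_kernel_def)
qed

text \<open>Gaussian part, jumps in \<open>[-1, 1]\<close>, jumps below \<open>-1\<close> and drift.
  Only positive orders \<open>K\<close> are claimed: the jumps below \<open>-1\<close> may be
  arbitrarily heavy, but \<open>exp (K * x)\<close> is bounded there when
  \<open>K > 0\<close>.\<close>

lemma light_part_exists:
  assumes t: "t > 0" and a: "a \<ge> 0"
  obtains \<eta> where "real_distribution \<eta>"
    "\<And>z. char \<eta> z = exp (of_real t * (- complex_of_real (a * z\<^sup>2 / 2) + \<i> * complex_of_real (b * z)
        + (\<integral>x. indicator {..1} x *\<^sub>R lk_kernel z x \<partial>\<nu>)))"
    "\<And>K. K > 0 \<Longrightarrow> exp_moment \<eta> K < \<infinity>"
proof -
  obtain G where G: "real_distribution G" "\<And>z. char G z = exp (- complex_of_real ((t * a) * z\<^sup>2 / 2))"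
    "\<And>K. exp_moment G K < \<infinity>"
    using gaussian_exists[of "t * a"] a t by (metis mult_nonneg_nonneg less_imp_le)
  obtain S where S: "real_distribution S"
    "\<And>z. char S z = exp (of_real t * (\<integral>x. indicator {-1..1} x *\<^sub>R lk_kernel z x \<partial>\<nu>))"
    "\<And>K. exp_moment S K < \<infinity>"
    by (rule small_jumps_exists[OF sets_nu levy t], rule that)
  let ?A = "{..<-1::real}"
  have Af: "emeasure \<nu> ?A < \<infinity>" by (rule emeasure_nu_finite[OF sets_nu levy, of _ 1]) auto
  obtain N where N: "real_distribution N"
    "\<And>z. char N z = exp (of_real t * (\<integral>x. indicator ?A x *\<^sub>R (iexp (z * x) - 1) \<partial>\<nu>))"
    "\<And>K. integrable \<nu> (\<lambda>x. indicator ?A x * exp (K * x)) \<Longrightarrow>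
      exp_moment N K = ennreal (exp (t * (\<integral>x. indicator ?A x * (exp (K * x) - 1) \<partial>\<nu>)))"
    by (rule cpois_restrict_exists[OF sets_nu _ Af t], simp, rule that)
  have Nm: "exp_moment N K < \<infinity>" if "K > 0" for K
  proof -
    have "integrable \<nu> (indicator ?A :: real \<Rightarrow> real)"
      using Af sets_nu by (simp add: integrable_indicator_iff)
    then have "integrable \<nu> (\<lambda>x. indicator ?A x * exp (K * x))"
    proof (rule Bochner_Integration.integrable_bound)
      show "AE x in \<nu>. norm (indicator ?A x * exp (K * x)) \<le> norm (indicator ?A x :: real)"
      proof (intro AE_I2)
        fix x :: real
        have "x < -1 \<Longrightarrow> K * x \<le> 0" using that by (simp add: mult_le_0_iff)
        then show "norm (indicator ?A x * exp (K * x)) \<le> norm (indicator ?A x :: real)"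
          by (auto simp: indicator_def)
      qed
    qed (use sets_nu in \<open>auto simp: measurable_nu[OF sets_nu levy]\<close>)
    from N(3)[OF this] show ?thesis by simp
  qed
  let ?d = "return borel (t * b)"
  let ?e = "((G \<star> S) \<star> N) \<star> ?d"
  note rd1 = real_distribution_convolution[OF G(1) S(1)]
  note rd2 = real_distribution_convolution[OF rd1 N(1)]
  show thesis
  proof (rule that[of ?e])
    show "real_distribution ?e" by (rule real_distribution_convolution[OF rd2 real_distribution_return])
    show "exp_moment ?e K < \<infinity>" if "K > 0" for K
      unfolding exp_moment_convolution[OF rd2 real_distribution_return] exp_moment_convolution[OF rd1 N(1)]
        exp_moment_convolution[OF G(1) S(1)] exp_moment_return
      using G(3)[of K] S(3)[of K] Nm[OF that] by (simp add: ennreal_mult_less_top)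
    show "char ?e z = exp (of_real t * (- complex_of_real (a * z\<^sup>2 / 2) + \<i> * complex_of_real (b * z)
        + (\<integral>x. indicator {..1} x *\<^sub>R lk_kernel z x \<partial>\<nu>)))" for z
    proof -
      have "{..1} = {-1..1} \<union> ?A" "{-1..1} \<inter> ?A = {}" "?A \<inter> {-1..1} = {}" by auto
      then have eq: "(\<integral>x. indicator {..1} x *\<^sub>R lk_kernel z x \<partial>\<nu>)
        = (\<integral>x. indicator {-1..1} x *\<^sub>R lk_kernel z x \<partial>\<nu>) + (\<integral>x. indicator ?A x *\<^sub>R (iexp (z * x) - 1) \<partial>\<nu>)"
        using integral_lk_kernel_Un[of "{-1..1}" ?A z] integral_lk_kernel_large[of ?A z] by simp
      show ?thesis
        unfolding char_convolution[OF rd2 real_distribution_return] char_convolution[OF rd1 N(1)]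
          char_convolution[OF G(1) S(1)] char_return G(2) S(2) N(2) exp_add[symmetric] eq
        by (rule arg_cong[where f=exp]) (simp add: algebra_simps)
    qed
  qed
qed

text \<open>Continuity makes the Levy-Khintchine exponent the continuous logarithm that
  \<open>is_real_conv_pow\<close> asks for.\<close>

lemma continuous_lk_integral: "continuous_on UNIV (\<lambda>z. \<integral>x. lk_kernel z x \<partial>\<nu>)"
proof (rule continuous_at_imp_continuous_on, rule ballI)
  fix z :: real
  show "isCont (\<lambda>z. \<integral>x. lk_kernel z x \<partial>\<nu>) z"
    unfolding continuous_at_sequentially
  proof (intro allI impI)
    fix X :: "nat \<Rightarrow> real" assume X: "X \<longlonglongrightarrow> z"
    then obtain C where C: "\<And>n. \<bar>X n\<bar> \<le> C"
      using convergent_imp_Bseq[of X] by (auto simp: convergent_def Bseq_def)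
    show "((\<lambda>z. \<integral>x. lk_kernel z x \<partial>\<nu>) \<circ> X) \<longlonglongrightarrow> (\<integral>x. lk_kernel z x \<partial>\<nu>)"
      unfolding o_def
    proof (rule integral_dominated_convergence)
      show "integrable \<nu> (\<lambda>x. (2 + C\<^sup>2) * min 1 (x\<^sup>2))"
        by (rule integrable_mult_right[OF integrable_min_square[OF sets_nu levy]])
      show "AE x in \<nu>. norm (lk_kernel (X n) x) \<le> (2 + C\<^sup>2) * min 1 (x\<^sup>2)" for n
      proof (rule AE_I2)
        fix x
        have "(X n)\<^sup>2 \<le> C\<^sup>2" using C[of n] by (simp add: abs_le_square_iff[symmetric])
        then have "(2 + (X n)\<^sup>2) * min 1 (x\<^sup>2) \<le> (2 + C\<^sup>2) * min 1 (x\<^sup>2)"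
          by (intro mult_right_mono) auto
        with norm_lk_kernel_le show "norm (lk_kernel (X n) x) \<le> (2 + C\<^sup>2) * min 1 (x\<^sup>2)"
          by (rule order_trans)
      qed
      show "AE x in \<nu>. (\<lambda>n. lk_kernel (X n) x) \<longlonglongrightarrow> lk_kernel z x"
        unfolding lk_kernel_def by (intro AE_I2 tendsto_intros X)
    qed (auto simp: measurable_nu[OF sets_nu levy])
  qed
qed

end

section \<open>Exponential transforms of infinitely divisible laws have no zeros\<close>

lemma exp_moment_integrable:
  assumes "real_distribution \<eta>"
  shows "exp_moment \<eta> K < \<infinity> \<longleftrightarrow> integrable \<eta> (\<lambda>u. exp (K * u))"
proof -
  interpret real_distribution \<eta> by fact
  show ?thesis by (auto simp: exp_moment_def integrable_iff_bounded)
qed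

lemma mgf_conv_pow:
  fixes w :: complex
  assumes rd: "real_distribution \<rho>" and m: "exp_moment \<rho> (Re w) < \<infinity>"
  shows "(\<integral>u. exp (w * of_real u) \<partial>conv_pow \<rho> n) = (\<integral>u. exp (w * of_real u) \<partial>\<rho>) ^ n"
proof (induction n)
  case (Suc n)
  let ?c = "conv_pow \<rho> n"
  note rdn = real_distribution_conv_pow[OF rd]
  have fin: "exp_moment (conv_pow \<rho> k) (Re w) < \<infinity>" for k
    using m by (simp add: exp_moment_conv_pow rd power_less_top_ennreal)
  have int: "integrable (conv_pow \<rho> k) (\<lambda>u. exp (w * of_real u))" for k
  proof -
    interpret real_distribution "conv_pow \<rho> k" by (rule rdn)
    show ?thesis
    proof (rule Bochner_Integration.integrable_bound)
      show "integrable (conv_pow \<rho> k) (\<lambda>u. exp (Re w * u))"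
        using fin[of k] by (simp only: exp_moment_integrable[OF rdn])
    qed auto
  qed
  have "(\<integral>u. exp (w * of_real u) \<partial>conv_pow \<rho> (Suc n)) = (\<integral>x. (\<integral>y. exp (w * of_real (x + y)) \<partial>?c) \<partial>\<rho>)"
    unfolding conv_pow.simps by (rule integral_convolution[OF rd rdn int[of "Suc n", unfolded conv_pow.simps]])
  also have "\<dots> = (\<integral>x. exp (w * of_real x) * (\<integral>y. exp (w * of_real y) \<partial>?c) \<partial>\<rho>)"
    by (intro Bochner_Integration.integral_cong refl) (simp add: distrib_left exp_add)
  also have "\<dots> = (\<integral>u. exp (w * of_real u) \<partial>\<rho>) ^ Suc n"
    by (simp add: Suc.IH)
  finally show ?case .
qed (simp add: integral_return)

text \<open>Every \<open>n\<close>-th root is analytic, so the order of a zero would be divisible by every \<open>n\<close>.\<close>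

lemma mgf_nonzero:
  fixes w0 :: complex
  assumes rd: "real_distribution \<eta>" and mom: "\<And>K. K > 0 \<Longrightarrow> exp_moment \<eta> K < \<infinity>"
    and roots: "\<And>n. n \<ge> 1 \<Longrightarrow> \<exists>\<zeta>. real_distribution \<zeta> \<and> conv_pow \<zeta> n = \<eta>"
    and w0: "Re w0 > 0"
  shows "(\<integral>u. exp (w0 * of_real u) \<partial>\<eta>) \<noteq> 0"
proof
  define f where "f = (\<lambda>\<zeta> w. \<integral>u. exp (w * of_real u) \<partial>(\<zeta> :: real measure) :: complex)"
  assume "(\<integral>u. exp (w0 * of_real u) \<partial>\<eta>) = 0"
  then have f0: "f \<eta> w0 = 0" by (simp add: f_def)
  let ?S = "{w. Re w > 0}"
  have fdiff: "f \<zeta> field_differentiable (at w)"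
    if "real_distribution \<zeta>" "\<And>K. K > 0 \<Longrightarrow> exp_moment \<zeta> K < \<infinity>" "Re w > 0" for \<zeta> w
  proof -
    interpret z: real_distribution \<zeta> by (rule that)
    show ?thesis
      using exp_integral_field_differentiable[of "\<lambda>x. x" \<zeta> "\<lambda>_. 1" "{0<..}" w] that
        exp_moment_integrable[OF that(1)]
      by (simp add: f_def)
  qed
  have hol: "f \<eta> holomorphic_on ?S"
  proof (rule holomorphic_onI)
    fix w assume "w \<in> ?S"
    then show "f \<eta> field_differentiable (at w within ?S)"
      by (intro field_differentiable_at_within[OF fdiff[OF rd]] mom) auto
  qed
  have conn: "connected ?S" by (intro convex_connected convex_halfspace_Re_gt)
  \<comment> \<open>On the positive real axis the transform is an integral of a positive function.
    Hence it is not identically zero, and a zero would have finite order.\<close>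
  have f1: "f \<eta> 1 \<noteq> 0"
  proof -
    interpret real_distribution \<eta> by fact
    have i: "integrable \<eta> exp" using exp_moment_integrable[OF rd, of 1] mom[of 1] by simp
    have "(\<integral>u. exp u \<partial>\<eta>) > 0"
    proof -
      have "(\<integral>u. exp u \<partial>\<eta>) \<noteq> 0"
        using integral_nonneg_eq_0_iff_AE[OF i] AE_False by auto
      moreover have "(\<integral>u. exp u \<partial>\<eta>) \<ge> 0" by (intro integral_nonneg_AE) auto
      ultimately show ?thesis by linarith
    qed
    moreover have "f \<eta> 1 = of_real (\<integral>u. exp u \<partial>\<eta>)"
      unfolding f_def using integral_of_real[OF i, where 'a=complex] by (simp flip: exp_of_real)
    ultimately show ?thesis by simp
  qed
  have nc: "\<not> f \<eta> constant_on ?S"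
  proof -
    have "1 \<in> ?S" "w0 \<in> ?S" using w0 by auto
    then show ?thesis using f0 f1 unfolding constant_on_def by metis
  qed
  obtain g r n where g: "0 < n" "0 < r" "ball w0 r \<subseteq> ?S" "g holomorphic_on ball w0 r"
    "\<And>w. w \<in> ball w0 r \<Longrightarrow> f \<eta> w = (w - w0) ^ n * g w" "\<And>w. w \<in> ball w0 r \<Longrightarrow> g w \<noteq> 0"
  proof (rule holomorphic_factor_zero_nonconstant[OF hol open_halfspace_Re_gt conn _ f0 nc])
    show "w0 \<in> ?S" using w0 by simp
  qed (rule that)
  \<comment> \<open>The degree of the root exceeds the order \<open>n\<close> of the zero by one.
    The transform of the root vanishes at \<open>w0\<close> too, so \<open>n\<close> of its factors
    already cancel \<open>(w - w0) ^ n\<close> and the remaining one forces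
    \<open>g w0 = 0\<close>.\<close>
  obtain \<zeta> where z: "real_distribution \<zeta>" "conv_pow \<zeta> (Suc n) = \<eta>" using roots[of "Suc n"] by auto
  have zm: "exp_moment \<zeta> K < \<infinity>" if "K > 0" for K
    using mom[OF that] unfolding z(2)[symmetric] exp_moment_conv_pow[OF z(1)]
    by (simp add: power_less_top_ennreal del: power_Suc)
  have fz: "f \<eta> w = f \<zeta> w ^ Suc n" if "Re w > 0" for w
    unfolding f_def z(2)[symmetric] by (rule mgf_conv_pow[OF z(1) zm[OF that]])
  have h0: "f \<zeta> w0 = 0" using fz[OF w0] f0 by auto
  obtain d where "(f \<zeta> has_field_derivative d) (at w0)"
    using fdiff[OF z(1) zm w0] by (auto simp: field_differentiable_def)
  then have q: "((\<lambda>w. f \<zeta> w / (w - w0)) \<longlongrightarrow> d) (at w0)"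
    unfolding has_field_derivative_iff by (simp add: h0)
  have c: "(f \<zeta> \<longlongrightarrow> f \<zeta> w0) (at w0)"
    using field_differentiable_imp_continuous_at[OF fdiff[OF z(1) zm w0]] by (simp add: isCont_def)
  have "((\<lambda>w. (f \<zeta> w / (w - w0)) ^ n * f \<zeta> w) \<longlongrightarrow> d ^ n * f \<zeta> w0) (at w0)"
    by (intro tendsto_intros q c)
  moreover have "\<forall>\<^sub>F w in at w0. (f \<zeta> w / (w - w0)) ^ n * f \<zeta> w = g w"
    unfolding eventually_at
  proof (intro exI[of _ r] conjI ballI impI)
    fix w assume "w \<noteq> w0 \<and> dist w w0 < r"
    then have w: "w \<noteq> w0" "w \<in> ball w0 r" by (auto simp: dist_commute)
    then have "Re w > 0" using g(3) by auto
    then have "f \<zeta> w ^ Suc n = (w - w0) ^ n * g w" using fz g(5)[OF w(2)] by simp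
    then show "(f \<zeta> w / (w - w0)) ^ n * f \<zeta> w = g w"
      using w(1) by (simp add: power_divide field_simps)
  qed (use g in auto)
  ultimately have "(g \<longlongrightarrow> d ^ n * f \<zeta> w0) (at w0)" by (rule Lim_transform_eventually)
  moreover have "(g \<longlongrightarrow> g w0) (at w0)"
    using holomorphic_on_imp_continuous_on[OF g(4)] g(2) continuous_on_interior[of "ball w0 r" g w0]
    by (simp add: isCont_def)
  ultimately have "g w0 = d ^ n * f \<zeta> w0" using tendsto_unique[OF at_neq_bot] by blast
  then show False using h0 g(6)[of w0] g(2) by simp
qed

section \<open>The single big jump principle\<close>

lemma class_OS_tail_bound:
  assumes "\<sigma> \<in> class_OS"
  obtains C where "C \<ge> 1" "\<And>x. tail (\<sigma> \<star> \<sigma>) x \<le> C * tail \<sigma> x"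
proof -
  have rd: "real_distribution \<sigma>" and pos: "\<And>x. x > 0 \<Longrightarrow> tail \<sigma> x > 0"
    and lim: "Limsup at_top (\<lambda>x. ereal (tail (conv_pow \<sigma> 2) x / tail \<sigma> x)) < \<infinity>"
    using assms by (auto simp: class_OS_def asymp_comparable_def)
  obtain c where "Limsup at_top (\<lambda>x. ereal (tail (conv_pow \<sigma> 2) x / tail \<sigma> x)) < ereal c"
    using lim less_PInf_Ex_of_nat by fastforce
  then have "\<forall>\<^sub>F x in at_top. ereal (tail (conv_pow \<sigma> 2) x / tail \<sigma> x) < ereal c"
    by (rule Limsup_lessD)
  with eventually_gt_at_top[of "0::real"]
  have "\<forall>\<^sub>F x in at_top. x > 0 \<and> tail (\<sigma> \<star> \<sigma>) x / tail \<sigma> x < c"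
    by eventually_elim (simp add: conv_pow_2[OF rd])
  then obtain X where X: "\<And>x. x \<ge> X \<Longrightarrow> x > 0 \<and> tail (\<sigma> \<star> \<sigma>) x / tail \<sigma> x < c"
    unfolding eventually_at_top_linorder by blast
  have pX: "tail \<sigma> X > 0" using X[of X] pos by simp
  \<comment> \<open>The ratio bound \<open>c\<close> holds only from \<open>X\<close> on. Below
    \<open>X\<close> the tail of \<open>\<sigma>\<close> is at least \<open>tail \<sigma> X\<close>,
    and every tail is at most \<open>1\<close>.\<close>
  define C where "C = max 1 (max c (1 / tail \<sigma> X))"
  have "tail (\<sigma> \<star> \<sigma>) x \<le> C * tail \<sigma> x" for x
  proof (cases "x \<ge> X")
    case True
    then have "tail (\<sigma> \<star> \<sigma>) x \<le> c * tail \<sigma> x" using X[OF True] pos[of x] by (simp add: field_simps)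
    also have "\<dots> \<le> C * tail \<sigma> x" by (intro mult_right_mono) (auto simp: C_def)
    finally show ?thesis .
  next
    case False
    have "tail (\<sigma> \<star> \<sigma>) x \<le> 1" by (intro tail_le_1 real_distribution_convolution rd)
    also have "\<dots> = (1 / tail \<sigma> X) * tail \<sigma> X" using pX by simp
    also have "\<dots> \<le> C * tail \<sigma> x"
      using False by (intro mult_mono tail_antimono rd) (auto simp: C_def)
    finally show ?thesis .
  qed
  then show ?thesis using that[of C] by (simp add: C_def)
qed

lemma integrable_tail_shift:
  assumes "real_distribution \<alpha>" "real_distribution \<beta>"
  shows "integrable \<beta> (\<lambda>y. tail \<alpha> (x - y))"
proof (rule integrable_bounded[OF assms(2)])
  note [measurable] = measurable_tail[OF assms(1)]
  show "(\<lambda>y. tail \<alpha> (x - y)) \<in> borel_measurable borel" by measurable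
  show "norm (tail \<alpha> (x - y)) \<le> 1" for y using tail_le_1[OF assms(1)] by simp
qed

lemma tail_convolution_mono:
  assumes "real_distribution \<alpha>" "real_distribution \<alpha>'" "real_distribution \<beta>"
    and le: "\<And>x. tail \<alpha> x \<le> c * tail \<alpha>' x"
  shows "tail (\<alpha> \<star> \<beta>) x \<le> c * tail (\<alpha>' \<star> \<beta>) x"
  unfolding tail_convolution[OF assms(1,3)] tail_convolution[OF assms(2,3)] integral_mult_right_zero[symmetric]
  by (intro integral_mono integrable_mult_right integrable_tail_shift assms)

text \<open>The probability that independent \<open>U\<close>, \<open>V\<close> with laws \<open>\<alpha>\<close>, \<open>\<beta>\<close> satisfy \<open>U + V > x\<close>, \<open>U > A\<close> and
  \<open>V > A\<close>; for \<open>\<alpha> = \<beta>\<close> and \<open>x \<ge> 2 A\<close> it is the numerator in \<open>class_S_sharp\<close>.\<close>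

definition big_jumps :: "real \<Rightarrow> real measure \<Rightarrow> real measure \<Rightarrow> real \<Rightarrow> real" where
  "big_jumps A \<alpha> \<beta> x = (\<integral>y. indicator {A<..} y * tail \<alpha> (max (x - y) A) \<partial>\<beta>)"

lemma integrable_big_jumps:
  assumes "real_distribution \<alpha>" "real_distribution \<beta>"
  shows "integrable \<beta> (\<lambda>y. indicator {A<..} y * tail \<alpha> (max (x - y) A))"
proof (rule integrable_bounded[OF assms(2)])
  note [measurable] = measurable_tail[OF assms(1)]
  show "(\<lambda>y. indicator {A<..} y * tail \<alpha> (max (x - y) A)) \<in> borel_measurable borel" by measurable
  show "norm (indicator {A<..} y * tail \<alpha> (max (x - y) A)) \<le> 1" for y
    using tail_le_1[OF assms(1)] by (simp add: indicator_def)
qed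

lemma integral_indicator_Int_tail:
  assumes "real_distribution \<alpha>" shows "(\<integral>u. indicator {a<..} u * indicator {b<..} u \<partial>\<alpha>) = tail \<alpha> (max a b)"
proof -
  have "indicator {a<..} u * indicator {b<..} u = (indicator {max a b<..} u :: real)" for u
    by (auto simp: indicator_def)
  then show ?thesis using assms by (simp add: tail_def real_distributionD)
qed

text \<open>Both sides are the probability of one event on the product space, computed by
  integrating out different coordinates first.\<close>

lemma big_jumps_commute:
  assumes "real_distribution \<alpha>" "real_distribution \<beta>"
  shows "big_jumps A \<alpha> \<beta> x = big_jumps A \<beta> \<alpha> x"
proof -
  interpret a: real_distribution \<alpha> by fact
  interpret b: real_distribution \<beta> by fact
  interpret pair_prob_space \<beta> \<alpha> ..
  let ?f = "\<lambda>y u. indicator {A<..} y * (indicator {A<..} u * indicator {x<..} (u + y)) :: real"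
  have i: "integrable (\<beta> \<Otimes>\<^sub>M \<alpha>) (case_prod ?f)"
    by (rule P.integrable_const_bound[of _ 1]) (auto simp: indicator_def split: prod.splits)
  have 1: "(\<integral>u. ?f y u \<partial>\<alpha>) = indicator {A<..} y * tail \<alpha> (max (x - y) A)" for y
  proof -
    have "(\<integral>u. ?f y u \<partial>\<alpha>) = (\<integral>u. indicator {A<..} y * (indicator {x - y<..} u * indicator {A<..} u) \<partial>\<alpha>)"
      by (intro Bochner_Integration.integral_cong refl) (auto simp: indicator_def)
    then show ?thesis by (simp only: integral_mult_right_zero integral_indicator_Int_tail[OF assms(1)])
  qed
  have 2: "(\<integral>y. ?f y u \<partial>\<beta>) = indicator {A<..} u * tail \<beta> (max (x - u) A)" for u
  proof -
    have "(\<integral>y. ?f y u \<partial>\<beta>) = (\<integral>y. indicator {A<..} u * (indicator {x - u<..} y * indicator {A<..} y) \<partial>\<beta>)"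
      by (intro Bochner_Integration.integral_cong refl) (auto simp: indicator_def)
    then show ?thesis by (simp only: integral_mult_right_zero integral_indicator_Int_tail[OF assms(2)])
  qed
  show ?thesis
    using Fubini_integral[OF i] unfolding 1 2 big_jumps_def by simp
qed

lemma big_jumps_mono:
  assumes "real_distribution \<alpha>" "real_distribution \<alpha>'" "real_distribution \<beta>"
    and le: "\<And>x. tail \<alpha> x \<le> c * tail \<alpha>' x"
  shows "big_jumps A \<alpha> \<beta> x \<le> c * big_jumps A \<alpha>' \<beta> x"
  unfolding big_jumps_def integral_mult_right_zero[symmetric]
proof (intro integral_mono integrable_mult_right integrable_big_jumps assms)
  fix y
  show "indicator {A<..} y * tail \<alpha> (max (x - y) A) \<le> c * (indicator {A<..} y * tail \<alpha>' (max (x - y) A))"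
    using le[of "max (x - y) A"] by (auto simp: indicator_def)
qed

text \<open>Tail domination is applied to one law at a time; symmetry moves the other law into the
  slot where its tail appears.\<close>

lemma big_jumps_le:
  assumes "real_distribution \<alpha>" "real_distribution \<beta>" "real_distribution \<sigma>"
    and "\<And>x. tail \<alpha> x \<le> c * tail \<sigma> x" "\<And>x. tail \<beta> x \<le> d * tail \<sigma> x" "c \<ge> 0"
  shows "big_jumps A \<alpha> \<beta> x \<le> c * d * big_jumps A \<sigma> \<sigma> x"
proof -
  have "big_jumps A \<alpha> \<beta> x \<le> c * big_jumps A \<sigma> \<beta> x"
    using assms by (intro big_jumps_mono) auto
  also have "big_jumps A \<sigma> \<beta> x = big_jumps A \<beta> \<sigma> x" using assms by (intro big_jumps_commute)
  also have "c * big_jumps A \<beta> \<sigma> x \<le> c * (d * big_jumps A \<sigma> \<sigma> x)"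
    using assms by (intro mult_left_mono big_jumps_mono) auto
  finally show ?thesis by (simp add: mult_ac)
qed

lemma big_jumps_nonneg: "big_jumps A \<alpha> \<beta> x \<ge> 0"
  unfolding big_jumps_def by (intro Bochner_Integration.integral_nonneg) auto

text \<open>For \<open>x > 2 * A\<close> two summands with sum above \<open>x\<close> cannot both be
  at most \<open>A\<close>. The event therefore splits disjointly according to which of them, if
  any, is at most \<open>A\<close>.\<close>

lemma tail_convolution_split:
  assumes rd: "real_distribution \<alpha>" "real_distribution \<beta>" and x: "x > 2 * A"
  shows "tail (\<alpha> \<star> \<beta>) x = (\<integral>y. indicator {..A} y * tail \<alpha> (x - y) \<partial>\<beta>)
    + (\<integral>y. indicator {..A} y * tail \<beta> (x - y) \<partial>\<alpha>) + big_jumps A \<alpha> \<beta> x"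
proof -
  interpret a: real_distribution \<alpha> by fact
  interpret b: real_distribution \<beta> by fact
  interpret pair_prob_space \<beta> \<alpha> ..
  note [measurable] = measurable_tail[OF rd(1)] measurable_tail[OF rd(2)]
  let ?f = "\<lambda>y u. indicator {..A} u * indicator {x<..} (u + y) :: real"
  have i: "integrable (\<beta> \<Otimes>\<^sub>M \<alpha>) (case_prod ?f)"
    by (rule P.integrable_const_bound[of _ 1]) (auto simp: indicator_def split: prod.splits)
  have 1: "(\<integral>y. ?f y u \<partial>\<beta>) = indicator {..A} u * tail \<beta> (x - u)" for u
  proof -
    have "(\<integral>y. ?f y u \<partial>\<beta>) = (\<integral>y. indicator {..A} u * indicator {x - u<..} y \<partial>\<beta>)"
      by (intro Bochner_Integration.integral_cong refl) (auto simp: indicator_def)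
    then show ?thesis by (simp add: tail_def)
  qed
  have if1: "integrable \<beta> (\<lambda>y. \<integral>u. ?f y u \<partial>\<alpha>)"
    using integrable_fst'[OF i] by simp
  \<comment> \<open>For a fixed value \<open>y\<close> of the second summand: the three terms are
    \<open>y \<le> A\<close>, the first summand at most \<open>A\<close>, and both above
    \<open>A\<close>. In the case \<open>y \<le> A\<close> the second is empty.\<close>
  have eq: "tail \<alpha> (x - y) = indicator {..A} y * tail \<alpha> (x - y) + (\<integral>u. ?f y u \<partial>\<alpha>) + indicator {A<..} y * tail \<alpha> (max (x - y) A)" for y
  proof (cases "y \<le> A")
    case True
    have "?f y u = 0" for u using True x by (auto simp: indicator_def)
    then have "(\<integral>u. ?f y u \<partial>\<alpha>) = 0" by (simp only: Bochner_Integration.integral_zero)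
    then show ?thesis using True by simp
  next
    case False
    have "tail \<alpha> (x - y) = (\<integral>u. indicator {x - y<..} u \<partial>\<alpha>)" by (simp add: tail_def)
    also have "\<dots> = (\<integral>u. ?f y u + indicator {x - y<..} u * indicator {A<..} u \<partial>\<alpha>)"
      by (intro Bochner_Integration.integral_cong refl) (auto simp: indicator_def)
    also have "\<dots> = (\<integral>u. ?f y u \<partial>\<alpha>) + (\<integral>u. indicator {x - y<..} u * indicator {A<..} u \<partial>\<alpha>)"
      by (intro Bochner_Integration.integral_add integrable_bounded[OF rd(1), of _ 1]) (auto simp: indicator_def)
    finally show ?thesis using False by (simp add: integral_indicator_Int_tail[OF rd(1)])
  qed
  have i1: "integrable \<beta> (\<lambda>y. indicator {..A} y * tail \<alpha> (x - y))"
    by (rule integrable_bounded[OF rd(2), of _ 1]) (auto simp: indicator_def tail_le_1[OF rd(1)])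
  have "tail (\<alpha> \<star> \<beta>) x = (\<integral>y. indicator {..A} y * tail \<alpha> (x - y) + (\<integral>u. ?f y u \<partial>\<alpha>) + indicator {A<..} y * tail \<alpha> (max (x - y) A) \<partial>\<beta>)"
    unfolding tail_convolution[OF rd] by (intro Bochner_Integration.integral_cong refl eq)
  also have "\<dots> = (\<integral>y. indicator {..A} y * tail \<alpha> (x - y) \<partial>\<beta>) + (\<integral>y. (\<integral>u. ?f y u \<partial>\<alpha>) \<partial>\<beta>) + big_jumps A \<alpha> \<beta> x"
    unfolding big_jumps_def
    by (subst Bochner_Integration.integral_add, rule Bochner_Integration.integrable_add[OF i1 if1], rule integrable_big_jumps[OF rd],
        subst Bochner_Integration.integral_add[OF i1 if1], rule refl)
  also have "(\<integral>y. (\<integral>u. ?f y u \<partial>\<alpha>) \<partial>\<beta>) = (\<integral>y. indicator {..A} y * tail \<beta> (x - y) \<partial>\<alpha>)"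
    using Fubini_integral[OF i] unfolding 1 by simp
  finally show ?thesis .
qed

lemma big_jumps_self:
  assumes rd: "real_distribution \<sigma>" and x: "x \<ge> 2 * A"
  shows "big_jumps A \<sigma> \<sigma> x = tail \<sigma> (x - A) * tail \<sigma> A + (LINT u:{A<..x - A}|\<sigma>. tail \<sigma> (x - u))"
proof -
  note [measurable] = measurable_tail[OF rd]
  interpret real_distribution \<sigma> by fact
  have i1: "integrable \<sigma> (\<lambda>y. indicator {A<..x - A} y * tail \<sigma> (x - y))"
    by (rule integrable_bounded[OF rd, of _ 1]) (auto simp: indicator_def tail_le_1[OF rd])
  have i2: "integrable \<sigma> (\<lambda>y. indicator {x - A<..} y * tail \<sigma> A)"
    by (rule integrable_bounded[OF rd, of _ 1]) (auto simp: indicator_def tail_le_1[OF rd])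
  \<comment> \<open>Once \<open>y > x - A\<close>, the only constraint left on the other summand is
    that it exceeds \<open>A\<close>.\<close>
  have "big_jumps A \<sigma> \<sigma> x = (\<integral>y. indicator {x - A<..} y * tail \<sigma> A + indicator {A<..x - A} y * tail \<sigma> (x - y) \<partial>\<sigma>)"
    unfolding big_jumps_def
    by (intro Bochner_Integration.integral_cong refl) (use x in \<open>auto simp: indicator_def max_def intro!: arg_cong[where f="tail \<sigma>"]\<close>)
  also have "\<dots> = (\<integral>y. indicator {x - A<..} y * tail \<sigma> A \<partial>\<sigma>) + (\<integral>y. indicator {A<..x - A} y * tail \<sigma> (x - y) \<partial>\<sigma>)"
    by (rule Bochner_Integration.integral_add[OF i2 i1])
  also have "(\<integral>y. indicator {x - A<..} y * tail \<sigma> A \<partial>\<sigma>) = tail \<sigma> (x - A) * tail \<sigma> A"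
    by (simp add: tail_def)
  finally show ?thesis by (simp add: set_lebesgue_integral_def)
qed

text \<open>The iterated upper limit in \<open>class_S_sharp\<close> in epsilon form, without
  quotients and extended reals. In this form it is also provable for nonnegative laws in
  \<open>class_S\<close>.\<close>

definition single_big_jump :: "real measure \<Rightarrow> bool" where
  "single_big_jump \<sigma> \<longleftrightarrow> (\<forall>e>0. \<exists>A0. \<forall>A\<ge>A0. \<forall>\<^sub>F x in at_top. big_jumps A \<sigma> \<sigma> x \<le> e * tail \<sigma> x)"

lemma class_S_sharp_single_big_jump:
  assumes "\<sigma> \<in> class_S_sharp"
  shows "single_big_jump \<sigma>"
  unfolding single_big_jump_def
proof (intro allI impI)
  fix e :: real assume e: "e > 0"
  let ?r = "\<lambda>A x. ereal ((tail \<sigma> (x - A) * tail \<sigma> A + (LINT u:{A<..x - A}|\<sigma>. tail \<sigma> (x - u))) / tail \<sigma> x)"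
  have rd: "real_distribution \<sigma>" and pos: "\<And>x. x > 0 \<Longrightarrow> tail \<sigma> x > 0"
    using assms by (auto simp: class_S_sharp_def class_OS_def)
  have "Limsup at_top (\<lambda>A. Limsup at_top (?r A)) < ereal e"
    using assms e by (simp add: class_S_sharp_def)
  then have "\<forall>\<^sub>F A in at_top. Limsup at_top (?r A) < ereal e" by (rule Limsup_lessD)
  then obtain A0 where A0: "\<And>A. A \<ge> A0 \<Longrightarrow> Limsup at_top (?r A) < ereal e"
    unfolding eventually_at_top_linorder by blast
  show "\<exists>A0. \<forall>A\<ge>A0. \<forall>\<^sub>F x in at_top. big_jumps A \<sigma> \<sigma> x \<le> e * tail \<sigma> x"
  proof (intro exI[of _ A0] allI impI)
    fix A assume "A \<ge> A0"
    then have "\<forall>\<^sub>F x in at_top. ?r A x < ereal e" by (intro Limsup_lessD A0)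
    with eventually_gt_at_top[of "0::real"] eventually_ge_at_top[of "2 * A"]
    show "\<forall>\<^sub>F x in at_top. big_jumps A \<sigma> \<sigma> x \<le> e * tail \<sigma> x"
    proof eventually_elim
      case (elim x)
      then have "big_jumps A \<sigma> \<sigma> x / tail \<sigma> x < e" by (simp add: big_jumps_self[OF rd])
      then show ?case using pos[OF elim(1)] by (simp add: field_simps)
    qed
  qed
qed

section \<open>Limits of tail ratios\<close>

text \<open>If one summand exceeds \<open>1\<close>, the other has to exceed only
  \<open>x - 1\<close>; so \<open>tail (\<sigma> \<star> \<sigma>) x\<close> is at least
  \<open>tail \<sigma> (x - 1) * tail \<sigma> 1\<close>. A unit shift thus costs a bounded factor,
  and iteration makes the cost exponential in the shift.\<close>

lemma class_OS_tail_shift: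
  assumes "\<sigma> \<in> class_OS"
  obtains C K where "C \<ge> 1" "K > 0" "\<And>x y. y \<ge> 0 \<Longrightarrow> tail \<sigma> (x - y) \<le> C * exp (K * y) * tail \<sigma> x"
proof -
  have rd: "real_distribution \<sigma>" and pos: "\<And>x. x > 0 \<Longrightarrow> tail \<sigma> x > 0"
    using assms by (auto simp: class_OS_def)
  obtain C1 where C1: "C1 \<ge> 1" "\<And>x. tail (\<sigma> \<star> \<sigma>) x \<le> C1 * tail \<sigma> x"
    by (rule class_OS_tail_bound[OF assms], rule that)
  \<comment> \<open>The lower bound \<open>2\<close> makes \<open>ln c\<close> positive, as required
    of \<open>K\<close>. The same \<open>c\<close> pays for rounding \<open>y\<close> up to an
    integer.\<close>
  define c where "c = max 2 (C1 / tail \<sigma> 1)"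
  have c: "c \<ge> 2" by (simp add: c_def)
  have step: "tail \<sigma> (x - 1) \<le> c * tail \<sigma> x" for x
  proof -
    interpret real_distribution \<sigma> by (rule rd)
    have "tail \<sigma> (x - 1) * tail \<sigma> 1 = (\<integral>y. tail \<sigma> (x - 1) * indicator {1<..} y \<partial>\<sigma>)"
      by (simp add: tail_def)
    also have "\<dots> \<le> (\<integral>y. tail \<sigma> (x - y) \<partial>\<sigma>)"
    proof (rule integral_mono[OF _ integrable_tail_shift[OF rd rd]])
      show "integrable \<sigma> (\<lambda>y. tail \<sigma> (x - 1) * indicator {1<..} y)"
        by (rule integrable_bounded[OF rd, of _ 1]) (auto simp: indicator_def tail_le_1[OF rd])
      show "tail \<sigma> (x - 1) * indicator {1<..} y \<le> tail \<sigma> (x - y)" for y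
        by (auto simp: indicator_def intro: tail_antimono[OF rd])
    qed
    also have "\<dots> \<le> C1 * tail \<sigma> x" using C1(2)[of x] by (simp add: tail_convolution[OF rd rd])
    finally have "tail \<sigma> (x - 1) \<le> (C1 / tail \<sigma> 1) * tail \<sigma> x"
      using pos[of 1] by (simp add: field_simps)
    also have "\<dots> \<le> c * tail \<sigma> x" by (intro mult_right_mono) (auto simp: c_def)
    finally show ?thesis .
  qed
  have steps: "tail \<sigma> (x - real n) \<le> c ^ n * tail \<sigma> x" for n x
  proof (induction n)
    case (Suc n)
    have "tail \<sigma> (x - real (Suc n)) \<le> c * tail \<sigma> (x - real n)" using step[of "x - real n"] by (simp add: algebra_simps)
    also have "\<dots> \<le> c * (c ^ n * tail \<sigma> x)" using Suc c by (intro mult_left_mono) auto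
    finally show ?case by simp
  qed simp
  have "tail \<sigma> (x - y) \<le> c * exp (ln c * y) * tail \<sigma> x" if "y \<ge> 0" for x y
  proof -
    define n where "n = nat \<lceil>y\<rceil>"
    have n: "y \<le> real n" "real n \<le> y + 1" using that by (auto simp: n_def)
    have "tail \<sigma> (x - y) \<le> tail \<sigma> (x - real n)" using n by (intro tail_antimono rd) auto
    also have "\<dots> \<le> c ^ n * tail \<sigma> x" by (rule steps)
    also have "c ^ n = exp (ln c * real n)" using c by (simp add: exp_of_nat2_mult)
    also have "\<dots> \<le> exp (ln c * (y + 1))" using n c by (simp add: mult_left_mono)
    also have "\<dots> = c * exp (ln c * y)" using c by (simp add: distrib_left exp_add)
    finally show ?thesis by (simp add: mult_right_mono)
  qed
  then show ?thesis using c by (intro that[of c "ln c"]) auto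
qed

text \<open>Gathers the constants of all later dominations: \<open>C\<close> for one convolution of
  \<open>\<sigma>\<close>, \<open>D\<close> for the geometric bound on the powers of
  \<open>\<rho>\<close>, \<open>K\<close> for the growth under shifts. Here \<open>\<sigma>\<close>
  is a power of \<open>\<rho>\<close> in one direction of the theorem and \<open>\<rho>\<close>
  itself in the other.\<close>

locale big_jump_setting =
  fixes \<rho> \<sigma> :: "real measure" and C D K :: real
  assumes rd_rho: "real_distribution \<rho>" and rho_nonneg: "AE x in \<rho>. 0 \<le> x"
    and rd_sigma: "real_distribution \<sigma>" and sigma_pos: "\<And>x. tail \<sigma> x > 0"
    and C: "C \<ge> 1" and sigma_conv: "\<And>x. tail (\<sigma> \<star> \<sigma>) x \<le> C * tail \<sigma> x"
    and D: "D \<ge> 1" and kesten: "\<And>n x. tail (conv_pow \<rho> n) x \<le> D ^ n * tail \<sigma> x"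
    and K: "K > 0" and sigma_shift: "\<And>x y. y \<ge> 0 \<Longrightarrow> tail \<sigma> (x - y) \<le> C * exp (K * y) * tail \<sigma> x"
    and sbj: "single_big_jump \<sigma>"

lemma class_OS_tail_pos:
  assumes "\<sigma> \<in> class_OS" shows "tail \<sigma> x > 0"
proof (cases "x > 0")
  case False
  have "0 < tail \<sigma> 1" "tail \<sigma> 1 \<le> tail \<sigma> x" using assms False
    by (auto simp: class_OS_def intro: tail_antimono)
  then show ?thesis by linarith
qed (use assms in \<open>auto simp: class_OS_def\<close>)

text \<open>The geometric bound is of Kesten type: powers with exponent a multiple of
  \<open>n\<close> are powers of \<open>\<sigma>\<close>, each further factor costs
  \<open>C1\<close>, and monotonicity in the exponent interpolates.\<close>

lemma big_jump_setting_conv_pow: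
  assumes rd: "real_distribution \<rho>" and nn: "AE x in \<rho>. 0 \<le> x" and n: "n \<ge> 1"
    and OS: "conv_pow \<rho> n \<in> class_OS" and sbj: "single_big_jump (conv_pow \<rho> n)"
  obtains C D K where "big_jump_setting \<rho> (conv_pow \<rho> n) C D K"
proof -
  let ?s = "conv_pow \<rho> n"
  note rdp = real_distribution_conv_pow[OF rd]
  obtain C1 where C1: "C1 \<ge> 1" "\<And>x. tail (?s \<star> ?s) x \<le> C1 * tail ?s x"
    by (rule class_OS_tail_bound[OF OS], rule that)
  obtain C2 K where C2: "C2 \<ge> 1" "K > 0" "\<And>x y. y \<ge> 0 \<Longrightarrow> tail ?s (x - y) \<le> C2 * exp (K * y) * tail ?s x"
    by (rule class_OS_tail_shift[OF OS], rule that)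
  have mult: "tail (conv_pow \<rho> (n * Suc k)) x \<le> C1 ^ k * tail ?s x" for k x
  proof (induction k arbitrary: x)
    case (Suc k)
    have "conv_pow \<rho> (n * Suc (Suc k)) = (conv_pow \<rho> (n * Suc k) \<star> ?s)"
      using conv_pow_add[OF rd, of "n * Suc k" n] by (simp add: algebra_simps)
    then have "tail (conv_pow \<rho> (n * Suc (Suc k))) x \<le> C1 ^ k * tail (?s \<star> ?s) x"
      using tail_convolution_mono[OF rdp rdp rdp Suc] by simp
    also have "\<dots> \<le> C1 ^ k * (C1 * tail ?s x)" using C1 by (intro mult_left_mono) auto
    finally show ?case by (simp add: mult_ac)
  qed simp
  have kesten: "tail (conv_pow \<rho> k) x \<le> C1 ^ k * tail ?s x" for k x
  proof -
    \<comment> \<open>With \<open>Suc k\<close> copies of \<open>\<sigma>\<close> there are exactly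
      \<open>k\<close> convolutions to pay for, and the case \<open>k = 0\<close> is
      covered.\<close>
    have "k \<le> n * Suc k" using n by (cases n) auto
    then show ?thesis using tail_conv_pow_mono[OF rd nn, of k "n * Suc k" x] mult[of k x] by linarith
  qed
  define C where "C = max C1 C2"
  have "big_jump_setting \<rho> ?s C C1 K"
  proof (rule big_jump_setting.intro)
    show "tail (?s \<star> ?s) x \<le> C * tail ?s x" for x
      by (rule order_trans[OF C1(2)]) (auto simp: C_def intro: mult_right_mono)
    show "tail ?s (x - y) \<le> C * exp (K * y) * tail ?s x" if "y \<ge> 0" for x y
      by (rule order_trans[OF C2(3)[OF that]]) (auto simp: C_def intro!: mult_right_mono)
    show "C \<ge> 1" using C1(1) by (simp add: C_def le_max_iff_disj)
  qed (rule rd nn rdp C1(1) C2(2) kesten sbj class_OS_tail_pos[OF OS])+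
  then show ?thesis using that by blast
qed

locale big_jump_limit = big_jump_setting +
  fixes X :: "nat \<Rightarrow> real" and h :: "real \<Rightarrow> real"
  assumes X: "filterlim X at_top sequentially"
    and h: "\<And>a. (\<lambda>k. tail \<rho> (X k + a) / tail \<sigma> (X k)) \<longlonglongrightarrow> h a"
begin

text \<open>The argument is moved down to \<open>X k - (\<bar>a\<bar> + max 0 y)\<close>, where the
  exponential shift bound applies uniformly in \<open>k\<close>; negative \<open>y\<close> only
  lowers the tail.\<close>

lemma ratio_bound:
  assumes "\<And>x. tail \<alpha> x \<le> c * tail \<sigma> x" "c \<ge> 0"
  shows "tail \<alpha> (X k + a - y) / tail \<sigma> (X k) \<le> c * (C * exp (K * (\<bar>a\<bar> + max 0 y)))"
proof -
  have "tail \<alpha> (X k + a - y) \<le> c * tail \<sigma> (X k + a - y)" by (rule assms)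
  also have "\<dots> \<le> c * tail \<sigma> (X k - (\<bar>a\<bar> + max 0 y))"
    using assms(2) by (intro mult_left_mono tail_antimono rd_sigma) auto
  also have "\<dots> \<le> c * (C * exp (K * (\<bar>a\<bar> + max 0 y)) * tail \<sigma> (X k))"
    using assms(2) by (intro mult_left_mono sigma_shift) auto
  finally show ?thesis using sigma_pos[of "X k"] by (simp add: field_simps)
qed

lemma ratio_nonneg: "tail \<alpha> x / tail \<sigma> (X k) \<ge> 0"
  using sigma_pos[of "X k"] by simp

lemma measurable_limit:
  assumes "real_distribution \<alpha>" and "\<And>a. (\<lambda>k. tail \<alpha> (X k + a) / tail \<sigma> (X k)) \<longlonglongrightarrow> f a"
  shows "f \<in> borel_measurable borel"
proof (rule borel_measurable_LIMSEQ_metric)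
  show "(\<lambda>a. tail \<alpha> (X k + a) / tail \<sigma> (X k)) \<in> borel_measurable borel" for k
    using measurable_tail[OF assms(1), measurable] by measurable
qed (use assms(2) in auto)

lemma limit_nonneg:
  assumes "\<And>a. (\<lambda>k. tail \<alpha> (X k + a) / tail \<sigma> (X k)) \<longlonglongrightarrow> f a"
  shows "f a \<ge> 0"
  by (rule LIMSEQ_le_const[OF assms]) (use ratio_nonneg in auto)

text \<open>Restricting to \<open>y \<le> A\<close> bounds the shift from above, so a constant
  dominates the ratios.\<close>

lemma truncated_limit:
  assumes rd: "real_distribution \<alpha>" "real_distribution \<beta>" and nn: "AE x in \<beta>. 0 \<le> x"
    and c: "\<And>x. tail \<alpha> x \<le> c * tail \<sigma> x" "c \<ge> 0"
    and f: "\<And>a. (\<lambda>k. tail \<alpha> (X k + a) / tail \<sigma> (X k)) \<longlonglongrightarrow> f a" and A: "A \<ge> 0"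
  shows "(\<lambda>k. (\<integral>y. indicator {..A} y * tail \<alpha> (X k + a - y) \<partial>\<beta>) / tail \<sigma> (X k))
    \<longlonglongrightarrow> (\<integral>y. indicator {..A} y * f (a - y) \<partial>\<beta>)"
proof -
  interpret real_distribution \<beta> by (rule rd)
  note [measurable] = measurable_limit[OF rd(1) f] measurable_tail[OF rd(1)]
  have "(\<lambda>k. \<integral>y. indicator {..A} y * (tail \<alpha> (X k + a - y) / tail \<sigma> (X k)) \<partial>\<beta>)
    \<longlonglongrightarrow> (\<integral>y. indicator {..A} y * f (a - y) \<partial>\<beta>)"
  proof (rule integral_dominated_convergence)
    show "integrable \<beta> (\<lambda>y. c * (C * exp (K * (\<bar>a\<bar> + A))))" by simp
    show "AE y in \<beta>. (\<lambda>k. indicator {..A} y * (tail \<alpha> (X k + a - y) / tail \<sigma> (X k))) \<longlonglongrightarrow> indicator {..A} y * f (a - y)"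
      using f[of "a - _"] by (intro AE_I2 tendsto_mult tendsto_const) (simp add: add_diff_eq)
    show "AE y in \<beta>. norm (indicator {..A} y * (tail \<alpha> (X k + a - y) / tail \<sigma> (X k))) \<le> c * (C * exp (K * (\<bar>a\<bar> + A)))" for k
    proof (rule AE_I2)
      fix y
      show "norm (indicator {..A} y * (tail \<alpha> (X k + a - y) / tail \<sigma> (X k))) \<le> c * (C * exp (K * (\<bar>a\<bar> + A)))"
      proof (cases "y \<le> A")
        case True
        have "tail \<alpha> (X k + a - y) / tail \<sigma> (X k) \<le> c * (C * exp (K * (\<bar>a\<bar> + max 0 y)))"
          by (rule ratio_bound[OF c])
        also have "\<dots> \<le> c * (C * exp (K * (\<bar>a\<bar> + A)))"
          using True A c C K by (intro mult_left_mono exp_le_cancel_iff[THEN iffD2]) auto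
        finally show ?thesis using True ratio_nonneg[of \<alpha>] by simp
      qed (use c C in auto)
    qed
  qed measurable
  then show ?thesis by simp
qed

lemma convolution_bound:
  assumes rd: "real_distribution \<alpha>" "real_distribution \<beta>"
    and c: "\<And>x. tail \<alpha> x \<le> c * tail \<sigma> x" "c \<ge> 0" and d: "\<And>x. tail \<beta> x \<le> d * tail \<sigma> x" "d \<ge> 0"
  shows "tail (\<alpha> \<star> \<beta>) x \<le> c * (d * C) * tail \<sigma> x"
proof -
  have "tail (\<alpha> \<star> \<beta>) x \<le> c * tail (\<sigma> \<star> \<beta>) x" by (rule tail_convolution_mono[OF rd(1) rd_sigma rd(2) c(1)])
  also have "(\<sigma> \<star> \<beta>) = (\<beta> \<star> \<sigma>)" by (rule convolution_comm[OF rd_sigma rd(2)])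
  also have "c * tail (\<beta> \<star> \<sigma>) x \<le> c * (d * tail (\<sigma> \<star> \<sigma>) x)"
    by (intro mult_left_mono tail_convolution_mono[OF rd(2) rd_sigma rd_sigma d(1)] c)
  also have "\<dots> \<le> c * (d * (C * tail \<sigma> x))"
    by (intro mult_left_mono sigma_conv c d)
  finally show ?thesis by (simp add: mult_ac)
qed

text \<open>Fatou's lemma: the integrals of the ratios against \<open>\<beta>\<close> are ratios for
  \<open>\<alpha> \<star> \<beta>\<close>, hence bounded. When \<open>f\<close> is exponential this
  becomes a statement about an exponential moment of \<open>\<beta>\<close>.\<close>

lemma integrable_limit:
  assumes rd: "real_distribution \<alpha>" "real_distribution \<beta>"
    and c: "\<And>x. tail (\<alpha> \<star> \<beta>) x \<le> c * tail \<sigma> x" "c \<ge> 0"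
    and f: "\<And>a. (\<lambda>k. tail \<alpha> (X k + a) / tail \<sigma> (X k)) \<longlonglongrightarrow> f a"
  shows "integrable \<beta> (\<lambda>y. f (a - y))"
proof -
  interpret real_distribution \<beta> by (rule rd)
  note [measurable] = measurable_limit[OF rd(1) f] measurable_tail[OF rd(1)]
  let ?b = "c * (C * exp (K * (\<bar>a\<bar> + max 0 0)))"
  have "(\<integral>\<^sup>+y. ennreal (f (a - y)) \<partial>\<beta>) = (\<integral>\<^sup>+y. liminf (\<lambda>k. ennreal (tail \<alpha> (X k + a - y) / tail \<sigma> (X k))) \<partial>\<beta>)"
  proof (intro nn_integral_cong)
    fix y
    have "(\<lambda>k. ennreal (tail \<alpha> (X k + a - y) / tail \<sigma> (X k))) \<longlonglongrightarrow> ennreal (f (a - y))"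
      using f[of "a - y"] by (intro tendsto_ennrealI) (simp add: add_diff_eq)
    from lim_imp_Liminf[OF _ this]
    show "ennreal (f (a - y)) = liminf (\<lambda>k. ennreal (tail \<alpha> (X k + a - y) / tail \<sigma> (X k)))" by simp
  qed
  also have "\<dots> \<le> liminf (\<lambda>k. \<integral>\<^sup>+y. ennreal (tail \<alpha> (X k + a - y) / tail \<sigma> (X k)) \<partial>\<beta>)"
    by (rule nn_integral_liminf) measurable
  also have "\<dots> \<le> liminf (\<lambda>k::nat. ennreal ?b)"
  proof (rule Liminf_mono, rule always_eventually, rule allI)
    fix k
    have "(\<integral>\<^sup>+y. ennreal (tail \<alpha> (X k + a - y) / tail \<sigma> (X k)) \<partial>\<beta>) = ennreal (\<integral>y. tail \<alpha> (X k + a - y) / tail \<sigma> (X k) \<partial>\<beta>)"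
      using integrable_tail_shift[OF rd, of "X k + a"] ratio_nonneg by (intro nn_integral_eq_integral) auto
    also have "(\<integral>y. tail \<alpha> (X k + a - y) / tail \<sigma> (X k) \<partial>\<beta>) = tail (\<alpha> \<star> \<beta>) (X k + a - 0) / tail \<sigma> (X k)"
      by (simp add: tail_convolution[OF rd])
    also have "ennreal \<dots> \<le> ennreal ?b" by (intro ennreal_leI ratio_bound c)
    finally show "(\<integral>\<^sup>+y. ennreal (tail \<alpha> (X k + a - y) / tail \<sigma> (X k)) \<partial>\<beta>) \<le> ennreal ?b" .
  qed
  also have "\<dots> < \<infinity>" by (simp add: Liminf_const)
  finally show ?thesis
    using limit_nonneg[OF f] by (intro integrableI_nonneg) auto
qed

text \<open>The product rule behind the derivation property. Splitting at level \<open>A\<close>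
  leaves two truncated integrals, which converge along the sequence, and a remainder with two big
  jumps, which is negligible uniformly for large \<open>A\<close>.\<close>

lemma convolution_limit:
  assumes rd: "real_distribution \<alpha>" "real_distribution \<beta>"
    and nn: "AE x in \<alpha>. 0 \<le> x" "AE x in \<beta>. 0 \<le> x"
    and c: "\<And>x. tail \<alpha> x \<le> c * tail \<sigma> x" "c \<ge> 0" and d: "\<And>x. tail \<beta> x \<le> d * tail \<sigma> x" "d \<ge> 0"
    and f: "\<And>a. (\<lambda>k. tail \<alpha> (X k + a) / tail \<sigma> (X k)) \<longlonglongrightarrow> f a"
    and g: "\<And>a. (\<lambda>k. tail \<beta> (X k + a) / tail \<sigma> (X k)) \<longlonglongrightarrow> g a"
  shows "(\<lambda>k. tail (\<alpha> \<star> \<beta>) (X k + a) / tail \<sigma> (X k))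
    \<longlonglongrightarrow> (\<integral>y. f (a - y) \<partial>\<beta>) + (\<integral>y. g (a - y) \<partial>\<alpha>)" (is "?r \<longlonglongrightarrow> ?L")
proof (rule LIMSEQ_I)
  fix e :: real assume e: "e > 0"
  note [measurable] = measurable_limit[OF rd(1) f] measurable_limit[OF rd(2) g]
  note cb = convolution_bound[OF rd c d]
  have cb': "tail (\<beta> \<star> \<alpha>) x \<le> c * (d * C) * tail \<sigma> x" for x
    using cb[of x] by (simp add: convolution_comm[OF rd])
  have nnc: "c * (d * C) \<ge> 0" using c d C by simp
  have fi: "integrable \<beta> (\<lambda>y. f (a - y))" by (rule integrable_limit[OF rd cb nnc f])
  have gi: "integrable \<alpha> (\<lambda>y. g (a - y))" by (rule integrable_limit[OF rd(2,1) cb' nnc g])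
  have trunc: "(\<lambda>n. \<integral>y. indicator {..real n} y * q (a - y) \<partial>\<delta>) \<longlonglongrightarrow> (\<integral>y. q (a - y) \<partial>\<delta>)"
    if "integrable \<delta> (\<lambda>y. q (a - y))" and rdd: "real_distribution \<delta>" and [measurable]: "q \<in> borel_measurable borel" for q :: "real \<Rightarrow> real" and \<delta>
  proof -
    interpret real_distribution \<delta> by (rule rdd)
    show ?thesis
    proof (rule integral_dominated_convergence[OF _ _ integrable_norm[OF that(1)]])
      show "AE y in \<delta>. norm (indicator {..real n} y * q (a - y)) \<le> norm (q (a - y))" for n
        by (intro AE_I2) (simp add: indicator_def)
      show "AE y in \<delta>. (\<lambda>n. indicator {..real n} y * q (a - y)) \<longlonglongrightarrow> q (a - y)"
      proof (rule AE_I2)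
        fix y
        obtain N where "y \<le> real N" using real_arch_simple by blast
        then have "\<forall>\<^sub>F n in sequentially. q (a - y) = indicator {..real n} y * q (a - y)"
          by (intro eventually_sequentiallyI[of N]) (auto simp: indicator_def)
        then show "(\<lambda>n. indicator {..real n} y * q (a - y)) \<longlonglongrightarrow> q (a - y)"
          by (rule Lim_transform_eventually[OF tendsto_const])
      qed
    qed measurable
  qed
  \<comment> \<open>Converts smallness relative to \<open>tail \<sigma> (X k + a)\<close> into
    smallness relative to \<open>tail \<sigma> (X k)\<close>, including the domination constants of
    both laws; the summand \<open>1\<close> makes division by \<open>E\<close> safe.\<close>
  define E where "E = c * d * (C * exp (K * \<bar>a\<bar>)) + 1"
  have E: "E > 0" "c * d * (C * exp (K * \<bar>a\<bar>)) \<le> E" using c d C by (auto simp: E_def add_nonneg_pos)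
  have e': "e / 4 / E > 0" using e E by simp
  obtain A0 where A0: "\<And>A. A \<ge> A0 \<Longrightarrow> \<forall>\<^sub>F x in at_top. big_jumps A \<sigma> \<sigma> x \<le> e / 4 / E * tail \<sigma> x"
    using sbj e' unfolding single_big_jump_def by meson
  have "(\<lambda>n. (\<integral>y. indicator {..real n} y * f (a - y) \<partial>\<beta>) + (\<integral>y. indicator {..real n} y * g (a - y) \<partial>\<alpha>)) \<longlonglongrightarrow> ?L"
    by (intro tendsto_add trunc fi gi rd) measurable
  from LIMSEQ_D[OF this, of "e / 4"] e obtain n1 where n1: "\<And>n. n \<ge> n1 \<Longrightarrow>
    norm ((\<integral>y. indicator {..real n} y * f (a - y) \<partial>\<beta>) + (\<integral>y. indicator {..real n} y * g (a - y) \<partial>\<alpha>) - ?L) < e / 4"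
    by auto
  obtain n2 where n2: "A0 \<le> real n2" using real_arch_simple by blast
  define A where "A = real (max n1 n2)"
  have A: "A \<ge> A0" "A \<ge> 0" using n2 by (auto simp: A_def)
  define F where "F = (\<integral>y. indicator {..A} y * f (a - y) \<partial>\<beta>)"
  define G where "G = (\<integral>y. indicator {..A} y * g (a - y) \<partial>\<alpha>)"
  have FG: "\<bar>F + G - ?L\<bar> < e / 4" using n1[of "max n1 n2"] unfolding F_def G_def A_def real_norm_def by simp
  let ?F = "\<lambda>k. (\<integral>y. indicator {..A} y * tail \<alpha> (X k + a - y) \<partial>\<beta>) / tail \<sigma> (X k)"
  let ?G = "\<lambda>k. (\<integral>y. indicator {..A} y * tail \<beta> (X k + a - y) \<partial>\<alpha>) / tail \<sigma> (X k)"
  have "(\<lambda>k. ?F k + ?G k) \<longlonglongrightarrow> F + G"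
    unfolding F_def G_def by (intro tendsto_add truncated_limit[OF rd nn(2) c f A(2)] truncated_limit[OF rd(2,1) nn(1) d g A(2)])
  from tendstoD[OF this, of "e / 4"] e have ev1: "\<forall>\<^sub>F k in sequentially. \<bar>?F k + ?G k - (F + G)\<bar> < e / 4"
    by (simp add: dist_real_def)
  have Xa: "filterlim (\<lambda>k. X k + a) at_top sequentially"
    using filterlim_tendsto_add_at_top[OF tendsto_const X, of a] by (simp add: add.commute)
  have ev2: "\<forall>\<^sub>F k in sequentially. big_jumps A \<sigma> \<sigma> (X k + a) \<le> e / 4 / E * tail \<sigma> (X k + a)"
    using filterlim_iff[THEN iffD1, OF Xa, rule_format, OF A0[OF A(1)]] .
  have ev3: "\<forall>\<^sub>F k in sequentially. X k + a > 2 * A"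
    using filterlim_iff[THEN iffD1, OF Xa, rule_format, OF eventually_gt_at_top] .
  have "\<forall>\<^sub>F k in sequentially. norm (?r k - ?L) < e"
    using ev1 ev2 ev3
  proof eventually_elim
    case (elim k)
    let ?J = "big_jumps A \<alpha> \<beta> (X k + a) / tail \<sigma> (X k)"
    have r: "?r k = ?F k + ?G k + ?J"
      unfolding tail_convolution_split[OF rd elim(3)] by (simp add: add_divide_distrib)
    have "big_jumps A \<alpha> \<beta> (X k + a) \<le> c * d * big_jumps A \<sigma> \<sigma> (X k + a)"
      by (rule big_jumps_le[OF rd rd_sigma c(1) d(1) c(2)])
    also have "\<dots> \<le> c * d * (e / 4 / E * tail \<sigma> (X k + a))"
      using elim(2) c d by (intro mult_left_mono) auto
    finally have "?J \<le> c * d * (e / 4 / E * tail \<sigma> (X k + a)) / tail \<sigma> (X k)"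
      using sigma_pos[of "X k"] by (intro divide_right_mono) auto
    also have "\<dots> = (c * d * (e / 4 / E)) * (tail \<sigma> (X k + a - 0) / tail \<sigma> (X k))" by simp
    also have "\<dots> \<le> (c * d * (e / 4 / E)) * (1 * (C * exp (K * (\<bar>a\<bar> + max 0 0))))"
    proof (rule mult_left_mono[OF ratio_bound])
      show "0 \<le> c * d * (e / 4 / E)" by (intro mult_nonneg_nonneg c d less_imp_le[OF e'])
    qed auto
    also have "\<dots> = (c * d * (C * exp (K * \<bar>a\<bar>))) * (e / 4 / E)" by simp
    also have "\<dots> \<le> E * (e / 4 / E)" using e' E by (intro mult_right_mono) auto
    finally have "?J \<le> e / 4" using E by simp
    moreover have "?J \<ge> 0" using big_jumps_nonneg sigma_pos[of "X k"] by simp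
    ultimately show ?case using elim(1) FG r e unfolding real_norm_def by linarith
  qed
  then show "\<exists>no. \<forall>n\<ge>no. norm (?r n - ?L) < e" by (simp add: eventually_sequentially)
qed

end

text \<open>The Poisson weights satisfy \<open>n p(n) = s p(n - 1)\<close>. The factor
  \<open>Suc k\<close> produced by differentiating a power is absorbed in this way.\<close>

lemma poisson_shift:
  fixes c :: "nat \<Rightarrow> real"
  assumes s: "s > 0" and sm: "summable (\<lambda>n. s ^ n / fact n * \<bar>c n\<bar>)"
  shows "(\<integral>n. (case n of 0 \<Rightarrow> 0 | Suc k \<Rightarrow> real (Suc k) * c k) \<partial>measure_pmf (poisson_pmf s))
    = s * (\<integral>n. c n \<partial>measure_pmf (poisson_pmf s))"
proof -
  let ?l = "\<lambda>n. case n of 0 \<Rightarrow> 0 | Suc k \<Rightarrow> real (Suc k) * c k"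
  have eq: "s ^ Suc k / fact (Suc k) * (real (Suc k) * y) = s * (s ^ k / fact k * y)" for k y
    by (simp add: field_simps del: of_nat_Suc)
  have "summable (\<lambda>n. s ^ Suc n / fact (Suc n) * norm (?l (Suc n)))"
  proof -
    have "s ^ Suc n / fact (Suc n) * norm (?l (Suc n)) = s * (s ^ n / fact n * \<bar>c n\<bar>)" for n
      unfolding eq[symmetric] by (simp add: abs_mult)
    then show ?thesis using summable_mult[OF sm, of s] by (simp only:)
  qed
  then have sl: "summable (\<lambda>n. s ^ n / fact n * norm (?l n))" by (subst (asm) summable_Suc_iff)
  have "(\<lambda>n. s * ((s ^ n / fact n * exp (- s)) *\<^sub>R c n)) sums (s * (\<integral>n. c n \<partial>measure_pmf (poisson_pmf s)))"
    using poisson_integral(2)[OF s, of c] sm by (intro sums_mult) simp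
  then have "(\<lambda>n. (s ^ Suc n / fact (Suc n) * exp (- s)) *\<^sub>R ?l (Suc n)) sums (s * (\<integral>n. c n \<partial>measure_pmf (poisson_pmf s)))"
    by (rule back_subst[of "\<lambda>f. f sums _"]) (auto simp: field_simps simp del: of_nat_Suc)
  then have "(\<lambda>n. (s ^ n / fact n * exp (- s)) *\<^sub>R ?l n) sums (s * (\<integral>n. c n \<partial>measure_pmf (poisson_pmf s)))"
    by (subst (asm) sums_Suc_iff) simp
  with poisson_integral(2)[OF s sl] show ?thesis by (rule sums_unique2)
qed

lemma exp_max_0_le: "exp (K * max 0 y) \<le> 1 + exp (K * y)" for K y :: real
  by (cases "y \<ge> 0") (auto simp: max_def)

context big_jump_setting
begin

lemma exp_max_integrable:
  assumes "real_distribution \<eta>" "exp_moment \<eta> K < \<infinity>"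
  shows "integrable \<eta> (\<lambda>u. exp (K * max 0 u))"
proof -
  interpret real_distribution \<eta> by fact
  have "integrable \<eta> (\<lambda>u. 1 + exp (K * u))"
    using assms(2) unfolding exp_moment_integrable[OF assms(1)] by simp
  then show ?thesis
    by (rule Bochner_Integration.integrable_bound) (auto simp: exp_max_0_le intro: order_trans[OF _ abs_ge_self])
qed

lemma tail_cpois_le:
  assumes s: "s > 0"
  shows "tail (cpois s \<rho>) x \<le> exp (s * (D - 1)) * tail \<sigma> x"
proof -
  have "tail (cpois s \<rho>) x = (\<integral>n. tail (conv_pow \<rho> n) x \<partial>measure_pmf (poisson_pmf s))"
    by (rule tail_cpois[OF s rd_rho])
  also have "\<dots> \<le> (\<integral>n. D ^ n * tail \<sigma> x \<partial>measure_pmf (poisson_pmf s))"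
  proof (intro integral_mono kesten integrable_mult_left poisson_integral_power_real s)
    show "integrable (measure_pmf (poisson_pmf s)) (\<lambda>n. tail (conv_pow \<rho> n) x)"
      by (rule measure_pmf.integrable_const_bound[of _ 1])
         (auto simp: tail_le_1 real_distribution_conv_pow rd_rho)
  qed
  also have "\<dots> = exp (s * (D - 1)) * tail \<sigma> x"
    by (simp add: poisson_integral_power_real s)
  finally show ?thesis .
qed

text \<open>Light factors do not spoil domination by \<open>\<sigma>\<close>: a positive shift costs
  an exponential of order \<open>K\<close>, which \<open>\<eta>\<close> integrates, and a negative
  one costs nothing.\<close>

lemma tail_convolution_light_le:
  assumes rd: "real_distribution \<alpha>" "real_distribution \<eta>" and m: "exp_moment \<eta> K < \<infinity>"
    and c: "\<And>x. tail \<alpha> x \<le> c * tail \<sigma> x" "c \<ge> 0"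
  shows "tail (\<alpha> \<star> \<eta>) x \<le> c * (C * (\<integral>u. exp (K * max 0 u) \<partial>\<eta>)) * tail \<sigma> x"
proof -
  have "tail (\<alpha> \<star> \<eta>) x = (\<integral>u. tail \<alpha> (x - u) \<partial>\<eta>)" by (rule tail_convolution[OF rd])
  also have "\<dots> \<le> (\<integral>u. c * C * tail \<sigma> x * exp (K * max 0 u) \<partial>\<eta>)"
  proof (intro integral_mono integrable_tail_shift rd integrable_mult_right exp_max_integrable m)
    fix u
    have "tail \<alpha> (x - u) \<le> c * tail \<sigma> (x - u)" by (rule c)
    also have "\<dots> \<le> c * tail \<sigma> (x - max 0 u)"
      using c by (intro mult_left_mono tail_antimono rd_sigma) auto
    also have "\<dots> \<le> c * (C * exp (K * max 0 u) * tail \<sigma> x)"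
      using c by (intro mult_left_mono sigma_shift) auto
    finally show "tail \<alpha> (x - u) \<le> c * C * tail \<sigma> x * exp (K * max 0 u)" by (simp add: mult_ac)
  qed
  finally show ?thesis by (simp add: mult_ac)
qed

end

context big_jump_limit
begin

lemma measurable_h [measurable]: "h \<in> borel_measurable borel"
  by (rule measurable_limit[OF rd_rho h])

lemma h_nonneg: "h a \<ge> 0"
  by (rule limit_nonneg[OF h])

lemma ratio_antimono:
  "real_distribution \<alpha> \<Longrightarrow> a \<le> b \<Longrightarrow> tail \<alpha> (X k + b) / tail \<sigma> (X k) \<le> tail \<alpha> (X k + a) / tail \<sigma> (X k)"
  using sigma_pos[of "X k"] by (intro divide_right_mono tail_antimono) auto

definition hconv :: "nat \<Rightarrow> real \<Rightarrow> real" where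
  "hconv n a = (\<integral>u. h (a - u) \<partial>conv_pow \<rho> n)"

lemma kesten_conv: "tail (\<rho> \<star> conv_pow \<rho> n) x \<le> D ^ Suc n * tail \<sigma> x"
  using kesten[of "Suc n" x] by simp

lemma integrable_hconv: "integrable (conv_pow \<rho> n) (\<lambda>u. h (a - u))"
  using D by (intro integrable_limit[OF rd_rho real_distribution_conv_pow[OF rd_rho] kesten_conv _ h]) simp

lemma hconv_0: "hconv 0 a = h a"
  by (simp add: hconv_def integral_return)

text \<open>The power rule, by induction from the product rule: every one of the
  \<open>Suc n\<close> factors can be the one that makes the big jump, and the others are convolved
  with \<open>h\<close>.\<close>

lemma conv_pow_limit:
  "(\<lambda>k. tail (conv_pow \<rho> (Suc n)) (X k + a) / tail \<sigma> (X k)) \<longlonglongrightarrow> real (Suc n) * hconv n a"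
proof (induction n arbitrary: a)
  case 0
  then show ?case using h by (simp only: conv_pow_1[OF rd_rho] hconv_0) simp
next
  case (Suc n)
  note rdp = real_distribution_conv_pow[OF rd_rho]
  have h1: "hconv (Suc n) a = (\<integral>y. hconv n (a - y) \<partial>\<rho>)"
  proof -
    have "hconv (Suc n) a = (\<integral>y. (\<integral>u. h (a - (y + u)) \<partial>conv_pow \<rho> n) \<partial>\<rho>)"
      unfolding hconv_def conv_pow.simps
      by (rule integral_convolution[OF rd_rho rdp integrable_hconv[of "Suc n", unfolded conv_pow.simps]])
    then show ?thesis by (simp add: hconv_def diff_diff_eq)
  qed
  have "tail \<rho> x \<le> D * tail \<sigma> x" for x using kesten[of "Suc 0" x] unfolding conv_pow_1[OF rd_rho] by simp
  then have "(\<lambda>k. tail (\<rho> \<star> conv_pow \<rho> (Suc n)) (X k + a) / tail \<sigma> (X k))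
    \<longlonglongrightarrow> (\<integral>y. h (a - y) \<partial>conv_pow \<rho> (Suc n)) + (\<integral>y. real (Suc n) * hconv n (a - y) \<partial>\<rho>)"
    using D rho_nonneg
    by (intro convolution_limit[OF rd_rho rdp _ _ _ _ kesten _ h Suc] AE_conv_pow_nonneg rd_rho) auto
  then show ?case
    unfolding integral_mult_right_zero h1[symmetric] hconv_def[symmetric]
    by (simp add: algebra_simps del: conv_pow.simps) simp
qed

lemma hconv_nonneg: "hconv n a \<ge> 0"
  unfolding hconv_def by (intro Bochner_Integration.integral_nonneg h_nonneg)

lemma hconv_bound: "real (Suc n) * hconv n a \<le> D ^ Suc n * (C * exp (K * \<bar>a\<bar>))"
proof (rule LIMSEQ_le_const2[OF conv_pow_limit])
  show "\<exists>N. \<forall>k\<ge>N. tail (conv_pow \<rho> (Suc n)) (X k + a) / tail \<sigma> (X k) \<le> D ^ Suc n * (C * exp (K * \<bar>a\<bar>))"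
    using ratio_bound[OF kesten[of "Suc n"], where a=a and y=0] D by auto
qed

lemma summable_hconv:
  assumes s: "s > 0"
  shows "summable (\<lambda>n. s ^ n / fact n * \<bar>hconv n a\<bar>)"
proof (rule summable_comparison_test')
  show "summable (\<lambda>n. (D * (C * exp (K * \<bar>a\<bar>))) * (s ^ n / fact n * D ^ n))"
    by (intro summable_mult summable_exp_pow)
  fix n
  have "hconv n a \<le> real (Suc n) * hconv n a" using hconv_nonneg[of n a] by (simp add: mult_le_cancel_right1)
  also note hconv_bound
  finally have "s ^ n / fact n * hconv n a \<le> s ^ n / fact n * (D ^ Suc n * (C * exp (K * \<bar>a\<bar>)))"
    using s by (intro mult_left_mono) auto
  then show "norm (s ^ n / fact n * \<bar>hconv n a\<bar>) \<le> (D * (C * exp (K * \<bar>a\<bar>))) * (s ^ n / fact n * D ^ n)"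
    using s hconv_nonneg[of n a] by (simp add: abs_mult mult_ac)
qed

text \<open>This is \<open>s\<close> times the convolution of \<open>h\<close> with
  \<open>cpois s \<rho>\<close>: formally, the derivative of \<open>exp (s (\<rho> - 1))\<close> in
  the direction \<open>h\<close>.\<close>

definition mlim :: "real \<Rightarrow> real \<Rightarrow> real" where
  "mlim s a = s * (\<integral>n. hconv n a \<partial>measure_pmf (poisson_pmf s))"

lemma cpois_limit:
  assumes s: "s > 0"
  shows "(\<lambda>k. tail (cpois s \<rho>) (X k + a) / tail \<sigma> (X k)) \<longlonglongrightarrow> mlim s a"
proof -
  let ?P = "measure_pmf (poisson_pmf s)"
  let ?l = "\<lambda>n. case n of 0 \<Rightarrow> 0 | Suc k \<Rightarrow> real (Suc k) * hconv k a"
  have "(\<lambda>k. \<integral>n. tail (conv_pow \<rho> n) (X k + a) / tail \<sigma> (X k) \<partial>?P) \<longlonglongrightarrow> (\<integral>n. ?l n \<partial>?P)"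
  proof (rule integral_dominated_convergence)
    show "integrable ?P (\<lambda>n. D ^ n * (C * exp (K * (\<bar>a\<bar> + max 0 0))))"
      by (intro integrable_mult_left poisson_integral_power_real s)
    show "AE n in ?P. norm (tail (conv_pow \<rho> n) (X k + a) / tail \<sigma> (X k)) \<le> D ^ n * (C * exp (K * (\<bar>a\<bar> + max 0 0)))" for k
      using ratio_bound[OF kesten, where a=a and y=0] ratio_nonneg D by (intro AE_I2) (simp add: abs_of_nonneg)
    show "AE n in ?P. (\<lambda>k. tail (conv_pow \<rho> n) (X k + a) / tail \<sigma> (X k)) \<longlonglongrightarrow> ?l n"
    proof (rule AE_I2)
      fix n
      show "(\<lambda>k. tail (conv_pow \<rho> n) (X k + a) / tail \<sigma> (X k)) \<longlonglongrightarrow> ?l n"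
      proof (cases n)
        case 0
        \<comment> \<open>The zeroth power is the point mass at \<open>0\<close>; its tail vanishes
          as soon as \<open>X k + a\<close> is nonnegative, which matches the value \<open>0\<close>
          of the limit at \<open>n = 0\<close>.\<close>
        have "\<forall>\<^sub>F k in sequentially. X k \<ge> - a"
          using filterlim_iff[THEN iffD1, OF X, rule_format, OF eventually_ge_at_top] .
        then have "\<forall>\<^sub>F k in sequentially. 0 = tail (conv_pow \<rho> n) (X k + a) / tail \<sigma> (X k)"
          by eventually_elim (simp add: 0 tail_def measure_return indicator_def)
        then show ?thesis by (simp add: 0 Lim_transform_eventually[OF tendsto_const])
      next
        case (Suc j)
        then show ?thesis using conv_pow_limit[of j a] by simp
      qed
    qed
  qed auto
  then show ?thesis
    unfolding mlim_def poisson_shift[OF s summable_hconv[OF s]] by (simp add: tail_cpois[OF s rd_rho])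
qed

lemma mlim_antimono: "s > 0 \<Longrightarrow> a \<le> b \<Longrightarrow> mlim s b \<le> mlim s a"
  by (rule LIMSEQ_le[OF cpois_limit cpois_limit])
     (auto intro!: exI[of _ 0] ratio_antimono real_distribution_cpois rd_rho)

text \<open>The law \<open>\<eta>\<close> may charge the negative axis, so the product rule for
  nonnegative laws is not the tool here. It is lighter than \<open>\<sigma>\<close> instead:
  \<open>exp (K * max 0 u)\<close> dominates the ratios and is integrable.\<close>

lemma full_limit:
  assumes s: "s > 0" and eta: "real_distribution \<eta>" "exp_moment \<eta> K < \<infinity>"
  shows "integrable \<eta> (\<lambda>u. mlim s (a - u))"
    and "(\<lambda>k. tail (cpois s \<rho> \<star> \<eta>) (X k + a) / tail \<sigma> (X k)) \<longlonglongrightarrow> (\<integral>u. mlim s (a - u) \<partial>\<eta>)"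
proof -
  let ?pi = "cpois s \<rho>"
  let ?c = "exp (s * (D - 1))"
  note rdpi = real_distribution_cpois[OF s rd_rho]
  interpret real_distribution \<eta> by (rule eta)
  have [measurable]: "mlim s \<in> borel_measurable borel"
    by (rule measurable_limit[OF rdpi cpois_limit[OF s]])
  note [measurable] = measurable_tail[OF rdpi]
  define w where "w u = ?c * (C * exp (K * \<bar>a\<bar>)) * exp (K * max 0 u)" for u
  have w: "integrable \<eta> w" unfolding w_def by (intro integrable_mult_right exp_max_integrable eta)
  have lim: "AE u in \<eta>. (\<lambda>k. tail ?pi (X k + a - u) / tail \<sigma> (X k)) \<longlonglongrightarrow> mlim s (a - u)"
    using cpois_limit[OF s, of "a - _"] by (intro AE_I2) (simp add: add_diff_eq)
  have bd: "AE u in \<eta>. norm (tail ?pi (X k + a - u) / tail \<sigma> (X k)) \<le> w u" for k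
  proof (rule AE_I2)
    fix u
    have "tail ?pi (X k + a - u) / tail \<sigma> (X k) \<le> ?c * (C * exp (K * (\<bar>a\<bar> + max 0 u)))"
      by (rule ratio_bound[OF tail_cpois_le[OF s]]) simp
    then show "norm (tail ?pi (X k + a - u) / tail \<sigma> (X k)) \<le> w u"
      using ratio_nonneg[of ?pi "X k + a - u" k] by (simp add: w_def distrib_left exp_add mult_ac)
  qed
  show "integrable \<eta> (\<lambda>u. mlim s (a - u))"
    by (rule integrable_dominated_convergence[OF _ _ w lim bd]) measurable
  have "(\<lambda>k. \<integral>u. tail ?pi (X k + a - u) / tail \<sigma> (X k) \<partial>\<eta>) \<longlonglongrightarrow> (\<integral>u. mlim s (a - u) \<partial>\<eta>)"
    by (rule integral_dominated_convergence[OF _ _ w lim bd]) measurable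
  then show "(\<lambda>k. tail (?pi \<star> \<eta>) (X k + a) / tail \<sigma> (X k)) \<longlonglongrightarrow> (\<integral>u. mlim s (a - u) \<partial>\<eta>)"
    by (simp add: tail_convolution[OF rdpi eta(1)])
qed

end

section \<open>Deconvolution\<close>

text \<open>Points of equality lie arbitrarily close to \<open>a\<close> on both sides, and
  monotonicity transfers their values. This removes the exceptional null set of the Wiener
  theorem.\<close>

lemma antimono_AE_eq_continuous:
  fixes m f :: "real \<Rightarrow> real"
  assumes mono: "\<And>a b. a \<le> b \<Longrightarrow> m b \<le> m a" and ae: "AE x in lborel. m x = f x" and cont: "isCont f a"
  shows "m a = f a"
proof (rule antisym)
  have ex: "\<exists>x. b < x \<and> x < c \<and> m x = f x" if "b < c" for b c
  proof (rule ccontr)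
    assume no: "\<nexists>x. b < x \<and> x < c \<and> m x = f x"
    have "AE x in lborel. x \<notin> {b<..<c}" using ae by eventually_elim (use no in auto)
    then have "{b<..<c} \<in> null_sets lborel" by (simp add: AE_iff_null_sets)
    then have "emeasure lborel {b<..<c} = 0" by (rule null_setsD1)
    then show False using that by simp
  qed
  show "m a \<le> f a"
  proof (rule ccontr)
    assume "\<not> m a \<le> f a"
    then have "\<forall>\<^sub>F x in at a. f x < m a"
      using cont by (intro order_tendstoD(2)[of f "f a"]) (auto simp: isCont_def)
    then obtain d where d: "d > 0" "\<And>x. x \<noteq> a \<Longrightarrow> dist x a < d \<Longrightarrow> f x < m a" by (auto simp: eventually_at)
    obtain x where x: "a - d < x" "x < a" "m x = f x" using ex[of "a - d" a] d by auto
    have "f x < m a" by (rule d) (use x in \<open>auto simp: dist_real_def\<close>)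
    moreover have "m a \<le> m x" by (rule mono) (use x in simp)
    ultimately show False using x by simp
  qed
  show "f a \<le> m a"
  proof (rule ccontr)
    assume "\<not> f a \<le> m a"
    then have "\<forall>\<^sub>F x in at a. m a < f x"
      using cont by (intro order_tendstoD(1)[of f "f a"]) (auto simp: isCont_def)
    then obtain d where d: "d > 0" "\<And>x. x \<noteq> a \<Longrightarrow> dist x a < d \<Longrightarrow> m a < f x" by (auto simp: eventually_at)
    obtain x where x: "a < x" "x < a + d" "m x = f x" using ex[of a "a + d"] d by auto
    have "m a < f x" by (rule d) (use x in \<open>auto simp: dist_real_def\<close>)
    moreover have "m x \<le> m a" by (rule mono) (use x in simp)
    ultimately show False using x by simp
  qed
qed

lemma ex_measure_atLeast_pos:
  assumes "real_distribution \<eta>"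
  obtains n :: nat where "measure \<eta> {- real n..} > 0"
proof (rule ccontr)
  interpret real_distribution \<eta> by fact
  assume "\<not> thesis"
  then have "measure \<eta> {- real n..} = 0" for n using that by (auto simp: zero_less_measure_iff)
  then have "emeasure \<eta> {- real n..} = 0" for n by (simp add: emeasure_eq_measure)
  then have "emeasure \<eta> (\<Union>n. {- real n..}) = 0" by (intro emeasure_UN_eq_0) auto
  moreover have "(\<Union>n. {- real n..}) = UNIV"
  proof (intro set_eqI iffI UNIV_I)
    fix x :: real
    obtain n where "- x \<le> real n" using real_arch_simple by blast
    then show "x \<in> (\<Union>n. {- real n..})" by (auto simp: minus_le_iff)
  qed
  ultimately show False using emeasure_space_1 by simp
qed

text \<open>Esscher tilting by \<open>exp (\<gamma> u)\<close> turns the equation into \<open>g \<star> \<theta> = 0\<close> with \<open>g\<close> bounded.\<close>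

lemma light_deconvolution:
  fixes m :: "real \<Rightarrow> real"
  assumes eta: "real_distribution \<eta>" and mom: "\<And>K. K > 0 \<Longrightarrow> exp_moment \<eta> K < \<infinity>"
    and nz: "\<And>w. Re w > 0 \<Longrightarrow> (\<integral>u. exp (w * complex_of_real u) \<partial>\<eta>) \<noteq> 0"
    and \<gamma>: "\<gamma> > 0" and \<kappa>: "\<kappa> > 0"
    and mono: "\<And>a b. a \<le> b \<Longrightarrow> m b \<le> m a" and nonneg: "\<And>a. m a \<ge> 0"
    and int: "\<And>a. integrable \<eta> (\<lambda>u. m (a - u))"
    and eq: "\<And>a. (\<integral>u. m (a - u) \<partial>\<eta>) = \<kappa> * exp (- \<gamma> * a)"
  obtains c where "c > 0" "\<And>a. m a = c * exp (- \<gamma> * a)"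
proof -
  interpret real_distribution \<eta> by (rule eta)
  have mm[measurable]: "m \<in> borel_measurable borel"
    by (rule borel_measurable_antimono) (use mono in \<open>auto simp: antimono_def\<close>)
  have ie: "integrable \<eta> (\<lambda>u. exp (K * u))" if "K > 0" for K
    using mom[OF that] unfolding exp_moment_integrable[OF eta] .
  define M where "M = (\<integral>u. exp (\<gamma> * u) \<partial>\<eta>)"
  have "complex_of_real M = (\<integral>u. exp (of_real \<gamma> * complex_of_real u) \<partial>\<eta>)"
    unfolding M_def using integral_of_real[OF ie[OF \<gamma>], where 'a=complex] by (simp flip: exp_of_real)
  then have "M \<noteq> 0" using nz[of "of_real \<gamma>"] \<gamma> by auto
  moreover have "M \<ge> 0" unfolding M_def by (intro Bochner_Integration.integral_nonneg) auto
  ultimately have M: "M > 0" by simp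
  \<comment> \<open>Convolving \<open>exp (- \<gamma> * a)\<close> with \<open>\<eta>\<close>
    multiplies it by \<open>M\<close>, so with this constant the exponential solves the same
    equation.\<close>
  define c where "c = \<kappa> / M"
  have c: "c > 0" using \<kappa> M by (simp add: c_def)
  obtain n where "measure \<eta> {- real n..} > 0" by (rule ex_measure_atLeast_pos[OF eta])
  then obtain N where N: "measure \<eta> {- N..} > 0" by blast
  \<comment> \<open>On \<open>u \<ge> - N\<close>, an event of positive probability,
    \<open>m ((a - N) - u)\<close> is at least \<open>m a\<close>. The equation at
    \<open>a - N\<close> thus bounds \<open>m a\<close> by an exponential.\<close>
  define B where "B = \<kappa> * exp (\<gamma> * N) / measure \<eta> {- N..}"
  have mb: "m a * exp (\<gamma> * a) \<le> B" for a
  proof -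
    have "m a * measure \<eta> {- N..} = (\<integral>u. m a * indicator {- N..} u \<partial>\<eta>)" by simp
    also have "\<dots> \<le> (\<integral>u. m ((a - N) - u) \<partial>\<eta>)"
    proof (rule integral_mono[OF _ int])
      show "integrable \<eta> (\<lambda>u. m a * indicator {- N..} u)"
        by (rule integrable_bounded[OF eta, of _ "m a"]) (use nonneg in \<open>auto simp: indicator_def\<close>)
      show "m a * indicator {- N..} u \<le> m ((a - N) - u)" for u
        using nonneg mono[of "(a - N) - u" a] by (auto simp: indicator_def)
    qed
    also have "\<dots> = \<kappa> * exp (- \<gamma> * (a - N))" by (rule eq)
    finally have "m a \<le> \<kappa> * exp (- \<gamma> * (a - N)) / measure \<eta> {- N..}"
      using N by (simp add: field_simps)
    then have "m a * exp (\<gamma> * a) \<le> \<kappa> * exp (- \<gamma> * (a - N)) / measure \<eta> {- N..} * exp (\<gamma> * a)"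
      by (intro mult_right_mono) auto
    also have "\<dots> = \<kappa> * (exp (- \<gamma> * (a - N)) * exp (\<gamma> * a)) / measure \<eta> {- N..}" by simp
    also have "exp (- \<gamma> * (a - N)) * exp (\<gamma> * a) = exp (\<gamma> * N)"
      by (simp add: algebra_simps flip: exp_add)
    finally show ?thesis by (simp add: B_def)
  qed
  define g where "g a = m a * exp (\<gamma> * a) - c" for a
  have [measurable]: "g \<in> borel_measurable borel" unfolding g_def by measurable
  have gb: "\<bar>g a\<bar> \<le> B + c" for a
  proof -
    have "0 \<le> m a * exp (\<gamma> * a)" using nonneg by simp
    then show ?thesis using mb[of a] c unfolding g_def by linarith
  qed
  define \<theta> where "\<theta> = density \<eta> (\<lambda>u. ennreal (exp (\<gamma> * u)))"
  have s\<theta>: "sets \<theta> = sets borel" by (simp add: \<theta>_def)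
  have f\<theta>: "finite_measure \<theta>"
  proof (rule finite_measureI)
    show "emeasure \<theta> (space \<theta>) \<noteq> \<infinity>"
      using mom[OF \<gamma>] unfolding \<theta>_def exp_moment_def by (subst emeasure_density) auto
  qed
  \<comment> \<open>Tilting and weight together give \<open>exp (2 * \<gamma> * u)\<close> for
    positive \<open>u\<close> and \<open>1\<close> for negative \<open>u\<close>. The width
    \<open>\<gamma>\<close> of the strip is chosen so that the negative side needs no moment of
    \<open>\<eta>\<close>.\<close>
  have e\<theta>: "integrable \<theta> (\<lambda>u. exp (\<gamma> * \<bar>u\<bar>))"
  proof -
    have "integrable \<eta> (\<lambda>u. exp (\<gamma> * u) *\<^sub>R exp (\<gamma> * \<bar>u\<bar>))"
    proof (rule Bochner_Integration.integrable_bound)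
      show "integrable \<eta> (\<lambda>u. 1 + exp (2 * \<gamma> * u))" using ie[of "2 * \<gamma>"] \<gamma> by simp
      show "AE u in \<eta>. norm (exp (\<gamma> * u) *\<^sub>R exp (\<gamma> * \<bar>u\<bar>)) \<le> norm (1 + exp (2 * \<gamma> * u))"
      proof (rule AE_I2)
        fix u :: real
        show "norm (exp (\<gamma> * u) *\<^sub>R exp (\<gamma> * \<bar>u\<bar>)) \<le> norm (1 + exp (2 * \<gamma> * u))"
          by (cases "u \<ge> 0") (auto simp: mult_ac simp flip: exp_add)
      qed
    qed auto
    then show ?thesis unfolding \<theta>_def by (subst integrable_density) auto
  qed
  have "AE a in lborel. g a = 0"
  proof (rule wiener_carleman[OF f\<theta> s\<theta> \<gamma> e\<theta> _ _ gb])
    fix y :: real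
    \<comment> \<open>The Fourier transform of the tilted measure is the transform of
      \<open>\<eta>\<close> on the line \<open>Re w = \<gamma>\<close>.\<close>
    have "(\<integral>u. exp (\<i> * of_real y * of_real u) \<partial>\<theta>) = (\<integral>u. exp (Complex \<gamma> y * of_real u) \<partial>\<eta>)"
      unfolding \<theta>_def
      by (subst integral_density)
         (auto simp: scaleR_conv_of_real Complex_eq algebra_simps simp flip: exp_of_real exp_add intro!: Bochner_Integration.integral_cong)
    also have "\<dots> \<noteq> 0" using nz[of "Complex \<gamma> y"] \<gamma> by simp
    finally show "(\<integral>u. exp (\<i> * of_real y * of_real u) \<partial>\<theta>) \<noteq> 0" .
  next
    fix a
    have "(\<integral>u. g (a - u) \<partial>\<theta>) = (\<integral>u. exp (\<gamma> * a) * m (a - u) - c * exp (\<gamma> * u) \<partial>\<eta>)"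
      unfolding \<theta>_def
      by (subst integral_density)
         (auto simp: g_def algebra_simps simp flip: exp_add intro!: Bochner_Integration.integral_cong)
    also have "\<dots> = exp (\<gamma> * a) * (\<kappa> * exp (- \<gamma> * a)) - c * M"
      unfolding M_def eq[symmetric]
      by (subst Bochner_Integration.integral_diff) (auto intro!: int ie[OF \<gamma>])
    also have "exp (\<gamma> * a) * (\<kappa> * exp (- \<gamma> * a)) = \<kappa>" by (simp add: exp_minus)
    finally show "(\<integral>u. g (a - u) \<partial>\<theta>) = 0" using M by (simp add: c_def)
  qed measurable
  then have "AE a in lborel. m a = c * exp (- \<gamma> * a)"
    by eventually_elim (simp add: g_def exp_minus field_simps)
  then have "m a = c * exp (- \<gamma> * a)" for a
    by (intro antimono_AE_eq_continuous[of m "\<lambda>a. c * exp (- \<gamma> * a)"] mono) auto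
  with c show ?thesis by (rule that)
qed

text \<open>This is \<open>exp (- s L) (exp (s L) d) = d\<close> for the shift operator \<open>L\<close> on sequences.\<close>

lemma exp_shift_inverse:
  fixes d :: "nat \<Rightarrow> real"
  assumes d: "\<And>j. \<bar>d j\<bar> \<le> H * M ^ j" and M: "M \<ge> 0" and s: "s > 0"
  shows "(\<lambda>k. (- s) ^ k / fact k * (\<Sum>n. s ^ n / fact n * d (n + k))) sums d 0"
proof -
  have H: "H \<ge> 0" using d[of 0] by simp
  define b where "b k j = (if k \<le> j then s ^ (j - k) / fact (j - k) else 0) * d j" for k j
  have sm: "summable (\<lambda>n. s ^ n / fact n * d (n + k))" for k
  proof (rule summable_comparison_test')
    show "summable (\<lambda>n. (H * M ^ k) * (s ^ n / fact n * M ^ n))"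
      by (intro summable_mult summable_exp_pow)
    show "norm (s ^ n / fact n * d (n + k)) \<le> (H * M ^ k) * (s ^ n / fact n * M ^ n)" for n
      using mult_left_mono[OF d[of "n + k"], of "s ^ n / fact n"] s by (simp add: abs_mult power_add mult_ac)
  qed
  have bs: "b k sums (\<Sum>n. s ^ n / fact n * d (n + k))" for k
  proof -
    have "(\<lambda>n. b k (n + k)) sums (\<Sum>n. s ^ n / fact n * d (n + k))"
      using summable_sums[OF sm[of k]] by (simp add: b_def)
    then show ?thesis by (subst (asm) sums_zero_iff_shift) (auto simp: b_def)
  qed
  \<comment> \<open>The coefficients regrouped by the index \<open>j\<close> of \<open>d\<close>. A
    full row is the binomial expansion of \<open>(- s + s) ^ j\<close> and vanishes for
    \<open>j > 0\<close>; in absolute value it is at most that of \<open>(s + s) ^ j\<close>, which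
    gives the dominating series with \<open>2 * s\<close>.\<close>
  define a where "a N j = (\<Sum>k<N. (- s) ^ k / fact k * b k j)" for N j
  have as: "a N sums (\<Sum>k<N. (- s) ^ k / fact k * (\<Sum>n. s ^ n / fact n * d (n + k)))" for N
    unfolding a_def by (intro sums_sum sums_mult bs)
  have bound: "\<bar>a N j\<bar> \<le> H * ((2 * s) ^ j / fact j * M ^ j)" for N j
  proof -
    have "\<bar>a N j\<bar> \<le> (\<Sum>k<N. \<bar>(- s) ^ k / fact k * b k j\<bar>)" unfolding a_def by (rule sum_abs)
    also have "\<dots> = (\<Sum>k\<in>{..<N} \<inter> {..j}. s ^ k / fact k * (s ^ (j - k) / fact (j - k)) * \<bar>d j\<bar>)"
      using s by (intro sum.mono_neutral_cong_right) (auto simp: b_def abs_mult power_abs)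
    also have "\<dots> \<le> (\<Sum>k\<le>j. s ^ k / fact k * (s ^ (j - k) / fact (j - k)) * \<bar>d j\<bar>)"
      using s by (intro sum_mono2) auto
    also have "\<dots> = (\<Sum>k\<le>j. of_nat (j choose k) * s ^ k * s ^ (j - k)) / fact j * \<bar>d j\<bar>"
      unfolding sum_distrib_right sum_divide_distrib by (intro sum.cong refl) (simp add: binomial_fact field_simps)
    also have "\<dots> = (2 * s) ^ j / fact j * \<bar>d j\<bar>" by (simp flip: binomial_ring)
    also have "\<dots> \<le> (2 * s) ^ j / fact j * (H * M ^ j)" using s d by (intro mult_left_mono) auto
    finally show ?thesis by (simp add: mult_ac)
  qed
  have a_eq: "a N j = (if j = 0 then d 0 else 0)" if "N > j" for N j
  proof -
    have "a N j = (\<Sum>k\<le>j. (- s) ^ k / fact k * (s ^ (j - k) / fact (j - k)) * d j)"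
      unfolding a_def using that by (intro sum.mono_neutral_cong_right) (auto simp: b_def)
    also have "\<dots> = (\<Sum>k\<le>j. of_nat (j choose k) * (- s) ^ k * s ^ (j - k)) / fact j * d j"
      unfolding sum_distrib_right sum_divide_distrib by (intro sum.cong refl) (simp add: binomial_fact field_simps)
    also have "\<dots> = (- s + s) ^ j / fact j * d j" by (simp only: binomial_ring)
    finally show ?thesis by (simp add: power_0_left)
  qed
  have "(\<lambda>N. \<integral>j. a N j \<partial>count_space UNIV) \<longlonglongrightarrow> (\<integral>j. (if j = 0 then d 0 else 0) \<partial>count_space (UNIV :: nat set))"
  proof (rule integral_dominated_convergence)
    show "integrable (count_space UNIV) (\<lambda>j. H * ((2 * s) ^ j / fact j * M ^ j))"
      unfolding integrable_count_space_nat_iff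
      using summable_mult[OF summable_exp_pow[of "2 * s" M], of H] H M s by (simp add: abs_mult)
    show "AE j in count_space UNIV. norm (a N j) \<le> H * ((2 * s) ^ j / fact j * M ^ j)" for N
      using bound by simp
    show "AE j in count_space UNIV. (\<lambda>N. a N j) \<longlonglongrightarrow> (if j = 0 then d 0 else 0)"
    proof (rule AE_I2)
      fix j
      have "\<forall>\<^sub>F N in sequentially. (if j = 0 then d 0 else 0) = a N j"
        using eventually_gt_at_top[of j] by eventually_elim (simp add: a_eq)
      then show "(\<lambda>N. a N j) \<longlonglongrightarrow> (if j = 0 then d 0 else 0)"
        by (rule Lim_transform_eventually[OF tendsto_const])
    qed
  qed auto
  moreover have "(\<integral>j. a N j \<partial>count_space UNIV) = (\<Sum>k<N. (- s) ^ k / fact k * (\<Sum>n. s ^ n / fact n * d (n + k)))" for N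
  proof -
    have "integrable (count_space UNIV) (a N)"
      unfolding integrable_count_space_nat_iff
      by (rule summable_comparison_test'[OF summable_mult[OF summable_exp_pow[of "2 * s" M], of H]]) (use bound in auto)
    then show ?thesis using sums_unique[OF as[of N]] by (simp add: integral_count_space_nat)
  qed
  moreover have "(\<integral>j. (if j = 0 then d 0 else 0) \<partial>count_space (UNIV :: nat set)) = d 0"
  proof -
    have "(\<lambda>j::nat. if j = 0 then d 0 else 0) sums d 0" using sums_single[of 0 "\<lambda>_. d 0"] by simp
    moreover have "summable (\<lambda>j::nat. norm (if j = 0 then d 0 else 0))"
      by (rule summable_finite[of "{0}"]) auto
    ultimately show ?thesis
      by (subst integral_count_space_nat) (auto simp: integrable_count_space_nat_iff sums_iff)
  qed
  ultimately show ?thesis by (simp add: sums_def)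
qed

lemma class_L_iff:
  "\<rho> \<in> class_L \<gamma> \<longleftrightarrow> real_distribution \<rho> \<and> (\<forall>x>0. tail \<rho> x > 0) \<and>
    (\<forall>a. ((\<lambda>x. tail \<rho> (x + a) / tail \<rho> x) \<longlongrightarrow> exp (- \<gamma> * a)) at_top)"
proof -
  have "(\<lambda>x. tail \<rho> (x + a)) \<sim>[at_top] (\<lambda>x. exp (- \<gamma> * a) * tail \<rho> x)
      \<longleftrightarrow> ((\<lambda>x. tail \<rho> (x + a) / tail \<rho> x) \<longlongrightarrow> exp (- \<gamma> * a)) at_top"
    if pos: "\<forall>x>0. tail \<rho> x > 0" for a
  proof
    have ev: "\<forall>\<^sub>F x in at_top. tail \<rho> x > 0"
      using eventually_gt_at_top[of "0::real"] by eventually_elim (use pos in auto)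
    {
      assume "(\<lambda>x. tail \<rho> (x + a)) \<sim>[at_top] (\<lambda>x. exp (- \<gamma> * a) * tail \<rho> x)"
      then have "((\<lambda>x. tail \<rho> (x + a) / (exp (- \<gamma> * a) * tail \<rho> x)) \<longlongrightarrow> 1) at_top"
        by (rule asymp_equivD_strong) (use ev in eventually_elim, auto)
      from tendsto_mult_left[OF this, of "exp (- \<gamma> * a)"]
      show "((\<lambda>x. tail \<rho> (x + a) / tail \<rho> x) \<longlongrightarrow> exp (- \<gamma> * a)) at_top" by simp
    next
      assume "((\<lambda>x. tail \<rho> (x + a) / tail \<rho> x) \<longlongrightarrow> exp (- \<gamma> * a)) at_top"
      from tendsto_divide[OF this tendsto_const, of "exp (- \<gamma> * a)"]
      have "((\<lambda>x. tail \<rho> (x + a) / (exp (- \<gamma> * a) * tail \<rho> x)) \<longlongrightarrow> 1) at_top"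
        by (simp add: divide_divide_eq_left mult.commute)
      then show "(\<lambda>x. tail \<rho> (x + a)) \<sim>[at_top] (\<lambda>x. exp (- \<gamma> * a) * tail \<rho> x)"
        by (rule asymp_equivI')
    }
  qed
  then show ?thesis unfolding class_L_def by blast
qed

lemma integral_exp_conv_pow:
  assumes rd: "real_distribution \<rho>" and M: "exp_moment \<rho> \<gamma> = ennreal M" "M \<ge> 0"
  shows "integrable (conv_pow \<rho> n) (\<lambda>u. exp (\<gamma> * u))" "(\<integral>u. exp (\<gamma> * u) \<partial>conv_pow \<rho> n) = M ^ n"
proof -
  have e: "exp_moment (conv_pow \<rho> n) \<gamma> = ennreal (M ^ n)"
    using M by (simp add: exp_moment_conv_pow rd ennreal_power)
  then show i: "integrable (conv_pow \<rho> n) (\<lambda>u. exp (\<gamma> * u))"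
    unfolding exp_moment_integrable[OF real_distribution_conv_pow[OF rd], symmetric] by simp
  have "ennreal (\<integral>u. exp (\<gamma> * u) \<partial>conv_pow \<rho> n) = ennreal (M ^ n)"
    using nn_integral_eq_integral[OF i] e by (simp add: exp_moment_def)
  then show "(\<integral>u. exp (\<gamma> * u) \<partial>conv_pow \<rho> n) = M ^ n"
    using M by (subst (asm) ennreal_inj) auto
qed

section \<open>Recovering \<open>h\<close> from the compound Poisson limit\<close>

context big_jump_limit
begin

lemma measurable_hconv [measurable]: "hconv n \<in> borel_measurable borel"
proof -
  have "(\<lambda>a. real (Suc n) * hconv n a) \<in> borel_measurable borel"
    by (rule measurable_limit[OF real_distribution_conv_pow[OF rd_rho] conv_pow_limit])
  then have "(\<lambda>a. (real (Suc n) * hconv n a) / real (Suc n)) \<in> borel_measurable borel" by measurable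
  then show ?thesis by (simp del: of_nat_Suc)
qed

lemma hconv_add: "hconv (n + k) a = (\<integral>y. hconv n (a - y) \<partial>conv_pow \<rho> k)"
proof -
  note rdp = real_distribution_conv_pow[OF rd_rho]
  have eq: "conv_pow \<rho> (n + k) = (conv_pow \<rho> k \<star> conv_pow \<rho> n)"
    using conv_pow_add[OF rd_rho, of k n] by (simp add: add.commute)
  show ?thesis
    unfolding hconv_def eq
    by (subst integral_convolution[OF rdp rdp integrable_hconv[of "n + k", unfolded eq]]) (simp add: diff_diff_eq)
qed

lemma hconv_le:
  assumes M: "exp_moment \<rho> \<gamma> = ennreal M" "M \<ge> 0" and H: "\<And>a. h a \<le> H * exp (- \<gamma> * a)"
  shows "hconv n a \<le> H * exp (- \<gamma> * a) * M ^ n"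
proof -
  have "hconv n a \<le> (\<integral>u. H * exp (- \<gamma> * a) * exp (\<gamma> * u) \<partial>conv_pow \<rho> n)"
    unfolding hconv_def
  proof (intro integral_mono integrable_hconv integrable_mult_right integral_exp_conv_pow[OF rd_rho M])
    show "h (a - u) \<le> H * exp (- \<gamma> * a) * exp (\<gamma> * u)" for u
      using H[of "a - u"] by (simp add: algebra_simps flip: exp_add)
  qed
  then show ?thesis by (simp add: integral_exp_conv_pow[OF rd_rho M])
qed

text \<open>The equation for \<open>mlim\<close> can be convolved with every power of
  \<open>\<rho>\<close>: an exponential function is only multiplied by powers of the moment
  \<open>M\<close>. So all shifted series in \<open>hconv\<close> are known, and the inverse
  exponential series extracts the term of index \<open>0\<close>, which is \<open>h\<close>.\<close>

lemma cpois_deconvolution: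
  assumes s: "s > 0" and c: "c > 0" and M: "exp_moment \<rho> \<gamma> = ennreal M" "M \<ge> 0"
    and eq: "\<And>a. mlim s a = c * exp (- \<gamma> * a)"
  obtains c' where "c' > 0" "\<And>a. h a = c' * exp (- \<gamma> * a)"
proof -
  \<comment> \<open>Undoes the factor \<open>s\<close> and the Poisson normalisation
    \<open>exp (- s)\<close> contained in \<open>mlim\<close>.\<close>
  define q where "q = c / s * exp s"
  have q: "q > 0" using c s by (simp add: q_def)
  have S: "(\<lambda>n. s ^ n / fact n * hconv n a) sums (q * exp (- \<gamma> * a))" for a
  proof -
    have "(\<lambda>n. (s ^ n / fact n * exp (- s)) *\<^sub>R hconv n a) sums (\<integral>n. hconv n a \<partial>measure_pmf (poisson_pmf s))"
      using summable_hconv[OF s] by (intro poisson_integral s) simp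
    also have "(\<integral>n. hconv n a \<partial>measure_pmf (poisson_pmf s)) = c / s * exp (- \<gamma> * a)"
      using eq[of a] s by (simp add: mlim_def field_simps)
    finally have "(\<lambda>n. exp s * ((s ^ n / fact n * exp (- s)) *\<^sub>R hconv n a)) sums (exp s * (c / s * exp (- \<gamma> * a)))"
      by (rule sums_mult)
    moreover have "exp s * ((s ^ n / fact n * exp (- s)) *\<^sub>R hconv n a) = s ^ n / fact n * hconv n a" for n
      using exp_minus_inverse[of s] by (simp add: mult_ac)
    ultimately have "(\<lambda>n. s ^ n / fact n * hconv n a) sums (exp s * (c / s * exp (- \<gamma> * a)))" by (simp only:)
    then show ?thesis by (simp add: q_def mult_ac)
  qed
  \<comment> \<open>\<open>h\<close> is the first term of a series of nonnegative terms. The bound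
    makes \<open>hconv n\<close> grow at most geometrically in \<open>n\<close>, as the interchange
    of sum and integral and the inverse series require.\<close>
  have H: "h a \<le> q * exp (- \<gamma> * a)" for a
  proof -
    have "(\<Sum>n<1. s ^ n / fact n * hconv n a) \<le> (\<Sum>n. s ^ n / fact n * hconv n a)"
      using s hconv_nonneg by (intro sum_le_suminf sums_summable[OF S]) auto
    then show ?thesis using sums_unique[OF S[of a]] by (simp add: hconv_0)
  qed
  note hb = hconv_le[OF M H]
  \<comment> \<open>The identity at \<open>a - y\<close>, integrated against the \<open>k\<close>-th
    power: \<open>exp (\<gamma> * y)\<close> integrates to \<open>M ^ k\<close>.\<close>
  have B: "(\<Sum>n. s ^ n / fact n * hconv (n + k) a) = q * exp (- \<gamma> * a) * M ^ k" for k a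
  proof -
    let ?R = "conv_pow \<rho> k"
    note ie = integral_exp_conv_pow[OF rd_rho M, of k]
    interpret R: real_distribution ?R by (rule real_distribution_conv_pow[OF rd_rho])
    have bd: "hconv n (a - y) \<le> q * exp (- \<gamma> * a) * M ^ n * exp (\<gamma> * y)" for n y
      using hb[of n "a - y"] by (simp add: algebra_simps flip: exp_add)
    have i: "integrable ?R (\<lambda>y. hconv n (a - y))" for n
      by (rule Bochner_Integration.integrable_bound[OF integrable_mult_right[OF ie(1), of "q * exp (- \<gamma> * a) * M ^ n"]])
         (use bd hconv_nonneg in \<open>auto intro: order_trans[OF _ abs_ge_self]\<close>)
    have "(\<Sum>n. s ^ n / fact n * hconv (n + k) a) = (\<Sum>n. \<integral>y. s ^ n / fact n * hconv n (a - y) \<partial>?R)"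
      by (simp add: hconv_add)
    also have "\<dots> = (\<integral>y. (\<Sum>n. s ^ n / fact n * hconv n (a - y)) \<partial>?R)"
    proof (rule integral_suminf[symmetric])
      show "integrable ?R (\<lambda>y. s ^ n / fact n * hconv n (a - y))" for n by (rule integrable_mult_right[OF i])
      show "AE y in ?R. summable (\<lambda>n. norm (s ^ n / fact n * hconv n (a - y)))"
        using summable_hconv[OF s] s by (intro AE_I2) (simp add: abs_mult)
      show "summable (\<lambda>n. \<integral>y. norm (s ^ n / fact n * hconv n (a - y)) \<partial>?R)"
      proof (rule summable_comparison_test')
        show "summable (\<lambda>n. (q * exp (- \<gamma> * a) * M ^ k) * (s ^ n / fact n * M ^ n))"
          by (intro summable_mult summable_exp_pow)
        fix n
        have "(\<integral>y. norm (s ^ n / fact n * hconv n (a - y)) \<partial>?R) \<le> (\<integral>y. s ^ n / fact n * (q * exp (- \<gamma> * a) * M ^ n) * exp (\<gamma> * y) \<partial>?R)"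
        proof (intro integral_mono integrable_norm integrable_mult_right i ie)
          show "norm (s ^ n / fact n * hconv n (a - y)) \<le> s ^ n / fact n * (q * exp (- \<gamma> * a) * M ^ n) * exp (\<gamma> * y)" for y
            using mult_left_mono[OF bd[of n y], of "s ^ n / fact n"] s hconv_nonneg by (simp add: abs_mult mult.assoc)
        qed
        then show "norm (\<integral>y. norm (s ^ n / fact n * hconv n (a - y)) \<partial>?R) \<le> (q * exp (- \<gamma> * a) * M ^ k) * (s ^ n / fact n * M ^ n)"
          using ie(2) by (simp add: mult_ac)
      qed
    qed
    also have "\<dots> = (\<integral>y. q * exp (- \<gamma> * a) * exp (\<gamma> * y) \<partial>?R)"
      using sums_unique[OF S, symmetric]
      by (intro Bochner_Integration.integral_cong refl) (simp add: algebra_simps flip: exp_add)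
    also have "\<dots> = q * exp (- \<gamma> * a) * M ^ k" using ie(2) by simp
    finally show ?thesis .
  qed
  have "h a = q * exp (- (s * M)) * exp (- \<gamma> * a)" for a
  proof -
    have "(\<lambda>k. (- s) ^ k / fact k * (\<Sum>n. s ^ n / fact n * hconv (n + k) a)) sums hconv 0 a"
      by (rule exp_shift_inverse[OF _ M(2) s, of _ "q * exp (- \<gamma> * a)"]) (use hb hconv_nonneg in auto)
    then have 1: "(\<lambda>k. (- s) ^ k / fact k * (q * exp (- \<gamma> * a) * M ^ k)) sums h a"
      unfolding B hconv_0 .
    have "(\<lambda>k. (- (s * M)) ^ k /\<^sub>R fact k) sums exp (- (s * M))" by (rule exp_converges)
    from sums_mult[OF this, of "q * exp (- \<gamma> * a)"]
    have "(\<lambda>k. (- s) ^ k / fact k * (q * exp (- \<gamma> * a) * M ^ k)) sums (q * exp (- \<gamma> * a) * exp (- (s * M)))"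
    proof (rule back_subst[of "\<lambda>f. f sums _"], intro ext)
      fix k
      have "(- (s * M)) ^ k = (- s) ^ k * M ^ k" by (simp flip: power_mult_distrib)
      then show "q * exp (- \<gamma> * a) * ((- (s * M)) ^ k /\<^sub>R fact k) = (- s) ^ k / fact k * (q * exp (- \<gamma> * a) * M ^ k)"
        by (simp add: field_simps)
    qed
    with 1 have "h a = q * exp (- \<gamma> * a) * exp (- (s * M))" by (rule sums_unique2)
    then show ?thesis by simp
  qed
  then show ?thesis using q by (intro that[of "q * exp (- (s * M))"]) auto
qed

end

section \<open>Limits along subsequences\<close>

context big_jump_setting
begin

text \<open>The ratios are antitone in the shift and bounded in \<open>k\<close> for each shift, so
  the selection result applies at every real argument.\<close>

lemma limit_subseq:
  assumes X: "filterlim X at_top sequentially"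
  obtains r h where "strict_mono (r :: nat \<Rightarrow> nat)" "big_jump_limit \<rho> \<sigma> C D K (\<lambda>k. X (r k)) h"
proof -
  let ?f = "\<lambda>k a. tail \<rho> (X k + a) / tail \<sigma> (X k)"
  have mono: "antimono (?f k)" for k
    using sigma_pos[of "X k"] by (auto simp: antimono_def intro!: divide_right_mono tail_antimono rd_rho)
  have "\<bar>?f k a\<bar> \<le> D * (C * exp (K * \<bar>a\<bar>))" for k a
  proof -
    have "tail \<rho> (X k + a) \<le> D * tail \<sigma> (X k + a)"
      using kesten[of "Suc 0" "X k + a"] unfolding conv_pow_1[OF rd_rho] by simp
    also have "\<dots> \<le> D * tail \<sigma> (X k - \<bar>a\<bar>)"
      using D by (intro mult_left_mono tail_antimono rd_sigma) auto
    also have "\<dots> \<le> D * (C * exp (K * \<bar>a\<bar>) * tail \<sigma> (X k))"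
      using D by (intro mult_left_mono sigma_shift) auto
    finally show ?thesis using sigma_pos[of "X k"] by (simp add: field_simps)
  qed
  then have "bounded (range (\<lambda>k. ?f k a))" for a
    by (intro boundedI[of _ "D * (C * exp (K * \<bar>a\<bar>))"]) auto
  from antimono_convergent_subseq[OF mono this] obtain r h
    where r: "strict_mono (r :: nat \<Rightarrow> nat)" "\<And>a. (\<lambda>k. ?f (r k) a) \<longlonglongrightarrow> h a" by blast
  have "big_jump_limit \<rho> \<sigma> C D K (\<lambda>k. X (r k)) h"
  proof (intro big_jump_limit.intro big_jump_setting_axioms big_jump_limit_axioms.intro r)
    show "filterlim (\<lambda>k. X (r k)) at_top sequentially"
      using filterlim_compose[OF X filterlim_subseq[OF r(1)]] .
  qed
  with r(1) show ?thesis by (rule that)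
qed

text \<open>\<open>class_L\<close> makes the limit of the whole law satisfy an exponential
  functional equation, with a factor that the lower bound \<open>p\<close> keeps positive. The
  constant \<open>c\<close> may depend on the subsequence; only the exponential shape is
  claimed.\<close>

lemma exponential_limit_subseq:
  assumes s: "s > 0" and eta: "real_distribution \<eta>" and mom: "\<And>K. K > 0 \<Longrightarrow> exp_moment \<eta> K < \<infinity>"
    and nz: "\<And>w. Re w > 0 \<Longrightarrow> (\<integral>u. exp (w * complex_of_real u) \<partial>\<eta>) \<noteq> 0"
    and p: "p > 0" "\<And>x. p * tail \<sigma> x \<le> tail (cpois s \<rho>) x"
    and \<gamma>: "\<gamma> > 0" and L: "(cpois s \<rho> \<star> \<eta>) \<in> class_L \<gamma>"
    and X: "filterlim X at_top sequentially"
  obtains r c where "strict_mono (r :: nat \<Rightarrow> nat)" "c > 0" "exp_moment \<rho> \<gamma> < \<infinity>"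
    "big_jump_limit \<rho> \<sigma> C D K (\<lambda>k. X (r k)) (\<lambda>a. c * exp (- \<gamma> * a))"
proof -
  let ?F = "cpois s \<rho> \<star> \<eta>"
  obtain r h where r: "strict_mono (r :: nat \<Rightarrow> nat)" and lim: "big_jump_limit \<rho> \<sigma> C D K (\<lambda>k. X (r k)) h"
    using limit_subseq[OF X] by blast
  interpret big_jump_limit \<rho> \<sigma> C D K "\<lambda>k. X (r k)" h by (rule lim)
  let ?Y = "\<lambda>k. X (r k)"
  have Y: "filterlim ?Y at_top sequentially" by (rule X)
  note rdpi = real_distribution_cpois[OF s rd_rho]
  note rdF = real_distribution_convolution[OF rdpi eta]
  interpret e: real_distribution \<eta> by (rule eta)
  note fl = full_limit[OF s eta mom[OF K]]
  define Lf where "Lf a = (\<integral>u. mlim s (a - u) \<partial>\<eta>)" for a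
  have Flim: "(\<lambda>k. tail ?F (?Y k + a) / tail \<sigma> (?Y k)) \<longlonglongrightarrow> Lf a" for a
    unfolding Lf_def by (rule fl(2))
  have Fpos: "\<And>x. x > 0 \<Longrightarrow> tail ?F x > 0"
    and FL: "\<And>a. ((\<lambda>x. tail ?F (x + a) / tail ?F x) \<longlongrightarrow> exp (- \<gamma> * a)) at_top"
    using L by (auto simp: class_L_iff)
  have LfE: "Lf a = Lf 0 * exp (- \<gamma> * a)" for a
  proof -
    have "(\<lambda>k. tail ?F (?Y k + a) / tail ?F (?Y k)) \<longlonglongrightarrow> exp (- \<gamma> * a)"
      by (rule filterlim_compose[OF FL Y])
    from tendsto_mult[OF Flim[of 0] this]
    have "(\<lambda>k. tail ?F (?Y k + 0) / tail \<sigma> (?Y k) * (tail ?F (?Y k + a) / tail ?F (?Y k))) \<longlonglongrightarrow> Lf 0 * exp (- \<gamma> * a)" .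
    moreover have "\<forall>\<^sub>F k in sequentially. ?Y k > 0"
      using filterlim_iff[THEN iffD1, OF Y, rule_format, OF eventually_gt_at_top] .
    then have "\<forall>\<^sub>F k in sequentially. tail ?F (?Y k + 0) / tail \<sigma> (?Y k) * (tail ?F (?Y k + a) / tail ?F (?Y k)) = tail ?F (?Y k + a) / tail \<sigma> (?Y k)"
    proof eventually_elim
      case (elim k)
      then show ?case using Fpos[OF elim] by simp
    qed
    ultimately have "(\<lambda>k. tail ?F (?Y k + a) / tail \<sigma> (?Y k)) \<longlonglongrightarrow> Lf 0 * exp (- \<gamma> * a)"
      by (rule Lim_transform_eventually)
    with Flim show ?thesis by (rule LIMSEQ_unique)
  qed
  have mnn: "mlim s a \<ge> 0" for a by (rule limit_nonneg[OF cpois_limit[OF s]])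
  \<comment> \<open>For \<open>a \<le> 0\<close> the tail of \<open>\<sigma>\<close> at
    \<open>X k + a\<close> is at least that at \<open>X k\<close>, so the lower bound survives in
    the limit.\<close>
  have mlow: "mlim s a \<ge> p" if "a \<le> 0" for a
  proof (rule LIMSEQ_le_const[OF cpois_limit[OF s]], intro exI allI impI)
    fix k
    have "p * tail \<sigma> (?Y k) \<le> p * tail \<sigma> (?Y k + a)"
      using p(1) that by (intro mult_left_mono tail_antimono rd_sigma) auto
    also have "\<dots> \<le> tail (cpois s \<rho>) (?Y k + a)" by (rule p)
    finally show "p \<le> tail (cpois s \<rho>) (?Y k + a) / tail \<sigma> (?Y k)"
      using sigma_pos[of "?Y k"] by (simp add: field_simps)
  qed
  \<comment> \<open>A zero factor would make \<open>Lf\<close> vanish everywhere, also at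
    \<open>- real n\<close>. There the integrand is at least \<open>p\<close> on
    \<open>u \<ge> - real n\<close>, an event of positive probability.\<close>
  have Lf0: "Lf 0 > 0"
  proof (rule ccontr)
    assume "\<not> Lf 0 > 0"
    moreover have "Lf 0 \<ge> 0" unfolding Lf_def by (intro Bochner_Integration.integral_nonneg mnn)
    ultimately have "Lf 0 = 0" by simp
    then have z: "Lf a = 0" for a using LfE[of a] by simp
    obtain n where n: "measure \<eta> {- real n..} > 0" by (rule ex_measure_atLeast_pos[OF eta])
    have "p * measure \<eta> {- real n..} = (\<integral>u. p * indicator {- real n..} u \<partial>\<eta>)" by simp
    also have "\<dots> \<le> (\<integral>u. mlim s (- real n - u) \<partial>\<eta>)"
    proof (rule integral_mono[OF _ fl(1)])
      show "integrable \<eta> (\<lambda>u. p * indicator {- real n..} u)"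
        by (rule integrable_bounded[OF eta, of _ p]) (use p in \<open>auto simp: indicator_def\<close>)
      show "p * indicator {- real n..} u \<le> mlim s (- real n - u)" for u
        using mlow[of "- real n - u"] mnn by (auto simp: indicator_def)
    qed
    also have "\<dots> = 0" using z[of "- real n"] by (simp add: Lf_def)
    finally show False using mult_pos_pos[OF p(1) n] by linarith
  qed
  obtain c where c: "c > 0" "\<And>a. mlim s a = c * exp (- \<gamma> * a)"
  proof (rule light_deconvolution[OF eta mom nz \<gamma> Lf0 mlim_antimono[OF s] mnn fl(1)])
    show "(\<integral>u. mlim s (a - u) \<partial>\<eta>) = Lf 0 * exp (- \<gamma> * a)" for a
      unfolding Lf_def[symmetric] by (rule LfE)
  qed (assumption | rule that)+
  have "exp_moment \<rho> \<gamma> < \<infinity>"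
  proof -
    obtain b where b: "b \<ge> 0" "\<And>x. tail ?F x \<le> b * tail \<sigma> x"
    proof -
      have "0 \<le> exp (s * (D - 1)) * (C * (\<integral>u. exp (K * max 0 u) \<partial>\<eta>))"
        using C by (intro mult_nonneg_nonneg Bochner_Integration.integral_nonneg) auto
      with tail_convolution_light_le[OF rdpi eta mom[OF K] tail_cpois_le[OF s]] show thesis
        using that by simp
    qed
    have D1: "tail \<rho> x \<le> D * tail \<sigma> x" for x
      using kesten[of "Suc 0" x] unfolding conv_pow_1[OF rd_rho] by simp
    \<comment> \<open>Fatou applied to the whole law convolved once more with \<open>\<rho>\<close>.
      As \<open>Lf\<close> is a positive multiple of an exponential, this is the moment of order
      \<open>\<gamma>\<close> needed before the compound Poisson factor can be removed.\<close>
    have "integrable \<rho> (\<lambda>y. Lf (0 - y))"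
    proof (rule integrable_limit[OF rdF rd_rho convolution_bound[OF rdF rd_rho b(2,1) D1] _ Flim])
      show "0 \<le> D" "0 \<le> b * (D * C)" using b C D by auto
    qed
    then have "integrable \<rho> (\<lambda>y. Lf 0 * exp (\<gamma> * y))"
      by (subst (asm) LfE) simp
    then have "integrable \<rho> (\<lambda>y. exp (\<gamma> * y))" using Lf0 by simp
    then show ?thesis unfolding exp_moment_integrable[OF rd_rho] .
  qed
  then obtain M where M: "exp_moment \<rho> \<gamma> = ennreal M" "M \<ge> 0"
    by (metis ennreal_cases infinity_ennreal_def less_irrefl)
  obtain c' where "c' > 0" "\<And>a. h a = c' * exp (- \<gamma> * a)"
    using cpois_deconvolution[OF s c(1) M c(2)] by blast
  moreover from this have "h = (\<lambda>a. c' * exp (- \<gamma> * a))" by auto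
  ultimately show ?thesis using r lim \<open>exp_moment \<rho> \<gamma> < \<infinity>\<close> that by blast
qed

end

section \<open>Exponential and convolution equivalent classes\<close>

context big_jump_setting
begin

text \<open>Both conditions are limits of quotients with denominator \<open>tail \<rho>\<close>.
  Dividing two limits relative to \<open>\<sigma>\<close> cancels the subsequence-dependent constant
  \<open>c\<close>, so all subsequences yield the same value.\<close>

lemma class_S_if_class_L:
  assumes s: "s > 0" and eta: "real_distribution \<eta>" and mom: "\<And>K. K > 0 \<Longrightarrow> exp_moment \<eta> K < \<infinity>"
    and nz: "\<And>w. Re w > 0 \<Longrightarrow> (\<integral>u. exp (w * complex_of_real u) \<partial>\<eta>) \<noteq> 0"
    and p: "p > 0" "\<And>x. p * tail \<sigma> x \<le> tail (cpois s \<rho>) x"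
    and \<gamma>: "\<gamma> > 0" and L: "(cpois s \<rho> \<star> \<eta>) \<in> class_L \<gamma>"
  shows "\<rho> \<in> class_S \<gamma>"
proof -
  note sub = exponential_limit_subseq[OF s eta mom nz p \<gamma> L]
  \<comment> \<open>One instance, along the natural numbers, supplies the facts that involve no
    limit: finiteness of the moment and positivity of the tail.\<close>
  obtain r0 c0 where r0: "strict_mono (r0 :: nat \<Rightarrow> nat)" "c0 > 0" and fin: "exp_moment \<rho> \<gamma> < \<infinity>"
    and l0: "big_jump_limit \<rho> \<sigma> C D K (\<lambda>k. real (r0 k)) (\<lambda>a. c0 * exp (- \<gamma> * a))"
    using sub[OF _ _ filterlim_real_sequentially] by blast
  obtain M where M: "exp_moment \<rho> \<gamma> = ennreal M" "M \<ge> 0"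
    using fin by (metis ennreal_cases infinity_ennreal_def less_irrefl)
  have pos: "tail \<rho> x > 0" for x
  proof -
    interpret big_jump_limit \<rho> \<sigma> C D K "\<lambda>k. real (r0 k)" "\<lambda>a. c0 * exp (- \<gamma> * a)" by (rule l0)
    have "\<forall>\<^sub>F k in sequentially. tail \<rho> (real (r0 k) + 0) / tail \<sigma> (real (r0 k)) > 0"
      using order_tendstoD(1)[OF h[of 0], of 0] r0(2) by simp
    moreover have "\<forall>\<^sub>F k in sequentially. real (r0 k) \<ge> x"
      using filterlim_iff[THEN iffD1, OF X, rule_format, OF eventually_ge_at_top] .
    ultimately have "\<forall>\<^sub>F k in sequentially. tail \<rho> x > 0"
    proof eventually_elim
      case (elim k)
      then have "tail \<rho> (real (r0 k)) > 0" using sigma_pos[of "real (r0 k)"] by (simp add: zero_less_divide_iff)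
      also have "tail \<rho> (real (r0 k)) \<le> tail \<rho> x" by (rule tail_antimono[OF rd_rho elim(2)])
      finally show ?case .
    qed
    then show ?thesis by simp
  qed
  have "\<rho> \<in> class_L \<gamma>"
    unfolding class_L_iff
  proof (intro conjI allI impI rd_rho pos)
    fix a
    show "((\<lambda>x. tail \<rho> (x + a) / tail \<rho> x) \<longlongrightarrow> exp (- \<gamma> * a)) at_top"
    proof (rule tendsto_at_top_subseqI)
      fix X :: "nat \<Rightarrow> real" assume "filterlim X at_top sequentially"
      from sub[OF _ _ this] obtain r c where r: "strict_mono (r :: nat \<Rightarrow> nat)" "c > 0"
        and l: "big_jump_limit \<rho> \<sigma> C D K (\<lambda>k. X (r k)) (\<lambda>a. c * exp (- \<gamma> * a))" by blast
      interpret big_jump_limit \<rho> \<sigma> C D K "\<lambda>k. X (r k)" "\<lambda>a. c * exp (- \<gamma> * a)" by (rule l)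
      have "(\<lambda>k. (tail \<rho> (X (r k) + a) / tail \<sigma> (X (r k))) / (tail \<rho> (X (r k) + 0) / tail \<sigma> (X (r k))))
          \<longlonglongrightarrow> (c * exp (- \<gamma> * a)) / (c * exp (- \<gamma> * 0))"
        by (intro tendsto_divide h) (use r in simp)
      then have "(\<lambda>k. tail \<rho> (X (r k) + a) / tail \<rho> (X (r k))) \<longlonglongrightarrow> exp (- \<gamma> * a)"
        using r(2) sigma_pos[THEN less_imp_neq] by (simp add: divide_divide_eq_left)
      with r(1) show "\<exists>r. strict_mono (r :: nat \<Rightarrow> nat) \<and> (\<lambda>k. tail \<rho> (X (r k) + a) / tail \<rho> (X (r k))) \<longlonglongrightarrow> exp (- \<gamma> * a)"
        by blast
    qed
  qed
  moreover have "((\<lambda>x. tail (conv_pow \<rho> 2) x / tail \<rho> x) \<longlongrightarrow> 2 * M) at_top"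
  proof (rule tendsto_at_top_subseqI)
    fix X :: "nat \<Rightarrow> real" assume "filterlim X at_top sequentially"
    from sub[OF _ _ this] obtain r c where r: "strict_mono (r :: nat \<Rightarrow> nat)" "c > 0"
      and l: "big_jump_limit \<rho> \<sigma> C D K (\<lambda>k. X (r k)) (\<lambda>a. c * exp (- \<gamma> * a))" by blast
    interpret big_jump_limit \<rho> \<sigma> C D K "\<lambda>k. X (r k)" "\<lambda>a. c * exp (- \<gamma> * a)" by (rule l)
    \<comment> \<open>The power rule for exponent \<open>2\<close> at shift \<open>0\<close>; the
      factor \<open>2\<close> comes from that rule and \<open>M\<close> from integrating the
      exponential \<open>h\<close>.\<close>
    have "hconv 1 0 = (\<integral>u. c * exp (\<gamma> * u) \<partial>conv_pow \<rho> 1)"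
      unfolding hconv_def by (intro Bochner_Integration.integral_cong refl) simp
    also have "\<dots> = c * M"
      using integral_exp_conv_pow(2)[OF rd_rho M, of 1] unfolding integral_mult_right_zero by simp
    finally have "(\<lambda>k. tail (conv_pow \<rho> 2) (X (r k) + 0) / tail \<sigma> (X (r k))) \<longlonglongrightarrow> 2 * (c * M)"
      using conv_pow_limit[of 1 0] by (simp add: numeral_2_eq_2)
    then have "(\<lambda>k. (tail (conv_pow \<rho> 2) (X (r k) + 0) / tail \<sigma> (X (r k))) / (tail \<rho> (X (r k) + 0) / tail \<sigma> (X (r k))))
        \<longlonglongrightarrow> (2 * (c * M)) / (c * exp (- \<gamma> * 0))"
      by (rule tendsto_divide[OF _ h]) (use r in simp)
    then have "(\<lambda>k. tail (conv_pow \<rho> 2) (X (r k)) / tail \<rho> (X (r k))) \<longlonglongrightarrow> 2 * M"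
      using r(2) sigma_pos[THEN less_imp_neq] by (simp add: divide_divide_eq_left)
    with r(1) show "\<exists>r. strict_mono (r :: nat \<Rightarrow> nat) \<and> (\<lambda>k. tail (conv_pow \<rho> 2) (X (r k)) / tail \<rho> (X (r k))) \<longlonglongrightarrow> 2 * M"
      by blast
  qed
  moreover have "M > 0"
  proof -
    interpret real_distribution \<rho> by (rule rd_rho)
    have "exp_moment \<rho> \<gamma> \<noteq> 0"
      unfolding exp_moment_def by (subst nn_integral_0_iff_AE) (use AE_False in auto)
    then show ?thesis using M by (auto simp: less_le)
  qed
  ultimately show ?thesis
    using M fin asymp_equivI'_const[of "tail (conv_pow \<rho> 2)" "tail \<rho>" "2 * M"]
    unfolding class_S_def by simp
qed

end

section \<open>From \<open>class_S\<close> to every convolution power\<close>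

lemma class_S_moment:
  assumes "\<rho> \<in> class_S \<gamma>"
  obtains M where "exp_moment \<rho> \<gamma> = ennreal M" "M > 0"
    "((\<lambda>x. tail (\<rho> \<star> \<rho>) x / tail \<rho> x) \<longlongrightarrow> 2 * M) at_top"
proof -
  have rd: "real_distribution \<rho>" and pos: "\<And>x. x > 0 \<Longrightarrow> tail \<rho> x > 0" and fin: "exp_moment \<rho> \<gamma> < \<infinity>"
    and eq: "(\<lambda>x. tail (conv_pow \<rho> 2) x) \<sim>[at_top] (\<lambda>x. 2 * enn2real (exp_moment \<rho> \<gamma>) * tail \<rho> x)"
    using assms by (auto simp: class_S_def class_L_def)
  interpret real_distribution \<rho> by (rule rd)
  define M where "M = enn2real (exp_moment \<rho> \<gamma>)"
  have M: "exp_moment \<rho> \<gamma> = ennreal M" using fin by (simp add: M_def)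
  have "exp_moment \<rho> \<gamma> \<noteq> 0"
    unfolding exp_moment_def by (subst nn_integral_0_iff_AE) (use AE_False in auto)
  then have M0: "M > 0" using fin by (auto simp: M_def enn2real_positive_iff zero_less_iff_neq_zero less_top)
  have "((\<lambda>x. tail (conv_pow \<rho> 2) x / (2 * M * tail \<rho> x)) \<longlongrightarrow> 1) at_top"
    using eq unfolding M_def[symmetric]
  proof (rule asymp_equivD_strong)
    show "\<forall>\<^sub>F x in at_top. tail (conv_pow \<rho> 2) x \<noteq> 0 \<or> 2 * M * tail \<rho> x \<noteq> 0"
      using eventually_gt_at_top[of "0::real"] by eventually_elim (use pos M0 in force)
  qed
  from tendsto_mult_left[OF this, of "2 * M"] M0
  have "((\<lambda>x. tail (conv_pow \<rho> 2) x / tail \<rho> x) \<longlongrightarrow> 2 * M) at_top" by simp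
  then show ?thesis using that[OF M M0] by (simp add: conv_pow_2[OF rd])
qed

lemma class_S_imp_class_OS:
  assumes "\<rho> \<in> class_S \<gamma>" shows "\<rho> \<in> class_OS"
proof -
  obtain M where M: "M > 0" "((\<lambda>x. tail (\<rho> \<star> \<rho>) x / tail \<rho> x) \<longlongrightarrow> 2 * M) at_top"
    by (rule class_S_moment[OF assms], rule that)
  have rd: "real_distribution \<rho>" and pos: "\<And>x. x > 0 \<Longrightarrow> tail \<rho> x > 0"
    using assms by (auto simp: class_S_def class_L_def)
  have l: "((\<lambda>x. ereal (tail (conv_pow \<rho> 2) x / tail \<rho> x)) \<longlongrightarrow> ereal (2 * M)) at_top"
    using M(2) by (simp add: conv_pow_2[OF rd])
  show ?thesis
    using M(1) rd pos lim_imp_Liminf[OF trivial_limit_at_top_linorder l] lim_imp_Limsup[OF trivial_limit_at_top_linorder l]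
    by (simp add: class_OS_def asymp_comparable_def)
qed

text \<open>The splitting of \<open>tail (\<rho> \<star> \<rho>)\<close> expresses the two-big-jumps
  term as the whole minus twice a truncated integral. Relative to \<open>tail \<rho>\<close> its
  limit is \<open>2 * M - 2 * I A\<close>, which tends to \<open>0\<close> as \<open>A\<close> grows
  because \<open>I A\<close> tends to the full moment \<open>M\<close>.\<close>

lemma class_S_single_big_jump:
  assumes S: "\<rho> \<in> class_S \<gamma>" and nn: "AE x in \<rho>. 0 \<le> x"
  shows "single_big_jump \<rho>"
  unfolding single_big_jump_def
proof (intro allI impI)
  fix e :: real assume e: "e > 0"
  obtain M where M: "exp_moment \<rho> \<gamma> = ennreal M" "M > 0" and lim2: "((\<lambda>x. tail (\<rho> \<star> \<rho>) x / tail \<rho> x) \<longlongrightarrow> 2 * M) at_top"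
    by (rule class_S_moment[OF S], rule that)
  have rd: "real_distribution \<rho>" and pos: "\<And>x. x > 0 \<Longrightarrow> tail \<rho> x > 0"
    and L: "\<And>a. ((\<lambda>x. tail \<rho> (x + a) / tail \<rho> x) \<longlongrightarrow> exp (- \<gamma> * a)) at_top"
    using S by (auto simp: class_S_def class_L_iff)
  interpret real_distribution \<rho> by (rule rd)
  note [measurable] = measurable_tail[OF rd]
  have ie: "integrable \<rho> (\<lambda>u. exp (\<gamma> * u))" "(\<integral>u. exp (\<gamma> * u) \<partial>\<rho>) = M"
    using integral_exp_conv_pow[OF rd M(1), of "Suc 0"] M(2) unfolding conv_pow_1[OF rd] by auto
  define I where "I A = (\<integral>y. indicator {..A} y * exp (\<gamma> * y) \<partial>\<rho>)" for A :: real
  have I: "((\<lambda>A. I A) \<longlongrightarrow> M) at_top"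
    unfolding I_def ie(2)[symmetric]
  proof (rule integral_dominated_convergence_at_top[OF _ _ ie(1)])
    show "AE y in \<rho>. ((\<lambda>A. indicator {..A} y * exp (\<gamma> * y)) \<longlongrightarrow> exp (\<gamma> * y)) at_top"
    proof (rule AE_I2)
      fix y :: real
      have "\<forall>\<^sub>F A in at_top. exp (\<gamma> * y) = indicator {..A} y * exp (\<gamma> * y)"
        using eventually_ge_at_top[of y] by eventually_elim simp
      then show "((\<lambda>A. indicator {..A} y * exp (\<gamma> * y)) \<longlongrightarrow> exp (\<gamma> * y)) at_top"
        by (rule Lim_transform_eventually[OF tendsto_const])
    qed
    show "\<forall>\<^sub>F A in at_top. AE y in \<rho>. norm (indicator {..A} y * exp (\<gamma> * y)) \<le> exp (\<gamma> * y)"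
      by (intro always_eventually allI AE_I2) (simp add: indicator_def)
  qed measurable
  \<comment> \<open>The truncated integral enters twice, so an error of \<open>e / 4\<close> leaves
    a limit of at most \<open>e / 2\<close>, strictly below \<open>e\<close>.\<close>
  from order_tendstoD(1)[OF this, of "M - e / 4"] e
  obtain A1 where A1: "\<And>A. A \<ge> A1 \<Longrightarrow> I A > M - e / 4"
    by (auto simp: eventually_at_top_linorder)
  show "\<exists>A0. \<forall>A\<ge>A0. \<forall>\<^sub>F x in at_top. big_jumps A \<rho> \<rho> x \<le> e * tail \<rho> x"
  proof (intro exI[of _ "max A1 0"] allI impI)
    fix A assume "A \<ge> max A1 0"
    then have A: "A \<ge> A1" "A \<ge> 0" by auto
    have lim1: "((\<lambda>x. \<integral>y. indicator {..A} y * (tail \<rho> (x - y) / tail \<rho> x) \<partial>\<rho>) \<longlongrightarrow> I A) at_top"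
      unfolding I_def
    proof (rule integral_dominated_convergence_at_top)
      show "integrable \<rho> (\<lambda>y. exp (\<gamma> * A) + 1)" by simp
      show "AE y in \<rho>. ((\<lambda>x. indicator {..A} y * (tail \<rho> (x - y) / tail \<rho> x)) \<longlongrightarrow> indicator {..A} y * exp (\<gamma> * y)) at_top"
        using L[of "- _"] by (intro AE_I2 tendsto_mult tendsto_const) simp
      have "((\<lambda>x. tail \<rho> (x - A) / tail \<rho> x) \<longlongrightarrow> exp (\<gamma> * A)) at_top" using L[of "- A"] by simp
      then have "\<forall>\<^sub>F x in at_top. tail \<rho> (x - A) / tail \<rho> x < exp (\<gamma> * A) + 1"
        by (rule order_tendstoD(2)) simp
      with eventually_gt_at_top[of "0::real"]
      show "\<forall>\<^sub>F x in at_top. AE y in \<rho>. norm (indicator {..A} y * (tail \<rho> (x - y) / tail \<rho> x)) \<le> exp (\<gamma> * A) + 1"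
      proof eventually_elim
        case (elim x)
        show ?case
        proof (rule AE_I2)
          fix y
          show "norm (indicator {..A} y * (tail \<rho> (x - y) / tail \<rho> x)) \<le> exp (\<gamma> * A) + 1"
          proof (cases "y \<le> A")
            case True
            have "tail \<rho> (x - y) / tail \<rho> x \<le> tail \<rho> (x - A) / tail \<rho> x"
              using True by (intro divide_right_mono tail_antimono rd) auto
            then show ?thesis using True elim(2) by simp
          qed (simp add: add_nonneg_nonneg)
        qed
      qed
    qed measurable
    have "((\<lambda>x. tail (\<rho> \<star> \<rho>) x / tail \<rho> x - 2 * (\<integral>y. indicator {..A} y * (tail \<rho> (x - y) / tail \<rho> x) \<partial>\<rho>)) \<longlongrightarrow> 2 * M - 2 * I A) at_top"
      by (intro tendsto_intros lim1 lim2)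
    moreover have "2 * M - 2 * I A < e" using A1[OF A(1)] e by simp
    ultimately have "\<forall>\<^sub>F x in at_top. tail (\<rho> \<star> \<rho>) x / tail \<rho> x - 2 * (\<integral>y. indicator {..A} y * (tail \<rho> (x - y) / tail \<rho> x) \<partial>\<rho>) < e"
      by (rule order_tendstoD(2))
    with eventually_gt_at_top[of "0::real"] eventually_gt_at_top[of "2 * A"]
    show "\<forall>\<^sub>F x in at_top. big_jumps A \<rho> \<rho> x \<le> e * tail \<rho> x"
    proof eventually_elim
      case (elim x)
      then have "big_jumps A \<rho> \<rho> x / tail \<rho> x < e"
        by (simp add: tail_convolution_split[OF rd rd elim(2)] add_divide_distrib)
      then show ?case using pos[OF elim(1)] by (simp add: field_simps)
    qed
  qed
qed

text \<open>With \<open>\<sigma> = \<rho>\<close> the ratios converge along every sequence and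
  \<open>h\<close> is the exponential itself. The limit of the whole law is then an explicit
  positive multiple of it, and this multiple cancels in the ratio that defines
  \<open>class_L\<close>.\<close>

lemma cpois_class_L:
  assumes S: "\<rho> \<in> class_S \<gamma>" and nn: "AE x in \<rho>. 0 \<le> x" and s: "s > 0" and \<gamma>: "\<gamma> > 0"
    and eta: "real_distribution \<eta>" and mom: "\<And>K. K > 0 \<Longrightarrow> exp_moment \<eta> K < \<infinity>"
  shows "(cpois s \<rho> \<star> \<eta>) \<in> class_L \<gamma>"
proof -
  obtain M where M: "exp_moment \<rho> \<gamma> = ennreal M" "M > 0" by (rule class_S_moment[OF S], rule that)
  have rd: "real_distribution \<rho>" and pos: "\<And>x. x > 0 \<Longrightarrow> tail \<rho> x > 0"
    and L: "\<And>a. ((\<lambda>x. tail \<rho> (x + a) / tail \<rho> x) \<longlongrightarrow> exp (- \<gamma> * a)) at_top"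
    using S by (auto simp: class_S_def class_L_iff)
  obtain C D K where "big_jump_setting \<rho> (conv_pow \<rho> (Suc 0)) C D K"
  proof (rule big_jump_setting_conv_pow[OF rd nn])
    show "conv_pow \<rho> (Suc 0) \<in> class_OS" "single_big_jump (conv_pow \<rho> (Suc 0))"
      using class_S_imp_class_OS[OF S] class_S_single_big_jump[OF S nn] by (simp_all only: conv_pow_1[OF rd])
  qed (simp, rule that)
  then have set: "big_jump_setting \<rho> \<rho> C D K" by (simp only: conv_pow_1[OF rd])
  then interpret big_jump_setting \<rho> \<rho> C D K .
  interpret e: real_distribution \<eta> by (rule eta)
  let ?F = "cpois s \<rho> \<star> \<eta>"
  note rdF = real_distribution_convolution[OF real_distribution_cpois[OF s rd] eta]
  define E where "E = (\<integral>u. exp (\<gamma> * u) \<partial>\<eta>)"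
  have ie: "integrable \<eta> (\<lambda>u. exp (\<gamma> * u))"
    using mom[OF \<gamma>] unfolding exp_moment_integrable[OF eta] .
  have E: "E > 0"
  proof -
    have "E \<noteq> 0" unfolding E_def using integral_nonneg_eq_0_iff_AE[OF ie] e.AE_False by auto
    moreover have "E \<ge> 0" unfolding E_def by (intro Bochner_Integration.integral_nonneg) auto
    ultimately show ?thesis by simp
  qed
  \<comment> \<open>The factor \<open>s\<close> from the Poisson shift, times the moments of order
    \<open>\<gamma>\<close> of the compound Poisson law and of \<open>\<eta>\<close>.\<close>
  define b where "b = s * exp (s * (M - 1)) * E"
  have b: "b > 0" using s E by (simp add: b_def)
  have lim: "(\<lambda>k. tail ?F (X k + a) / tail \<rho> (X k)) \<longlonglongrightarrow> b * exp (- \<gamma> * a)"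
    if X: "filterlim X at_top sequentially" for X :: "nat \<Rightarrow> real" and a
  proof -
    interpret big_jump_limit \<rho> \<rho> C D K X "\<lambda>a. exp (- \<gamma> * a)"
    proof (intro big_jump_limit.intro set big_jump_limit_axioms.intro X)
      show "(\<lambda>k. tail \<rho> (X k + a) / tail \<rho> (X k)) \<longlonglongrightarrow> exp (- \<gamma> * a)" for a
        by (rule filterlim_compose[OF L X])
    qed
    have hc: "hconv n x = exp (- \<gamma> * x) * M ^ n" for n x
    proof -
      have "hconv n x = (\<integral>u. exp (- \<gamma> * x) * exp (\<gamma> * u) \<partial>conv_pow \<rho> n)"
        unfolding hconv_def by (intro Bochner_Integration.integral_cong refl) (simp add: algebra_simps flip: exp_add)
      then show ?thesis
        using integral_exp_conv_pow(2)[OF rd M(1), of n] M(2) by (simp only: integral_mult_right_zero)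
    qed
    have ml: "mlim s x = s * exp (s * (M - 1)) * exp (- \<gamma> * x)" for x
      unfolding mlim_def hc by (simp add: poisson_integral_power_real s)
    have "(\<integral>u. mlim s (a - u) \<partial>\<eta>) = (\<integral>u. s * exp (s * (M - 1)) * exp (- \<gamma> * a) * exp (\<gamma> * u) \<partial>\<eta>)"
      unfolding ml by (intro Bochner_Integration.integral_cong refl) (simp add: algebra_simps flip: exp_add)
    also have "\<dots> = b * exp (- \<gamma> * a)"
      unfolding integral_mult_right_zero E_def[symmetric] by (simp add: b_def)
    finally show ?thesis using full_limit(2)[OF s eta mom[OF K], of a] by (simp only:)
  qed
  have Fpos: "tail ?F x > 0" for x
  proof -
    have "\<forall>\<^sub>F k in sequentially. tail ?F (real k + 0) / tail \<rho> (real k) > 0"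
      using order_tendstoD(1)[OF lim[OF filterlim_real_sequentially, of 0], of 0] b by simp
    moreover have "\<forall>\<^sub>F k in sequentially. real k \<ge> x"
      using filterlim_iff[THEN iffD1, OF filterlim_real_sequentially, rule_format, OF eventually_ge_at_top] .
    ultimately have "\<forall>\<^sub>F k::nat in sequentially. tail ?F x > 0"
    proof eventually_elim
      case (elim k)
      then have "tail ?F (real k) > 0" using sigma_pos[of "real k"] by (simp add: zero_less_divide_iff)
      also have "tail ?F (real k) \<le> tail ?F x" by (rule tail_antimono[OF rdF elim(2)])
      finally show ?case .
    qed
    then show ?thesis by simp
  qed
  show ?thesis
    unfolding class_L_iff
  proof (intro conjI allI impI rdF Fpos)
    fix a
    show "((\<lambda>x. tail ?F (x + a) / tail ?F x) \<longlongrightarrow> exp (- \<gamma> * a)) at_top"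
    proof (rule tendsto_at_topI_sequentially)
      fix X :: "nat \<Rightarrow> real" assume X: "filterlim X at_top sequentially"
      have "(\<lambda>k. (tail ?F (X k + a) / tail \<rho> (X k)) / (tail ?F (X k + 0) / tail \<rho> (X k)))
          \<longlonglongrightarrow> (b * exp (- \<gamma> * a)) / (b * exp (- \<gamma> * 0))"
        by (intro tendsto_divide lim X) (use b in simp)
      then show "(\<lambda>k. tail ?F (X k + a) / tail ?F (X k)) \<longlonglongrightarrow> exp (- \<gamma> * a)"
        using b sigma_pos[THEN less_imp_neq] by (simp add: divide_divide_eq_left)
    qed
  qed
qed

text \<open>Without jumps above \<open>1\<close>, \<open>levy_jump\<close> degenerates to the zero
  measure, whose powers have total mass \<open>0\<close>. The bound \<open>n \<ge> 1\<close>
  excludes the zeroth power, which is always a point mass. Thus the existence of a power that is a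
  distribution already ensures that the normalisation makes sense.\<close>

lemma levy_jump_of_conv_pow:
  assumes lm: "levy_measure \<mu> \<nu>" and n: "n \<ge> 1" and rd: "real_distribution (conv_pow (levy_jump \<nu>) n)"
  shows "emeasure \<nu> {1<..} \<noteq> 0"
proof
  have sn: "sets \<nu> = sets borel" using lm by (simp add: levy_measure_def)
  assume z: "emeasure \<nu> {1<..} = 0"
  have null: "emeasure (levy_jump \<nu>) A = 0" for A
  proof (cases "A \<in> sets borel")
    case True
    have "emeasure \<nu> ({1<..} \<inter> A) \<le> emeasure \<nu> {1<..}" using sn by (intro emeasure_mono) auto
    then show ?thesis using z True sn unfolding levy_jump_def by (subst emeasure_uniform_measure) auto
  next
    case False
    then show ?thesis using sn by (intro emeasure_notin_sets) (simp add: levy_jump_def)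
  qed
  have "sets (levy_jump \<nu>) = sets borel" using sn by (simp add: levy_jump_def)
  moreover have "finite_measure (levy_jump \<nu>)" using null by (intro finite_measureI) simp
  moreover obtain k where k: "n = Suc k" using n by (cases n) auto
  moreover have ck: "finite_measure (conv_pow (levy_jump \<nu>) j) \<and> sets (conv_pow (levy_jump \<nu>) j) = sets borel" for j
  proof (induction j)
    case 0
    then show ?case by (simp add: prob_space.finite_measure prob_space_return)
  next
    case (Suc j)
    then show ?case using calculation(1,2) by (auto intro!: convolution_finite)
  qed
  ultimately have "emeasure (conv_pow (levy_jump \<nu>) n) UNIV = (\<integral>\<^sup>+x. \<integral>\<^sup>+y. indicator UNIV (x + y) \<partial>conv_pow (levy_jump \<nu>) k \<partial>levy_jump \<nu>)"
    using convolution_emeasure'[of UNIV "levy_jump \<nu>" "conv_pow (levy_jump \<nu>) k"] by simp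
  also have "\<dots> = 0"
    using null by (subst nn_integral_0_iff_AE) (auto intro!: AE_I[of _ _ UNIV] simp: \<open>sets (levy_jump \<nu>) = sets borel\<close>)
  finally show False
    using prob_space.emeasure_space_1[OF real_distributionD(2)[OF rd]] real_distributionD(4)[OF rd] by simp
qed

section \<open>Splitting the powers of \<open>\<mu>\<close> at jump size \<open>1\<close>\<close>

lemma is_real_conv_pow_real_conv_pow:
  "is_real_conv_pow \<mu> t \<rho> \<Longrightarrow> real_conv_pow \<mu> t = \<rho>"
  unfolding real_conv_pow_def by (rule the_equality) (auto intro: is_real_conv_pow_unique)

text \<open>Restricting the Levy measure to \<open>{1<..}\<close> and its complement splits the
  exponent additively. The light part exists for every positive time, hence has roots of every
  degree, and this excludes zeros of its transform in the right half-plane.\<close>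

lemma real_conv_pow_decomposition:
  assumes lm: "levy_measure \<mu> \<nu>" and jump: "emeasure \<nu> {1<..} \<noteq> 0" and t: "t > 0"
  obtains \<eta> where "real_distribution \<eta>" "\<And>K. K > 0 \<Longrightarrow> exp_moment \<eta> K < \<infinity>"
    "\<And>w. Re w > 0 \<Longrightarrow> (\<integral>u. exp (w * complex_of_real u) \<partial>\<eta>) \<noteq> 0"
    "real_conv_pow \<mu> t = (cpois (t * measure \<nu> {1<..}) (levy_jump \<nu>) \<star> \<eta>)"
proof -
  obtain a b where sn: "sets \<nu> = sets borel" and levy: "(\<integral>\<^sup>+ x. ennreal (min 1 (x\<^sup>2)) \<partial>\<nu>) < \<infinity>"
    and a: "a \<ge> 0" and ch: "\<And>z. char \<mu> z = exp (- complex_of_real (a * z\<^sup>2 / 2) + \<i> * complex_of_real (b * z) +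
          (\<integral>x. lk_kernel z x \<partial>\<nu>))"
    using lm unfolding levy_measure_def lk_kernel_def by auto
  define \<phi> where "\<phi> z = - complex_of_real (a * z\<^sup>2 / 2) + \<i> * complex_of_real (b * z)
        + (\<integral>x. indicator {..1} x *\<^sub>R lk_kernel z x \<partial>\<nu>)" for z
  \<comment> \<open>\<open>\<psi>\<close> is the full exponent, the continuous logarithm of
    \<open>char \<mu>\<close>; \<open>\<phi>\<close> is the exponent without the jumps above
    \<open>1\<close>.\<close>
  define \<psi> where "\<psi> z = - complex_of_real (a * z\<^sup>2 / 2) + \<i> * complex_of_real (b * z) + (\<integral>x. lk_kernel z x \<partial>\<nu>)" for z
  have ex: "\<exists>\<eta>. real_distribution \<eta> \<and> (\<forall>z. char \<eta> z = exp (of_real r * \<phi> z)) \<and> (\<forall>K>0. exp_moment \<eta> K < \<infinity>)"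
    if "r > 0" for r
    using light_part_exists[OF sn levy that a, of b] unfolding \<phi>_def by metis
  obtain \<eta> where eta: "real_distribution \<eta>" "\<And>z. char \<eta> z = exp (of_real t * \<phi> z)"
    "\<And>K. K > 0 \<Longrightarrow> exp_moment \<eta> K < \<infinity>"
    using ex[OF t] by blast
  \<comment> \<open>The root of degree \<open>n\<close> is the light part at time
    \<open>t / n\<close>.\<close>
  have roots: "\<exists>\<zeta>. real_distribution \<zeta> \<and> conv_pow \<zeta> n = \<eta>" if "n \<ge> 1" for n
  proof -
    have "t / real n > 0" using t that by simp
    from ex[OF this] obtain \<zeta> where z: "real_distribution \<zeta>" "\<And>z. char \<zeta> z = exp (of_real (t / real n) * \<phi> z)" by blast
    have "conv_pow \<zeta> n = \<eta>"
    proof (intro Levy_uniqueness real_distribution_conv_pow z eta ext)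
      fix x
      have "char (conv_pow \<zeta> n) x = exp (of_nat n * (of_real (t / real n) * \<phi> x))"
        by (simp only: char_conv_pow[OF z(1)] z(2) exp_of_nat_mult)
      also have "of_nat n * (of_real (t / real n) * \<phi> x) = of_real t * \<phi> x" using that by simp
      finally show "char (conv_pow \<zeta> n) x = char \<eta> x" by (simp only: eta(2))
    qed
    with z(1) show ?thesis by blast
  qed
  let ?A = "{1::real<..}"
  have Af: "emeasure \<nu> ?A < \<infinity>" by (rule emeasure_nu_finite[OF sn levy, of _ 1]) auto
  have l: "measure \<nu> ?A > 0" by (rule measure_pos[OF Af jump])
  have rdj: "real_distribution (levy_jump \<nu>)"
    unfolding levy_jump_def by (rule real_distribution_uniform_measure[OF sn _ Af jump]) simp
  let ?F = "cpois (t * measure \<nu> ?A) (levy_jump \<nu>) \<star> \<eta>"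
  have rdp: "real_distribution (cpois (t * measure \<nu> ?A) (levy_jump \<nu>))"
    by (rule real_distribution_cpois[OF _ rdj]) (use t l in simp)
  have "is_real_conv_pow \<mu> t ?F"
    unfolding is_real_conv_pow_def
  proof (intro conjI exI[of _ \<psi>] allI)
    show "real_distribution ?F" by (rule real_distribution_convolution[OF rdp eta(1)])
    show "continuous_on UNIV \<psi>"
      unfolding \<psi>_def by (intro continuous_intros continuous_lk_integral[OF sn levy]) auto
    show "\<psi> 0 = 0" by (simp add: \<psi>_def lk_kernel_def)
    fix z
    show "char \<mu> z = exp (\<psi> z)" by (simp add: ch \<psi>_def)
    have "(\<integral>x. lk_kernel z x \<partial>\<nu>) = (\<integral>x. indicator ({..1} \<union> ?A) x *\<^sub>R lk_kernel z x \<partial>\<nu>)"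
      by (intro Bochner_Integration.integral_cong refl) (auto simp: indicator_def)
    also have "\<dots> = (\<integral>x. indicator {..1} x *\<^sub>R lk_kernel z x \<partial>\<nu>) + (\<integral>x. indicator ?A x *\<^sub>R lk_kernel z x \<partial>\<nu>)"
      by (rule integral_lk_kernel_Un[OF sn levy]) auto
    also have "(\<integral>x. indicator ?A x *\<^sub>R lk_kernel z x \<partial>\<nu>) = (\<integral>x. indicator ?A x *\<^sub>R (iexp (z * x) - 1) \<partial>\<nu>)"
      by (rule integral_lk_kernel_large[OF sn levy]) auto
    finally have "\<psi> z = \<phi> z + (\<integral>x. indicator ?A x *\<^sub>R (iexp (z * x) - 1) \<partial>\<nu>)"
      by (simp add: \<psi>_def \<phi>_def)
    then show "char ?F z = exp (of_real t * \<psi> z)"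
      unfolding char_convolution[OF rdp eta(1)] eta(2)
      using char_cpois_uniform[OF sn _ Af jump t, of z, folded levy_jump_def]
      by (simp add: distrib_left exp_add mult.commute)
  qed
  then have "real_conv_pow \<mu> t = ?F" by (rule is_real_conv_pow_real_conv_pow)
  with eta(1,3) mgf_nonzero[OF eta(1,3) roots] show ?thesis using that by blast
qed

theorem proposition1p3:
  fixes \<gamma> :: real and \<mu> \<nu> :: "real measure"
  assumes "\<gamma> > 0"
    and "\<mu> \<in> class_OS \<inter> class_ID"
    and "levy_measure \<mu> \<nu>"
    and "\<exists>n\<^sub>1\<ge>1. conv_pow (levy_jump \<nu>) n\<^sub>1 \<in> class_S_sharp"
  shows "(T_set \<mu> \<gamma> = {0<..} \<or> T_set \<mu> \<gamma> = {}) \<and>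
         (T_set \<mu> \<gamma> = {0<..} \<longleftrightarrow> levy_jump \<nu> \<in> class_S \<gamma>)"
proof -
  let ?\<rho> = "levy_jump \<nu>" and ?A = "{1::real<..}"
  obtain n where n: "n \<ge> 1" "conv_pow ?\<rho> n \<in> class_S_sharp" using assms(4) by blast
  then have OS: "conv_pow ?\<rho> n \<in> class_OS" by (simp add: class_S_sharp_def)
  have sn: "sets \<nu> = sets borel" and levy: "(\<integral>\<^sup>+ x. ennreal (min 1 (x\<^sup>2)) \<partial>\<nu>) < \<infinity>"
    using assms(3) by (auto simp: levy_measure_def)
  have jump: "emeasure \<nu> ?A \<noteq> 0"
    using levy_jump_of_conv_pow[OF assms(3) n(1)] OS by (simp add: class_OS_def)
  have Af: "emeasure \<nu> ?A < \<infinity>" by (rule emeasure_nu_finite[OF sn levy, of _ 1]) auto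
  have l: "measure \<nu> ?A > 0" by (rule measure_pos[OF Af jump])
  have rd: "real_distribution ?\<rho>"
    unfolding levy_jump_def by (rule real_distribution_uniform_measure[OF sn _ Af jump]) simp
  have nn: "AE x in ?\<rho>. 0 \<le> x"
    unfolding levy_jump_def by (rule AE_uniform_measureI) (use sn in auto)
  obtain C D K where "big_jump_setting ?\<rho> (conv_pow ?\<rho> n) C D K"
    by (rule big_jump_setting_conv_pow[OF rd nn n(1) OS class_S_sharp_single_big_jump[OF n(2)]], rule that)
  then interpret big_jump_setting ?\<rho> "conv_pow ?\<rho> n" C D K .
  have S: "?\<rho> \<in> class_S \<gamma>" if "t \<in> T_set \<mu> \<gamma>" for t
  proof -
    have t: "t > 0" and L: "real_conv_pow \<mu> t \<in> class_L \<gamma>" using that by (auto simp: T_set_def)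
    let ?s = "t * measure \<nu> ?A"
    have s: "?s > 0" using t l by simp
    obtain \<eta> where eta: "real_distribution \<eta>" "\<And>K. K > 0 \<Longrightarrow> exp_moment \<eta> K < \<infinity>"
      "\<And>w. Re w > 0 \<Longrightarrow> (\<integral>u. exp (w * complex_of_real u) \<partial>\<eta>) \<noteq> 0"
      "real_conv_pow \<mu> t = (cpois ?s ?\<rho> \<star> \<eta>)"
      by (rule real_conv_pow_decomposition[OF assms(3) jump t], rule that)
    \<comment> \<open>A single term of the Poisson mixture, the one whose power is
      \<open>\<sigma>\<close>, supplies the positive constant that keeps limits relative to
      \<open>\<sigma>\<close> from vanishing.\<close>
    have low: "?s ^ n / fact n * exp (- ?s) * tail (conv_pow ?\<rho> n) x \<le> tail (cpois ?s ?\<rho>) x" for x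
    proof -
      have "(\<Sum>k\<in>{n}. (?s ^ k / fact k * exp (- ?s)) *\<^sub>R tail (conv_pow ?\<rho> k) x)
        \<le> (\<Sum>k. (?s ^ k / fact k * exp (- ?s)) *\<^sub>R tail (conv_pow ?\<rho> k) x)"
        and "(\<lambda>k. (?s ^ k / fact k * exp (- ?s)) *\<^sub>R tail (conv_pow ?\<rho> k) x) sums tail (cpois ?s ?\<rho>) x"
      proof -
        have sm: "summable (\<lambda>k. ?s ^ k / fact k * norm (tail (conv_pow ?\<rho> k) x))"
        proof (rule summable_comparison_test')
          show "summable (\<lambda>k. ?s ^ k / fact k * 1 ^ k)" by (rule summable_exp_pow)
          show "norm (?s ^ k / fact k * norm (tail (conv_pow ?\<rho> k) x)) \<le> ?s ^ k / fact k * 1 ^ k" for k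
            using mult_left_mono[OF tail_le_1[OF real_distribution_conv_pow[OF rd]], of "?s ^ k / fact k" k x] t
            by (simp add: abs_mult)
        qed
        show sums: "(\<lambda>k. (?s ^ k / fact k * exp (- ?s)) *\<^sub>R tail (conv_pow ?\<rho> k) x) sums tail (cpois ?s ?\<rho>) x"
          unfolding tail_cpois[OF s rd] by (rule poisson_integral(2)[OF s sm])
        show "(\<Sum>k\<in>{n}. (?s ^ k / fact k * exp (- ?s)) *\<^sub>R tail (conv_pow ?\<rho> k) x)
          \<le> (\<Sum>k. (?s ^ k / fact k * exp (- ?s)) *\<^sub>R tail (conv_pow ?\<rho> k) x)"
          by (rule sum_le_suminf[OF sums_summable[OF sums]]) (use t in auto)
      qed
      then show ?thesis by (simp add: sums_iff)
    qed
    show ?thesis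
      by (rule class_S_if_class_L[OF s eta(1,2,3) _ low assms(1) L[unfolded eta(4)]]) (use s in simp_all)
  qed
  have T: "T_set \<mu> \<gamma> = {0<..}" if "?\<rho> \<in> class_S \<gamma>"
  proof -
    have "real_conv_pow \<mu> t \<in> class_L \<gamma>" if t: "t > 0" for t
    proof -
      have s: "t * measure \<nu> ?A > 0" using t l by simp
      obtain \<eta> where eta: "real_distribution \<eta>" "\<And>K. K > 0 \<Longrightarrow> exp_moment \<eta> K < \<infinity>"
        "real_conv_pow \<mu> t = (cpois (t * measure \<nu> ?A) ?\<rho> \<star> \<eta>)"
        by (rule real_conv_pow_decomposition[OF assms(3) jump t], rule that)
      show ?thesis
        unfolding eta(3) by (rule cpois_class_L[OF \<open>?\<rho> \<in> class_S \<gamma>\<close> nn s assms(1) eta(1,2)])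
    qed
    then show ?thesis by (auto simp: T_set_def)
  qed
  have "T_set \<mu> \<gamma> = {} \<or> ?\<rho> \<in> class_S \<gamma>" using S by blast
  moreover have "({0<..} :: real set) \<noteq> {}" by auto
  ultimately show ?thesis using T by auto
qed

end
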